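(* Let $k\ge 2$ be an integer and let $G$ be a (simple, connected) minimally $(k,k)$-edge-connected graph of size $m\geq (432 k)^2$. (i) If $m-k\equiv 0 \pmod 2$, then $$\rho(G)\leq \frac{\sqrt{2m+2\sqrt{2k^2-2km+m^2-8k+4m+8}}}{2},$$ with equality if and only if $G\cong K^{k-2}_{2,\frac{m-k+2}{2}}$. (ii) If $m-k\equiv 1 \pmod 2$, then $$\rho(G)\leq \rho\big(K^{k-2}_{2,\frac{m-k-1}{2}}*K_3\big),$$ with equality if and only if $G\cong K^{k-2}_{2,\frac{m-k-1}{2}}*K_3$.
   Context: All graphs are finite and simple. The size of a graph is its number of edges. $\rho(G)$ denotes the spectral radius of $G$, i.e. the largest eigenvalue of its adjacency matrix $A(G)$. For an integer $l\ge 2$, the $l$-edge-connectivity $\kappa'_l(G)$ of a connected graph $G$ is the smallest number of edges whose removal leaves a graph with at least $l$ components if $|V(G)|\ge l$, and $\kappa'_l(G)=|V(G)|$ otherwise. (For $G-e$, which may be disconnected, $\kappa'_l(G-e)$ is given by the same formula.) A connected graph $G$ is $(k,l)$-edge-connected if $\kappa'_l(G)\ge k$; it is minimally $(k,l)$-edge-connected if $\kappa'_l(G)\ge k$ but $\kappa'_l(G-e)<k$ for every edge $e\in E(G)$. Here $l=k$. For a positive integer $a$, $K^{k-2}_{2,a}$ denotes the graph obtained from the disjoint union of the star $K_{1,k-2}$ and the complete bipartite graph $K_{2,a}$ by identifying the centre (the vertex of degree $k-2$) of $K_{1,k-2}$ with one of the two vertices of degree $a$ (a vertex in the part of size 2)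 of $K_{2,a}$; when $k=2$, $K_{1,0}$ is a single vertex. $K^{k-2}_{2,a}*K_3$ denotes the graph obtained from the disjoint union of $K_{1,k-2}$, a triangle $K_3$ and $K_{2,a}$ by identifying into one single vertex the centre of $K_{1,k-2}$, one vertex of the triangle, and one of the two vertices of degree $a$ (in the part of size 2) of $K_{2,a}$. *)

theory Defs
  imports
    "Graph_Theory.Graph_Theory"
    "Jordan_Normal_Form.Spectral_Radius"
begin

text \<open>
  A finite simple graph is a \<^locale>\<open>pair_graph\<close>: a finite vertex set together with a symmetric
  irreflexive set of arcs. An undirected edge is a two-element set \<open>{u, v}\<close>, corresponding to the
  two arcs \<open>(u, v)\<close> and \<open>(v, u)\<close>. Connectedness and isomorphism are the library's
  \<^const>\<open>connected\<close> and \<^const>\<open>digraph_iso\<close>.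
\<close>

definition edges :: "'a pair_pre_digraph \<Rightarrow> 'a set set" where
  "edges G = {{u, v} | u v. (u, v) \<in> parcs G}"

definition graph_size :: "'a pair_pre_digraph \<Rightarrow> nat" where
  "graph_size G = card (edges G)"

definition delete_edges :: "'a pair_pre_digraph \<Rightarrow> 'a set set \<Rightarrow> 'a pair_pre_digraph" where
  "delete_edges G F = \<lparr> pverts = pverts G, parcs = {(u, v) \<in> parcs G. {u, v} \<notin> F} \<rparr>"

text \<open>In a symmetric digraph the strongly connected components are the connected components.\<close>

definition num_components :: "'a pair_pre_digraph \<Rightarrow> nat" where
  "num_components G = card (pre_digraph.sccs (with_proj G))"

definition edge_connectivity :: "nat \<Rightarrow> 'a pair_pre_digraph \<Rightarrow> nat" where
  "edge_connectivity l G =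
    (if l \<le> card (pverts G)
     then LEAST j. \<exists>F \<subseteq> edges G. card F = j \<and> l \<le> num_components (delete_edges G F)
     else card (pverts G))"

definition edge_connected :: "nat \<Rightarrow> nat \<Rightarrow> 'a pair_pre_digraph \<Rightarrow> bool" where
  "edge_connected k l G \<longleftrightarrow> connected (with_proj G) \<and> k \<le> edge_connectivity l G"

definition minimally_edge_connected :: "nat \<Rightarrow> nat \<Rightarrow> 'a pair_pre_digraph \<Rightarrow> bool" where
  "minimally_edge_connected k l G \<longleftrightarrow>
    edge_connected k l G \<and> (\<forall>e \<in> edges G. edge_connectivity l (delete_edges G {e}) < k)"

text \<open>
  The adjacency matrix depends on an enumeration of the vertices, which is chosen arbitrarily;
  a different choice conjugates the matrix by a permutation matrix and so has the same eigenvalues.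
\<close>

definition vertex_list :: "'a pair_pre_digraph \<Rightarrow> 'a list" where
  "vertex_list G = (SOME vs. distinct vs \<and> set vs = pverts G)"

definition adjacency_matrix :: "'a pair_pre_digraph \<Rightarrow> real mat" where
  "adjacency_matrix G =
    mat (card (pverts G)) (card (pverts G))
      (\<lambda>(i, j). if (vertex_list G ! i, vertex_list G ! j) \<in> parcs G then 1 else 0)"

text \<open>
  The largest eigenvalue. Since the matrix is real symmetric, its real spectrum contains all of its
  eigenvalues; it is nonempty whenever the graph has a vertex.
\<close>

definition spectral_rad :: "'a pair_pre_digraph \<Rightarrow> real" (\<open>\<rho>\<close>) where
  "\<rho> G = Max (spectrum (adjacency_matrix G))"

abbreviation graph_iso :: "'a pair_pre_digraph \<Rightarrow> 'b pair_pre_digraph \<Rightarrow> bool" (infix \<open>\<cong>\<^sub>g\<close> 50) where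
  "G \<cong>\<^sub>g H \<equiv> digraph_iso (with_proj G) (with_proj H)"

text \<open>
  The extremal graphs, given by representatives in which the identifications are already carried
  out. \<open>Centre\<close> is the identified vertex: the centre of the star with leaves \<open>Leaf i\<close>, one of the two
  vertices in the part of size 2 of \<open>K\<^bsub>2,a\<^esub>\<close> (the other is \<open>Opposite\<close>, and the part of size \<open>a\<close>
  consists of the vertices \<open>Mid j\<close>), and, if present, a vertex of the triangle with further vertices
  \<open>Tri1\<close> and \<open>Tri2\<close>.
\<close>

datatype kvertex = Centre | Opposite | Leaf nat | Mid nat | Tri1 | Tri2

definition undirected :: "'a set \<Rightarrow> ('a \<times> 'a) set \<Rightarrow> 'a pair_pre_digraph" where
  "undirected V R = \<lparr> pverts = V, parcs = R \<union> R\<inverse> \<rparr>"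

definition star_K2_verts :: "nat \<Rightarrow> nat \<Rightarrow> kvertex set" where
  "star_K2_verts s a = {Centre, Opposite} \<union> Leaf ` {..<s} \<union> Mid ` {..<a}"

definition star_K2_arcs :: "nat \<Rightarrow> nat \<Rightarrow> (kvertex \<times> kvertex) set" where
  "star_K2_arcs s a = {Centre} \<times> Leaf ` {..<s} \<union> {Centre, Opposite} \<times> Mid ` {..<a}"

text \<open>
  With \<open>s = k - 2\<close>, \<open>star_K2 s a\<close> is \<open>K\<^bsub>1,s\<^esub>\<close> and \<open>K\<^bsub>2,a\<^esub>\<close> glued at \<open>Centre\<close>;
  \<open>star_K2_triangle s a\<close> has a triangle glued to the same vertex as well.
\<close>

definition star_K2 :: "nat \<Rightarrow> nat \<Rightarrow> kvertex pair_pre_digraph" where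
  "star_K2 s a = undirected (star_K2_verts s a) (star_K2_arcs s a)"

definition star_K2_triangle :: "nat \<Rightarrow> nat \<Rightarrow> kvertex pair_pre_digraph" where
  "star_K2_triangle s a =
    undirected (star_K2_verts s a \<union> {Tri1, Tri2})
      (star_K2_arcs s a \<union> {(Centre, Tri1), (Centre, Tri2), (Tri1, Tri2)})"

lemma pair_graph_undirected:
  assumes "finite V" and R: "R \<subseteq> V \<times> V" and "irrefl R"
  shows "pair_graph (undirected V R)"
proof
  have "finite R" using assms(1) R by (meson finite_SigmaI finite_subset)
  then show "finite (parcs (undirected V R))" by (simp add: undirected_def)
  show "finite (pverts (undirected V R))" using assms(1) by (simp add: undirected_def)
  show "symmetric (with_proj (undirected V R))"
    by (simp add: undirected_def symmetric_def sym_Un_converse)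
  fix e assume "e \<in> parcs (undirected V R)"
  then have e: "e \<in> R \<or> (snd e, fst e) \<in> R" by (cases e) (simp add: undirected_def)
  show "fst e \<in> pverts (undirected V R)" "snd e \<in> pverts (undirected V R)"
    using e R by (cases e; simp add: undirected_def; blast)+
  show "fst e \<noteq> snd e"
    using e assms(3) by (cases e) (auto simp: irrefl_def)
qed

lemma pair_graph_star_K2: "pair_graph (star_K2 s a)"
  unfolding star_K2_def
proof (rule pair_graph_undirected, goal_cases)
  case 1 show ?case by (simp add: star_K2_verts_def)
next
  case 2 show ?case unfolding star_K2_verts_def star_K2_arcs_def by blast
next
  case 3 show ?case unfolding star_K2_arcs_def by (simp add: irrefl_def) blast
qed

lemma pair_graph_star_K2_triangle: "pair_graph (star_K2_triangle s a)"
  unfolding star_K2_triangle_def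
proof (rule pair_graph_undirected, goal_cases)
  case 1 show ?case by (simp add: star_K2_verts_def)
next
  case 2 show ?case unfolding star_K2_verts_def star_K2_arcs_def by blast
next
  case 3 show ?case unfolding star_K2_arcs_def by (simp add: irrefl_def) blast
qed

end

theory Submission
  imports Defs "HOL-Analysis.Function_Topology"
begin

text \<open>
  Put \<open>s = k - 2\<close>. Deleting \<open>k - 1\<close> edges from a connected graph leaves \<open>k\<close> components only if every
  deleted edge is a bridge. So a connected graph is \<open>(k, k)\<close>-edge-connected iff it has at most \<open>s\<close>
  bridges (and at least \<open>k\<close> vertices), and minimality says that deleting any non-bridge creates more
  than \<open>s\<close> bridges. A new bridge \<open>f\<close> of \<open>G - ab\<close> separates \<open>a\<close> from \<open>b\<close> in \<open>G - ab - f\<close>; hence no edge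
  \<open>ab\<close> has two edge-disjoint \<open>a\<close>-\<open>b\<close> paths that avoid it (\<open>no_two_edge_disjoint_paths\<close>). This single
  property excludes all the small configurations that matter: two triangles on an edge, a triangle
  and a 4-cycle on an edge, two 4-cycles on an edge with nothing else in common. Moreover a \<open>K\<^bsub>2,3\<^esub>\<close>
  forces exactly \<open>s\<close> bridges (\<open>many_bridges_of_K23\<close>).

  Let \<open>l\<close> be the spectral radius of a graph \<open>G\<close> of this kind with \<open>m\<close> edges, at least as large as that
  of the extremal graph; then \<open>l\<^sup>2 \<ge> m - s / 2 - 2\<close>. Scale the Perron vector \<open>x\<close> to have maximum 1,
  attained at \<open>u\<close>. Expanding \<open>l\<^sup>2 = l\<^sup>2 x u\<close> along walks of length 2 charges every edge with at most
  about 1: an edge from the neighbourhood \<open>N\<close> of \<open>u\<close> to a vertex \<open>w\<close> at distance 2 contributes only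
  \<open>x w\<close>, and an edge inside \<open>N\<close> or off \<open>N\<close> contributes almost nothing. Since only \<open>O(k)\<close> may be lost in
  total, almost all edges off \<open>u\<close> end in vertices \<open>w\<close> with \<open>x w\<close> near 1. The vertices with three or
  more neighbours in \<open>N\<close> use disjoint parts of \<open>N\<close>, so their entries sum to about 1 at most and only
  one of them can have a large entry. Hence all but \<open>O(k)\<close> edges form a \<open>K\<^bsub>2,c\<^esub>\<close> with hubs \<open>u\<close> and \<open>w\<close>
  (\<open>large_common_neighbourhood\<close>).

  Adding the eigenvalue equations at the two hubs prices the remaining edges: one at a hub costs
  about \<open>1/2\<close> of \<open>m - l\<^sup>2\<close>, any other one almost 1 (\<open>extra_edges_cost\<close>). The \<open>s\<close> bridges lie outside
  \<open>K\<^bsub>2,c\<^esub>\<close> and cost at least \<open>s / 2\<close>. If \<open>m - k\<close> is even nothing more may be lost, so \<open>G\<close> is \<open>K\<^bsub>2,c\<^esub>\<close> with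
  \<open>s\<close> pendant edges at the hubs (\<open>no_extra_cost\<close>). If \<open>m - k\<close> is odd there is room for three more
  edges, exactly one of them off the hubs: a triangle at a hub or a path of length 3 between the hubs
  (\<open>odd_extra_structure\<close>).

  In each case the eigenvalue equations can be solved. With \<open>q = l\<^sup>2 - c\<close> the extremal graphs satisfy
  \<open>(q - s) q = c\<^sup>2\<close> and \<open>(q - s - 2 l / (l - 1)) q = c\<^sup>2\<close>, and the other distributions of the extra edges
  make the left side strictly smaller. As the left side exceeds \<open>c\<^sup>2\<close> for large \<open>l\<close>, a root of the
  extremal equation lies above \<open>l\<close>; it belongs to a positive eigenfunction and so is the spectral
  radius of the extremal graph.
\<close>

section \<open>Components and bridges\<close>

definition remove_edges :: "'a rel \<Rightarrow> 'a set set \<Rightarrow> 'a rel" where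
  "remove_edges R F = {(u, v) \<in> R. {u, v} \<notin> F}"

definition rel_edges :: "'a rel \<Rightarrow> 'a set set" where
  "rel_edges R = {{u, v} | u v. (u, v) \<in> R}"

definition component_classes :: "'a set \<Rightarrow> 'a rel \<Rightarrow> 'a set set" where
  "component_classes V R = (\<lambda>v. R\<^sup>* `` {v}) ` V"

definition bridges :: "'a rel \<Rightarrow> 'a set set" where
  "bridges R = {e. \<exists>u v. e = {u, v} \<and> (u, v) \<in> R \<and> (u, v) \<notin> (remove_edges R {e})\<^sup>*}"

lemma remove_edges_subset: "remove_edges R F \<subseteq> R"
  by (auto simp: remove_edges_def)

lemma remove_edges_remove_edges: "remove_edges (remove_edges R F) F' = remove_edges R (F \<union> F')"
  by (auto simp: remove_edges_def)

lemma remove_edges_empty [simp]: "remove_edges R {} = R"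
  by (auto simp: remove_edges_def)

lemma sym_remove_edges: "sym R \<Longrightarrow> sym (remove_edges R F)"
  by (auto simp: remove_edges_def sym_def insert_commute)

lemma rel_edges_remove_edges: "rel_edges (remove_edges R F) = rel_edges R - F"
  by (auto simp: remove_edges_def rel_edges_def)

lemma in_rel_edges: "sym R \<Longrightarrow> {u, v} \<in> rel_edges R \<longleftrightarrow> (u, v) \<in> R"
  by (auto simp: rel_edges_def doubleton_eq_iff sym_def)

lemma finite_rel_edges: "finite R \<Longrightarrow> finite (rel_edges R)"
proof -
  assume "finite R"
  moreover have "rel_edges R = (\<lambda>(u, v). {u, v}) ` R" by (auto simp: rel_edges_def)
  ultimately show ?thesis by simp
qed

lemma rtrancl_sym: "sym R \<Longrightarrow> (a, b) \<in> R\<^sup>* \<Longrightarrow> (b, a) \<in> R\<^sup>*"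
  by (metis sym_rtrancl symD)

lemma bridge_iff:
  assumes "sym R"
  shows "{u, v} \<in> bridges R \<longleftrightarrow> (u, v) \<in> R \<and> (u, v) \<notin> (remove_edges R {{u, v}})\<^sup>*"
proof
  assume "{u, v} \<in> bridges R"
  then obtain a b where ab: "{u, v} = {a, b}" "(a, b) \<in> R" "(a, b) \<notin> (remove_edges R {{u, v}})\<^sup>*"
    by (auto simp: bridges_def)
  from ab(1) consider "u = a" "v = b" | "u = b" "v = a" by (auto simp: doubleton_eq_iff)
  then show "(u, v) \<in> R \<and> (u, v) \<notin> (remove_edges R {{u, v}})\<^sup>*"
    by cases (use ab assms rtrancl_sym[OF sym_remove_edges[OF assms]] in \<open>auto dest: symD\<close>)
qed (auto simp: bridges_def)

lemma bridges_subset: "bridges R \<subseteq> rel_edges R"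
  by (auto simp: bridges_def rel_edges_def)

text \<open>
  A walk that uses the deleted edge reaches an end of it before its first use and leaves from an end
  after its last use.
\<close>

lemma rtrancl_remove_edge_cases:
  assumes "sym R" "(x, y) \<in> R\<^sup>*" and R': "R' = remove_edges R {{a, b}}"
  shows "(x, y) \<in> R'\<^sup>* \<or> ((x, a) \<in> R'\<^sup>* \<or> (x, b) \<in> R'\<^sup>*) \<and> ((y, a) \<in> R'\<^sup>* \<or> (y, b) \<in> R'\<^sup>*)"
  using assms(2)
proof induction
  case base
  then show ?case by simp
next
  case (step y z)
  note s = rtrancl_sym[OF sym_remove_edges[OF assms(1)], of _ _ "{{a, b}}", folded R']
  show ?case
  proof (cases "{y, z} = {a, b}")
    case True
    then have "y = a \<and> z = b \<or> y = b \<and> z = a" by (auto simp: doubleton_eq_iff)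
    then show ?thesis using step.IH by auto
  next
    case False
    then have yz: "(y, z) \<in> R'" using step.hyps by (auto simp: R' remove_edges_def)
    then have zy: "(z, y) \<in> R'\<^sup>*" using s by blast
    from step.IH show ?thesis
      using yz zy by (meson rtrancl.rtrancl_into_rtrancl rtrancl_trans)
  qed
qed

text \<open>
  If both ends stay connected, the classes are unchanged; otherwise the class of the edge is split
  into the two classes of its ends.
\<close>

text \<open>
  If the ends of the edge stay connected, the classes do not change; otherwise the class of the edge
  splits into the classes of its two ends.
\<close>

lemma card_component_classes_remove_edge:
  assumes "finite V" "R \<subseteq> V \<times> V" "sym R" "(a, b) \<in> R"
  shows "card (component_classes V (remove_edges R {{a, b}})) =
    card (component_classes V R) + (if {a, b} \<in> bridges R then 1 else 0)"
proof -
  define R' where "R' = remove_edges R {{a, b}}"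
  define c where "c v = R\<^sup>* `` {v}" for v
  define c' where "c' v = R'\<^sup>* `` {v}" for v
  define M where "M = c' a \<union> c' b"
  have s: "(x, y) \<in> R'\<^sup>* \<Longrightarrow> (y, x) \<in> R'\<^sup>*" for x y
    unfolding R'_def by (rule rtrancl_sym[OF sym_remove_edges[OF assms(3)]])
  have sub: "R'\<^sup>* \<subseteq> R\<^sup>*" unfolding R'_def by (rule rtrancl_mono[OF remove_edges_subset])
  have ab: "(a, b) \<in> R\<^sup>*" "(b, a) \<in> R\<^sup>*" using assms(3,4) by (auto dest: symD)
  have V: "a \<in> V" "b \<in> V" using assms by auto
  have cases: "(x, y) \<in> R\<^sup>* \<Longrightarrow> (x, y) \<in> R'\<^sup>* \<or> x \<in> M \<and> y \<in> M" for x y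
    using rtrancl_remove_edge_cases[OF assms(3) _ R'_def, of x y] s by (auto simp: M_def c'_def)
  have MM: "x \<in> M \<Longrightarrow> y \<in> M \<Longrightarrow> (x, y) \<in> R\<^sup>*" for x y
    using s sub ab by (auto simp: M_def c'_def) (meson rtrancl_trans subsetD)+
  have c_eq: "c v = (if v \<in> M then M else c' v)" for v
  proof (cases "v \<in> M")
    case True
    have "y \<in> M" if "(v, y) \<in> R'\<^sup>*" for y
      using True that by (auto simp: M_def c'_def intro: rtrancl_trans)
    then show ?thesis using True cases MM by (auto simp: c_def)
  next
    case False
    then show ?thesis using cases sub by (auto simp: c_def c'_def)
  qed
  have c'_eqI: "c' x = c' y" if "(x, y) \<in> R'\<^sup>*" for x y
    using that s by (auto simp: c'_def intro: rtrancl_trans)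
  have c'_M: "c' v \<in> {c' a, c' b} \<longleftrightarrow> v \<in> M" for v
  proof
    assume "c' v \<in> {c' a, c' b}"
    moreover have "v \<in> c' v" by (simp add: c'_def)
    ultimately show "v \<in> M" by (auto simp: M_def)
  next
    assume "v \<in> M"
    then have "(a, v) \<in> R'\<^sup>* \<or> (b, v) \<in> R'\<^sup>*" by (auto simp: M_def c'_def)
    then show "c' v \<in> {c' a, c' b}" using c'_eqI[of a v] c'_eqI[of b v] by auto
  qed
  have aM: "a \<in> M" by (simp add: M_def c'_def)
  have eq: "c ` V = insert M (c' ` V - {c' a, c' b})"
  proof
    show "c ` V \<subseteq> insert M (c' ` V - {c' a, c' b})"
      using c'_M c_eq by auto
    show "insert M (c' ` V - {c' a, c' b}) \<subseteq> c ` V"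
    proof
      fix S assume "S \<in> insert M (c' ` V - {c' a, c' b})"
      then consider "S = M" | v where "v \<in> V" "S = c' v" "c' v \<notin> {c' a, c' b}" by blast
      then show "S \<in> c ` V"
      proof cases
        case 1
        then have "S = c a" using c_eq[of a] aM by simp
        then show ?thesis using V by blast
      next
        case 2
        then have "S = c v" using c_eq[of v] c'_M[of v] by simp
        then show ?thesis using 2 by blast
      qed
    qed
  qed
  have bridge: "{a, b} \<in> bridges R \<longleftrightarrow> (a, b) \<notin> R'\<^sup>*"
    using bridge_iff[OF assms(3)] assms(4) by (simp add: R'_def)
  have fin: "finite (c' ` V)" using assms(1) by simp
  have Mn: "M \<notin> c' ` V - {c' a, c' b}"
  proof
    assume "M \<in> c' ` V - {c' a, c' b}"
    then obtain v where v: "M = c' v" "v \<notin> M" using c'_M by auto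
    then show False by (auto simp: c'_def)
  qed
  show ?thesis
  proof (cases "(a, b) \<in> R'\<^sup>*")
    case True
    then have "c' a = c' b" by (rule c'_eqI)
    then have "c' ` V = insert (c' a) (c' ` V - {c' a, c' b})" and "c' a \<notin> c' ` V - {c' a, c' b}"
      using V by auto
    then have "card (c' ` V) = Suc (card (c' ` V - {c' a, c' b}))"
      using fin by (metis card_insert_disjoint finite_Diff)
    moreover have "card (c ` V) = Suc (card (c' ` V - {c' a, c' b}))"
      using eq Mn fin by simp
    ultimately show ?thesis
      using True bridge by (simp add: component_classes_def c_def c'_def R'_def)
  next
    case False
    then have ne: "c' a \<noteq> c' b" by (auto simp: c'_def)
    have "card (c' ` V - {c' a, c' b}) = card (c' ` V) - card {c' a, c' b}"
      using V by (intro card_Diff_subset) auto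
    moreover have "card {c' a, c' b} \<le> card (c' ` V)" using V fin by (intro card_mono) auto
    ultimately have "card (c' ` V) = Suc (Suc (card (c' ` V - {c' a, c' b})))"
      using ne by simp
    moreover have "card (c ` V) = Suc (card (c' ` V - {c' a, c' b}))"
      using eq Mn fin by simp
    ultimately show ?thesis
      using False bridge by (simp add: component_classes_def c_def c'_def R'_def)
  qed
qed

lemma num_components_eq:
  assumes "pair_graph G"
  shows "num_components G = card (component_classes (pverts G) (parcs G))"
proof -
  interpret pair_graph G by fact
  have wf: "wf_digraph (with_proj G)" by unfold_locales
  have "pre_digraph.scc_of (with_proj G) v = (parcs G)\<^sup>* `` {v}" if "v \<in> pverts G" for v
  proof -
    have r: "v \<rightarrow>\<^sup>*\<^bsub>with_proj G\<^esub> w \<longleftrightarrow> (v, w) \<in> (parcs G)\<^sup>*" for w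
    proof
      assume "(v, w) \<in> (parcs G)\<^sup>*"
      then show "v \<rightarrow>\<^sup>*\<^bsub>with_proj G\<^esub> w"
      proof induction
        case base then show ?case using that by simp
      next
        case (step y z)
        then have "y \<rightarrow>\<^bsub>with_proj G\<^esub> z" by simp
        with step.IH show ?case using wf_digraph.reachable_adj_trans[OF wf] by blast
      qed
    qed (use reachable_rtranclI[of "with_proj G" v w] in simp)
    then show ?thesis
      using symmetric_reachable[OF sym_arcs] by (auto simp: scc_of_def)
  qed
  then show ?thesis
    by (simp add: num_components_def component_classes_def card_sccs_verts[symmetric]
        sccs_verts_conv_scc_of cong: image_cong)
qed

lemma connected_parcs:
  assumes "pair_graph G" "connected (with_proj G)" "u \<in> pverts G" "v \<in> pverts G"
  shows "(u, v) \<in> (parcs G)\<^sup>*"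
proof -
  interpret pair_graph G by fact
  have "strongly_connected (mk_symmetric (with_proj G))" using assms(2) by (simp add: connected_def)
  then have "u \<rightarrow>\<^sup>*\<^bsub>mk_symmetric (with_proj G)\<^esub> v" using assms(3,4)
    by (auto simp: strongly_connected_def mk_symmetric_def)
  then have "(u, v) \<in> (parcs (mk_symmetric (with_proj G)))\<^sup>*"
    using reachable_rtranclI[of "with_proj (mk_symmetric (with_proj G))" u v] by simp
  moreover have "parcs (mk_symmetric (with_proj G)) = parcs G"
    using sym_arcs by (auto simp: parcs_mk_symmetric symmetric_def sym_def)
  ultimately show ?thesis by simp
qed

section \<open>Bridge-critical graphs\<close>

lemma bridges_remove_edges:
  assumes "e \<in> bridges R" "e \<notin> F"
  shows "e \<in> bridges (remove_edges R F)"
proof -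
  obtain u v where e: "e = {u, v}" "(u, v) \<in> R" "(u, v) \<notin> (remove_edges R {e})\<^sup>*"
    using assms(1) by (auto simp: bridges_def)
  have "remove_edges (remove_edges R F) {e} \<subseteq> remove_edges R {e}" by (auto simp: remove_edges_def)
  then have "(u, v) \<notin> (remove_edges (remove_edges R F) {e})\<^sup>*" using e(3) rtrancl_mono by blast
  moreover have "(u, v) \<in> remove_edges R F" using e assms(2) by (auto simp: remove_edges_def)
  ultimately show ?thesis using e(1) by (auto simp: bridges_def)
qed

text \<open>
  A bridge stays a bridge when other edges are deleted, so deleting bridges one at a time creates a
  component each time.
\<close>

lemma card_component_classes_remove_edges:
  assumes "finite V" "R \<subseteq> V \<times> V" "sym R" "finite F" "F \<subseteq> rel_edges R"
  shows card_component_classes_remove_le: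
      "card (component_classes V (remove_edges R F)) \<le> card (component_classes V R) + card F"
    and card_component_classes_remove_bridges: "F \<subseteq> bridges R \<Longrightarrow>
      card (component_classes V (remove_edges R F)) = card (component_classes V R) + card F"
proof -
  have "card (component_classes V (remove_edges R F)) \<le> card (component_classes V R) + card F \<and>
    (F \<subseteq> bridges R \<longrightarrow>
      card (component_classes V (remove_edges R F)) = card (component_classes V R) + card F)"
    using assms(4,5)
  proof (induction F rule: finite_induct)
    case empty
    then show ?case by simp
  next
    case (insert e F)
    let ?R = "remove_edges R F"
    obtain a b where e: "e = {a, b}" "(a, b) \<in> R" using insert.prems by (auto simp: rel_edges_def)
    have ab: "(a, b) \<in> ?R" using e insert.hyps by (auto simp: remove_edges_def)
    have "remove_edges R (insert e F) = remove_edges ?R {{a, b}}"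
      using e by (simp add: remove_edges_remove_edges)
    moreover have "card (component_classes V (remove_edges ?R {{a, b}})) =
        card (component_classes V ?R) + (if {a, b} \<in> bridges ?R then 1 else 0)"
      using assms(1-3) ab remove_edges_subset[of R F] sym_remove_edges
      by (intro card_component_classes_remove_edge) auto
    moreover have "{a, b} \<in> bridges R \<Longrightarrow> {a, b} \<in> bridges ?R"
      using bridges_remove_edges[of e R F] insert.hyps e by simp
    ultimately show ?case using insert e by auto
  qed
  then show "card (component_classes V (remove_edges R F)) \<le> card (component_classes V R) + card F"
    and "F \<subseteq> bridges R \<Longrightarrow>
      card (component_classes V (remove_edges R F)) = card (component_classes V R) + card F"
    by auto
qed

lemma component_classes_connected:
  assumes "V \<noteq> {}" "R \<subseteq> V \<times> V" "\<And>u v. u \<in> V \<Longrightarrow> v \<in> V \<Longrightarrow> (u, v) \<in> R\<^sup>*"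
  shows "component_classes V R = {V}"
proof -
  have "w \<in> V" if "v \<in> V" "(v, w) \<in> R\<^sup>*" for v w
    using that(2,1) by induction (use assms(2) in auto)
  then have "R\<^sup>* `` {v} = V" if "v \<in> V" for v using that assms(3) by blast
  then show ?thesis using assms(1) by (auto simp: component_classes_def)
qed

lemma component_classes_no_edges: "card (component_classes V {}) = card V"
proof -
  have "component_classes V {} = (\<lambda>v. {v}) ` V" by (auto simp: component_classes_def)
  then show ?thesis by (simp add: card_image)
qed

lemma pair_graph_delete_edges: 
  assumes "pair_graph G" shows "pair_graph (delete_edges G F)"
proof -
  interpret pair_graph G by fact
  show ?thesis
  proof
    fix e assume "e \<in> parcs (delete_edges G F)"
    then have "e \<in> parcs G" by (auto simp: delete_edges_def)
    then show "fst e \<in> pverts (delete_edges G F)" "snd e \<in> pverts (delete_edges G F)"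
      "fst e \<noteq> snd e"
      using in_arcsD1 in_arcsD2 no_loops by (cases e; auto simp: delete_edges_def)+
  next
    show "finite (pverts (delete_edges G F))" by (simp add: delete_edges_def)
    have "parcs (delete_edges G F) \<subseteq> parcs G" by (auto simp: delete_edges_def)
    then show "finite (parcs (delete_edges G F))" by (rule finite_subset) (use finite_arcs in simp)
    have "sym (parcs G)" using sym_arcs by (simp add: symmetric_def)
    then show "symmetric (with_proj (delete_edges G F))"
      by (auto simp: symmetric_def sym_def delete_edges_def insert_commute)
  qed
qed

text \<open>
  The form in which \<open>(s + 2, s + 2)\<close>-minimality is used: few bridges, but too many after the deletion
  of any other edge.
\<close>

locale bridge_critical_graph =
  fixes V :: "'a set" and R :: "'a rel" and s :: nat
  assumes finite_V: "finite V" and R_sub: "R \<subseteq> V \<times> V" and sym_R: "sym R" and irrefl_R: "irrefl R"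
    and connected: "\<And>u v. u \<in> V \<Longrightarrow> v \<in> V \<Longrightarrow> (u, v) \<in> R\<^sup>*"
    and few_bridges: "card (bridges R) \<le> s"
    and critical: "\<And>e. e \<in> rel_edges R \<Longrightarrow> e \<notin> bridges R \<Longrightarrow> s < card (bridges (remove_edges R {e}))"

text \<open>
  Both directions of the translation count components: \<open>k - 1\<close> bridges would give \<open>k\<close> components. For
  a non-bridge \<open>e\<close> the graph \<open>G - e\<close> is connected, so \<open>k - 1\<close> further edges whose deletion leaves \<open>k\<close>
  components must all be bridges of \<open>G - e\<close>, because each of them has to create a component.
\<close>

lemma bridge_critical_graph_of_minimally_edge_connected:
  assumes k: "k \<ge> 2" and G: "pair_graph G" and min: "minimally_edge_connected k k G"
  shows "bridge_critical_graph (pverts G) (parcs G) (k - 2)"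
proof -
  interpret pair_graph G by fact
  let ?V = "pverts G" and ?R = "parcs G"
  have conn: "connected (with_proj G)" and ge: "k \<le> edge_connectivity k G"
    and lt: "\<And>e. e \<in> edges G \<Longrightarrow> edge_connectivity k (delete_edges G {e}) < k"
    using min by (auto simp: minimally_edge_connected_def edge_connected_def)
  have edges: "edges (delete_edges G F) = rel_edges ?R - F" "edges G = rel_edges ?R" for F
    using rel_edges_remove_edges[of ?R F]
    by (auto simp: edges_def rel_edges_def remove_edges_def delete_edges_def)
  have finR: "finite ?R" using finite_arcs by simp
  then have finE: "finite (rel_edges ?R)" by (rule finite_rel_edges)
  have Rsub: "?R \<subseteq> ?V \<times> ?V" using in_arcsD1 in_arcsD2 by auto
  have sym: "sym ?R" using sym_arcs by (simp add: symmetric_def)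
  have comps: "num_components (delete_edges G F) = card (component_classes ?V (remove_edges ?R F))" for F
    using num_components_eq[OF pair_graph_delete_edges[OF G]]
    by (simp add: delete_edges_def remove_edges_def)
  have reach: "(u, v) \<in> ?R\<^sup>*" if "u \<in> ?V" "v \<in> ?V" for u v
    using connected_parcs[OF G conn] that by blast
  have V: "k \<le> card ?V" using ge by (auto simp: edge_connectivity_def split: if_splits)
  then have "?V \<noteq> {}" using k by auto
  then have one: "card (component_classes ?V ?R) = 1"
    using component_classes_connected[OF _ Rsub reach] by simp
  have few: "card (component_classes ?V (remove_edges ?R F)) < k"
    if F: "F \<subseteq> rel_edges ?R" "card F < k" for F
  proof (rule ccontr)
    assume "\<not> ?thesis"
    then have "\<exists>F' \<subseteq> edges G. card F' = card F \<and> k \<le> num_components (delete_edges G F')"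
      using F comps edges by (auto intro!: exI[of _ F])
    then have "(LEAST j. \<exists>F \<subseteq> edges G. card F = j \<and> k \<le> num_components (delete_edges G F)) \<le> card F"
      by (rule Least_le)
    then show False using ge V F by (simp add: edge_connectivity_def)
  qed
  have "card (bridges ?R) \<le> k - 2"
  proof (rule ccontr)
    assume "\<not> ?thesis"
    then have "k - 1 \<le> card (bridges ?R)" by simp
    then obtain F where F: "F \<subseteq> bridges ?R" "card F = k - 1"
      by (meson obtain_subset_with_card_n)
    have FE: "F \<subseteq> rel_edges ?R" using F bridges_subset by blast
    have "card (component_classes ?V (remove_edges ?R F)) = 1 + (k - 1)"
      using card_component_classes_remove_bridges[OF _ Rsub sym _ FE F(1)] one F(2)
        finite_subset[OF FE finE] by simp
    then show False using few[OF FE] F(2) k by simp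
  qed
  moreover have "k - 2 < card (bridges (remove_edges ?R {e}))"
    if e: "e \<in> rel_edges ?R" "e \<notin> bridges ?R" for e
  proof -
    let ?S = "remove_edges ?R {e}"
    have S: "?S \<subseteq> ?V \<times> ?V" "sym ?S" using Rsub sym remove_edges_subset[of ?R] sym_remove_edges by auto
    have fin: "finite (rel_edges ?S)" using finE rel_edges_remove_edges[of ?R] by auto
    obtain a b where ab: "e = {a, b}" "(a, b) \<in> ?R" using e by (auto simp: rel_edges_def)
    have one': "card (component_classes ?V ?S) = 1"
      using card_component_classes_remove_edge[OF _ Rsub sym ab(2)] ab e one by simp
    let ?H = "delete_edges G {e}"
    have dd: "delete_edges ?H F = delete_edges G (insert e F)" for F
      by (auto simp: delete_edges_def)
    have "card (pverts ?H) = card ?V" by (simp add: delete_edges_def)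
    then have "(LEAST j. \<exists>F \<subseteq> edges ?H. card F = j \<and> k \<le> num_components (delete_edges ?H F)) < k"
      using lt[of e] e V edges by (simp add: edge_connectivity_def)
    moreover have "\<exists>j. \<exists>F \<subseteq> edges ?H. card F = j \<and> k \<le> num_components (delete_edges ?H F)"
    proof (intro exI conjI)
      show "edges ?H \<subseteq> edges ?H" ..
      show "card (edges ?H) = card (edges ?H)" ..
      have "remove_edges ?R (insert e (edges ?H)) = {}"
        using edges(1)[of "{e}"] by (auto simp: remove_edges_def rel_edges_def)
      then show "k \<le> num_components (delete_edges ?H (edges ?H))"
        using V dd comps component_classes_no_edges by metis
    qed
    ultimately obtain F where F: "F \<subseteq> edges ?H" "card F < k" "k \<le> num_components (delete_edges ?H F)"
      using LeastI_ex[of "\<lambda>j. \<exists>F \<subseteq> edges ?H. card F = j \<and> k \<le> num_components (delete_edges ?H F)"]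
      by auto
    have FS: "F \<subseteq> rel_edges ?S" using F(1) edges(1) rel_edges_remove_edges by metis
    then have finF: "finite F" using fin finite_subset by blast
    have "k \<le> card (component_classes ?V (remove_edges ?S F))"
      using F(3) dd comps by (simp add: remove_edges_remove_edges)
    then have kF: "k \<le> card (component_classes ?V (remove_edges ?S F))" .
    also have "\<dots> \<le> 1 + card F"
      using card_component_classes_remove_le[OF _ S finF FS] one' by simp
    finally have cF: "card F = k - 1" using F(2) by simp
    have "F \<subseteq> bridges ?S"
    proof
      fix f assume f: "f \<in> F"
      show "f \<in> bridges ?S"
      proof (rule ccontr)
        assume nf: "f \<notin> bridges ?S"
        obtain c d where cd: "f = {c, d}" "(c, d) \<in> ?S" using f FS by (auto simp: rel_edges_def)
        let ?T = "remove_edges ?S {f}"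
        have T: "?T \<subseteq> ?V \<times> ?V" "sym ?T" using S remove_edges_subset[of ?S] sym_remove_edges by auto
        have "card (component_classes ?V ?T) = 1"
          using card_component_classes_remove_edge[OF _ S cd(2)] cd nf one' by simp
        moreover have "remove_edges ?T (F - {f}) = remove_edges ?S F"
          using f by (simp add: remove_edges_remove_edges insert_commute[of f e] insert_absorb)
        moreover have "F - {f} \<subseteq> rel_edges ?T" using FS rel_edges_remove_edges by blast
        ultimately have "card (component_classes ?V (remove_edges ?S F)) \<le> 1 + card (F - {f})"
          using card_component_classes_remove_le[OF _ T, of "F - {f}"] finF by simp
        then show False using kF cF f finF k by simp
      qed
    qed
    moreover have "finite (bridges ?S)" using fin bridges_subset finite_subset by blast
    ultimately have "k - 1 \<le> card (bridges ?S)" using cF card_mono by metis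
    then show ?thesis using k by simp
  qed
  moreover have "irrefl ?R" using no_loops by (fastforce simp: irrefl_def)
  ultimately show ?thesis
    using Rsub sym reach by unfold_locales auto
qed

context bridge_critical_graph
begin

lemma finite_R: "finite R"
  using finite_V R_sub finite_subset by blast

lemma arc_sym: "(a, b) \<in> R \<Longrightarrow> (b, a) \<in> R"
  using sym_R by (auto simp: sym_def)

lemma finite_bridges: "finite (bridges R)"
  using finite_rel_edges[OF finite_R] bridges_subset finite_subset by blast

text \<open>
  If \<open>a\<close> and \<open>b\<close> were still connected, the edge \<open>ab\<close> could be bypassed and \<open>f\<close> would be a bridge
  already before the deletion of \<open>ab\<close>.
\<close>

lemma new_bridge_separates:
  assumes "(a, b) \<in> R" "f \<in> bridges (remove_edges R {{a, b}})" "f \<notin> bridges R"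
  shows "(a, b) \<notin> (remove_edges R {{a, b}, f})\<^sup>*"
proof
  let ?T = "remove_edges R {{a, b}, f}"
  assume ab: "(a, b) \<in> ?T\<^sup>*"
  obtain c d where cd: "f = {c, d}" "(c, d) \<in> remove_edges R {{a, b}}"
    "(c, d) \<notin> (remove_edges (remove_edges R {{a, b}}) {f})\<^sup>*"
    using assms(2) by (auto simp: bridges_def)
  have "(c, d) \<in> (remove_edges R {f})\<^sup>*"
    using bridge_iff[OF sym_R, of c d] cd assms(3) by (auto simp: remove_edges_def)
  moreover have "remove_edges R {f} \<subseteq> ?T\<^sup>*"
  proof
    fix e assume e: "e \<in> remove_edges R {f}"
    obtain x y where xy: "e = (x, y)" by (cases e)
    show "e \<in> ?T\<^sup>*"
    proof (cases "{x, y} = {a, b}")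
      case True
      then have "e = (a, b) \<or> e = (b, a)" using xy by (auto simp: doubleton_eq_iff)
      then show ?thesis using ab rtrancl_sym[OF sym_remove_edges[OF sym_R] ab] by auto
    next
      case False
      then show ?thesis using e xy by (auto simp: remove_edges_def)
    qed
  qed
  ultimately have "(c, d) \<in> ?T\<^sup>*" using rtrancl_subset_rtrancl by blast
  then show False using cd(3) by (simp add: remove_edges_remove_edges insert_commute)
qed

text \<open>
  Deleting the non-bridge \<open>ab\<close> creates a new bridge \<open>f\<close>, which separates \<open>a\<close> from \<open>b\<close>; but \<open>f\<close> can meet
  only one of two edge-disjoint connections.
\<close>

lemma no_two_edge_disjoint_links:
  assumes ab: "(a, b) \<in> R" and P: "P \<subseteq> R" "sym P" "{a, b} \<notin> rel_edges P" "(a, b) \<in> P\<^sup>*"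
    and Q: "Q \<subseteq> R" "sym Q" "{a, b} \<notin> rel_edges Q" "(a, b) \<in> Q\<^sup>*" and PQ: "rel_edges P \<inter> rel_edges Q = {}"
  shows False
proof -
  have sub: "X \<subseteq> remove_edges R F" if "X \<subseteq> R" "rel_edges X \<inter> F = {}" for X F
    using that by (auto simp: remove_edges_def rel_edges_def)
  have "(a, b) \<in> (remove_edges R {{a, b}})\<^sup>*"
    using rtrancl_mono[OF sub[OF P(1), of "{{a, b}}"]] P(3,4) by auto
  then have nb: "{a, b} \<notin> bridges R" using bridge_iff[OF sym_R] by blast
  have "s < card (bridges (remove_edges R {{a, b}}))"
    using critical[OF _ nb] in_rel_edges[OF sym_R] ab by simp
  then have "\<not> bridges (remove_edges R {{a, b}}) \<subseteq> bridges R"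
    using few_bridges card_mono[OF finite_bridges, of "bridges (remove_edges R {{a, b}})"] by linarith
  then obtain f where f: "f \<in> bridges (remove_edges R {{a, b}})" "f \<notin> bridges R" by blast
  have sep: "(a, b) \<notin> (remove_edges R {{a, b}, f})\<^sup>*" by (rule new_bridge_separates[OF ab f])
  have "(a, b) \<in> (remove_edges R {{a, b}, f})\<^sup>*" if "X \<subseteq> R" "{a, b} \<notin> rel_edges X" "(a, b) \<in> X\<^sup>*" "f \<notin> rel_edges X" for X
    using rtrancl_mono[OF sub[of X "{{a, b}, f}"]] that by auto
  from this[OF P(1,3,4)] this[OF Q(1,3,4)] sep PQ show False by (metis IntI empty_iff)
qed

text \<open>
  A cycle contains no bridge, so the connection of \<open>a\<close> and \<open>b\<close> that makes \<open>ab\<close> a non-bridge survives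
  the deletion of all bridges.
\<close>

lemma nonbridge_connected_off_bridges:
  assumes ab: "(a, b) \<in> R" "{a, b} \<notin> bridges R"
  shows "(a, b) \<in> (remove_edges R (insert {a, b} (bridges R)))\<^sup>*"
proof -
  have "(a, b) \<in> (remove_edges R (insert {a, b} F))\<^sup>*" if "finite F" "F \<subseteq> bridges R" for F
    using that
  proof (induction F rule: finite_induct)
    case empty
    then show ?case using bridge_iff[OF sym_R] ab by blast
  next
    case (insert f F)
    let ?S = "remove_edges R (insert {a, b} F)" and ?T = "remove_edges R (insert {a, b} (insert f F))"
    show ?case
    proof (rule ccontr)
      assume n: "(a, b) \<notin> ?T\<^sup>*"
      obtain c d where f: "f = {c, d}" "(c, d) \<in> R" using insert.prems by (auto simp: bridges_def)
      have T: "?T = remove_edges ?S {{c, d}}" 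
        using f by (simp add: remove_edges_remove_edges insert_commute)
      have "(a, b) \<in> ?S\<^sup>*" using insert by auto
      note c = rtrancl_remove_edge_cases[OF sym_remove_edges[OF sym_R] this T]
      note sT = rtrancl_sym[OF sym_remove_edges[OF sym_R], of _ _ "insert {a, b} (insert f F)"]
      from c n sT have "(a, c) \<in> ?T\<^sup>* \<and> (b, d) \<in> ?T\<^sup>* \<or> (a, d) \<in> ?T\<^sup>* \<and> (b, c) \<in> ?T\<^sup>*"
        by (meson rtrancl_trans)
      moreover have "?T\<^sup>* \<subseteq> (remove_edges R {f})\<^sup>*"
        by (rule rtrancl_mono) (auto simp: remove_edges_def)
      moreover have "(a, b) \<in> remove_edges R {f}" "(b, a) \<in> remove_edges R {f}"
        using ab arc_sym insert by (auto simp: remove_edges_def insert_commute)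
      moreover note sf = rtrancl_sym[OF sym_remove_edges[OF sym_R], of _ _ "{f}"]
      ultimately have "(c, d) \<in> (remove_edges R {f})\<^sup>*"
        by (meson r_into_rtrancl rtrancl_trans subsetD)
      then show False using insert.prems f bridge_iff[OF sym_R] by auto
    qed
  qed
  then show ?thesis using finite_bridges by blast
qed

text \<open>
  The first step of a connection off the bridges: every vertex on a cycle has two cycle edges.
\<close>

lemma nonbridge_extends:
  assumes ab: "(a, b) \<in> R" "{a, b} \<notin> bridges R"
  shows "\<exists>c. c \<noteq> b \<and> (a, c) \<in> R \<and> {a, c} \<notin> bridges R"
proof -
  have "a \<noteq> b" using ab irrefl_R by (auto simp: irrefl_def)
  then obtain c where "(a, c) \<in> remove_edges R (insert {a, b} (bridges R))"
    using nonbridge_connected_off_bridges[OF ab] by (meson converse_rtranclE)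
  then show ?thesis by (auto simp: remove_edges_def)
qed

end

section \<open>The spectral radius as a Perron eigenvalue\<close>

text \<open>
  The eigenvalue equation of the adjacency matrix, independent of an enumeration of the vertices.
\<close>

definition eigenfunction :: "'a set \<Rightarrow> 'a rel \<Rightarrow> real \<Rightarrow> ('a \<Rightarrow> real) \<Rightarrow> bool" where
  "eigenfunction V R l x \<longleftrightarrow> (\<forall>v\<in>V. (\<Sum>w\<in>R `` {v}. x w) = l * x v)"

lemma vertex_list:
  assumes "finite (pverts G)"
  shows "distinct (vertex_list G)" "set (vertex_list G) = pverts G" "length (vertex_list G) = card (pverts G)"
proof -
  have *: "distinct (vertex_list G) \<and> set (vertex_list G) = pverts G"
    unfolding vertex_list_def by (rule someI_ex) (use finite_distinct_list[OF assms] in blast)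
  then show "distinct (vertex_list G)" "set (vertex_list G) = pverts G" by simp_all
  from * show "length (vertex_list G) = card (pverts G)" using distinct_card[of "vertex_list G"] by simp
qed

lemma spectrum_adjacency_matrix:
  assumes G: "pair_graph G"
  shows "l \<in> spectrum (adjacency_matrix G) \<longleftrightarrow>
    (\<exists>x. (\<exists>v\<in>pverts G. x v \<noteq> 0) \<and> eigenfunction (pverts G) (parcs G) l x)"
proof -
  interpret pair_graph G by fact
  define n where "n = card (pverts G)"
  define vs where "vs = vertex_list G"
  define A where "A = adjacency_matrix G"
  have fin: "finite (pverts G)" using finite_verts by simp
  note vs = vertex_list[OF fin, folded vs_def n_def]
  have A: "A \<in> carrier_mat n n" by (simp add: A_def adjacency_matrix_def n_def)
  have bij: "bij_betw ((!) vs) {..<n} (pverts G)"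
    using bij_betw_nth[OF vs(1)] vs by simp
  have Ay: "(A *\<^sub>v y) $ i = (\<Sum>w\<in>parcs G `` {vs ! i}. x w)"
    if y: "y \<in> carrier_vec n" and xy: "\<And>j. j < n \<Longrightarrow> x (vs ! j) = y $ j" and i: "i < n" for x y i
  proof -
    have "(A *\<^sub>v y) $ i = (\<Sum>j<n. (if (vs ! i, vs ! j) \<in> parcs G then 1 else 0) * y $ j)"
      using y i by (auto simp: A_def adjacency_matrix_def n_def vs_def scalar_prod_def
          atLeast0LessThan intro!: sum.cong)
    also have "\<dots> = (\<Sum>j<n. if (vs ! i, vs ! j) \<in> parcs G then x (vs ! j) else 0)"
      using xy by (intro sum.cong) auto
    also have "\<dots> = (\<Sum>w\<in>pverts G. if (vs ! i, w) \<in> parcs G then x w else 0)"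
      by (rule sum.reindex_bij_betw[OF bij, of "\<lambda>w. if (vs ! i, w) \<in> parcs G then x w else 0"])
    also have "\<dots> = (\<Sum>w\<in>{w \<in> pverts G. (vs ! i, w) \<in> parcs G}. x w)"
      using fin by (simp add: sum.inter_filter)
    also have "{w \<in> pverts G. (vs ! i, w) \<in> parcs G} = parcs G `` {vs ! i}"
      using in_arcsD2 by auto
    finally show ?thesis .
  qed
  have iff: "A *\<^sub>v y = l \<cdot>\<^sub>v y \<longleftrightarrow> eigenfunction (pverts G) (parcs G) l x"
    if y: "y \<in> carrier_vec n" and xy: "\<And>j. j < n \<Longrightarrow> x (vs ! j) = y $ j" for x y
  proof -
    have "dim_vec (A *\<^sub>v y) = n" "dim_vec y = n" using y A by auto
    then have "A *\<^sub>v y = l \<cdot>\<^sub>v y \<longleftrightarrow> (\<forall>i<n. (A *\<^sub>v y) $ i = l * y $ i)"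
      by (auto simp: vec_eq_iff simp del: index_mult_mat_vec dim_mult_mat_vec)
    also have "\<dots> \<longleftrightarrow> (\<forall>i<n. (\<Sum>w\<in>parcs G `` {vs ! i}. x w) = l * x (vs ! i))"
      by (intro all_cong) (simp only: Ay[OF y xy] xy)
    also have "\<dots> \<longleftrightarrow> eigenfunction (pverts G) (parcs G) l x"
      unfolding eigenfunction_def by (auto simp: bij_betw_imp_surj_on[OF bij, symmetric])
    finally show ?thesis .
  qed
  show ?thesis
  proof
    assume "l \<in> spectrum (adjacency_matrix G)"
    then obtain y where y: "y \<in> carrier_vec n" "y \<noteq> 0\<^sub>v n" "A *\<^sub>v y = l \<cdot>\<^sub>v y"
      using A by (auto simp: spectrum_def eigenvalue_def eigenvector_def A_def[symmetric])
    define x where "x v = y $ (the_inv_into {..<n} ((!) vs) v)" for v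
    have xy: "x (vs ! j) = y $ j" if "j < n" for j
      using that the_inv_into_f_f[OF bij_betw_imp_inj_on[OF bij]] by (simp add: x_def)
    obtain j where j: "j < n" "y $ j \<noteq> 0" using y(1,2) by (auto simp: vec_eq_iff)
    then have "vs ! j \<in> pverts G" using bij_betwE[OF bij] by auto
    then show "\<exists>x. (\<exists>v\<in>pverts G. x v \<noteq> 0) \<and> eigenfunction (pverts G) (parcs G) l x"
      using iff[OF y(1) xy] y(3) xy[OF j(1)] j by (intro exI[of _ x] conjI bexI[of _ "vs ! j"]) auto
  next
    assume "\<exists>x. (\<exists>v\<in>pverts G. x v \<noteq> 0) \<and> eigenfunction (pverts G) (parcs G) l x"
    then obtain x v where x: "v \<in> pverts G" "x v \<noteq> 0" "eigenfunction (pverts G) (parcs G) l x" by blast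
    define y where "y = vec n (\<lambda>j. x (vs ! j))"
    have y: "y \<in> carrier_vec n" by (simp add: y_def)
    have xy: "x (vs ! j) = y $ j" if "j < n" for j using that by (simp add: y_def)
    obtain j where j: "j < n" "v = vs ! j" using x(1) bij_betw_imp_surj_on[OF bij] by auto
    then have "y $ j \<noteq> 0\<^sub>v n $ j" using x xy by simp
    then have "y \<noteq> 0\<^sub>v n" by auto
    then have "eigenvector A y l"
      using A y iff[OF y xy] x(3) by (auto simp: eigenvector_def)
    then show "l \<in> spectrum (adjacency_matrix G)"
      by (auto simp: spectrum_def eigenvalue_def A_def)
  qed
qed

lemma sum_over_arcs:
  fixes f :: "'a \<Rightarrow> 'a \<Rightarrow> real"
  assumes "finite V" "R \<subseteq> V \<times> V"
  shows "(\<Sum>(v, w)\<in>R. f v w) = (\<Sum>v\<in>V. \<Sum>w\<in>R `` {v}. f v w)"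
proof -
  have "finite R" using assms finite_subset by blast
  then have fin: "finite (R `` {v})" for v by (simp add: finite_Image)
  have "R = Sigma V (\<lambda>v. R `` {v})" using assms by auto
  then have "(\<Sum>(v, w)\<in>R. f v w) = (\<Sum>(v, w)\<in>Sigma V (\<lambda>v. R `` {v}). f v w)" by simp
  also have "\<dots> = (\<Sum>v\<in>V. \<Sum>w\<in>R `` {v}. f v w)"
    by (rule sum.Sigma[symmetric]) (use assms fin in auto)
  finally show ?thesis .
qed

lemma sum_arcs_swap:
  assumes "sym R"
  shows "(\<Sum>(v, w)\<in>R. f v w) = (\<Sum>(v, w)\<in>R. f w v)"
  by (rule sum.reindex_bij_witness[of _ prod.swap prod.swap]) (use assms in \<open>auto dest: symD\<close>)

text \<open>
  The Rayleigh quotient is maximised over functions on the vertex set; functions on the whole type that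
  vanish off \<open>V\<close> replace vectors of a dimension that would depend on \<open>V\<close>.
\<close>

lemma compact_box:
  fixes V :: "'a set" shows "compact {x :: 'a \<Rightarrow> real. \<forall>v. x v \<in> (if v \<in> V then {-1..1} else {0})}"
proof -
  have "compactin (product_topology (\<lambda>_. euclidean) UNIV) (PiE UNIV (\<lambda>v. if v \<in> V then {-1..1::real} else {0}))"
    by (subst compactin_PiE) auto
  moreover have "PiE UNIV (\<lambda>v. if v \<in> V then {-1..1::real} else {0}) =
      {x. \<forall>v. x v \<in> (if v \<in> V then {-1..1} else {0})}"
    by (auto simp: PiE_def Pi_def)
  ultimately have "compactin euclidean {x :: 'a \<Rightarrow> real. \<forall>v. x v \<in> (if v \<in> V then {-1..1} else {0})}"
    by (simp only: euclidean_product_topology)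
  then show ?thesis by (simp only: compactin_euclidean_iff)
qed

lemma linear_term_zero:
  fixes b c :: real
  assumes "\<And>e. 0 \<le> 2 * e * b + e\<^sup>2 * c"
  shows "b = 0"
proof (rule ccontr)
  assume b: "b \<noteq> 0"
  \<comment> \<open>the choice \<open>e = - b / d\<close> makes the linear term dominate\<close>
  define d where "d = \<bar>c\<bar> + 1"
  have d: "d > 0" "c < d" by (auto simp: d_def)
  have "0 \<le> 2 * (- b / d) * b + (- b / d)\<^sup>2 * c" by (rule assms)
  also have "\<dots> = (b\<^sup>2 / d\<^sup>2) * (c - 2 * d)"
    using d by (simp add: field_simps power2_eq_square)
  finally have "0 \<le> (b\<^sup>2 / d\<^sup>2) * (c - 2 * d)" .
  moreover have "b\<^sup>2 / d\<^sup>2 > 0" using b d by simp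
  then have "(b\<^sup>2 / d\<^sup>2) * (c - 2 * d) < 0" using d by (intro mult_pos_neg) auto
  ultimately show False by linarith
qed

text \<open>
  A maximiser \<open>x\<close> of the quadratic form on the unit sphere may be replaced by its absolute value, as the
  form has non-negative coefficients. Perturbing it by multiples of the indicator of a vertex shows
  that it satisfies the eigenvalue equation, and its eigenvalue bounds every other one.
\<close>

theorem perron_eigenfunction:
  fixes V :: "'a set" and R :: "'a rel"
  assumes fin: "finite V" and ne: "V \<noteq> {}" and R: "R \<subseteq> V \<times> V" and sym: "sym R"
  shows "\<exists>l x. (\<forall>v. 0 \<le> x v) \<and> (\<exists>v\<in>V. x v \<noteq> 0) \<and> eigenfunction V R l x \<and>
    (\<forall>l' y. (\<exists>v\<in>V. y v \<noteq> 0) \<longrightarrow> eigenfunction V R l' y \<longrightarrow> l' \<le> l)"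
proof -
  define B where "B x y = (\<Sum>(v, w)\<in>R. x v * y w)" for x y :: "'a \<Rightarrow> real"
  define N where "N x = (\<Sum>v\<in>V. (x v)\<^sup>2)" for x :: "'a \<Rightarrow> real"
  define T where "T = {x :: 'a \<Rightarrow> real. \<forall>v. x v \<in> (if v \<in> V then {-1..1} else {0})} \<inter> {x. N x = 1}"
  have finR: "finite R" using fin R finite_subset by blast
  have coord: "continuous_on UNIV (\<lambda>x :: 'a \<Rightarrow> real. x v)" for v
    by (rule continuous_on_product_coordinates)
  have contB: "continuous_on UNIV (\<lambda>x. B x x)"
    unfolding B_def case_prod_beta by (intro continuous_intros coord)
  have contN: "continuous_on UNIV N"
    unfolding N_def by (intro continuous_intros coord)
  have "closed {x. N x = 1}"
    by (intro closed_Collect_eq contN continuous_on_const)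
  then have "compact T" unfolding T_def using compact_box by (rule compact_Int_closed[rotated])
  moreover obtain v0 where v0: "v0 \<in> V" using ne by blast
  have "(\<lambda>v. if v = v0 then 1 else 0) \<in> T"
    using v0 fin by (auto simp: T_def N_def if_distrib[of "\<lambda>z. z\<^sup>2"] sum.delta cong: if_cong)
  then have "T \<noteq> {}" by blast
  ultimately obtain x where x: "x \<in> T" "\<And>y. y \<in> T \<Longrightarrow> B y y \<le> B x x"
    using continuous_attains_sup[of T "\<lambda>x. B x x"] continuous_on_subset[OF contB] by auto
  define l where "l = B x x"
  define z where "z v = \<bar>x v\<bar>" for v
  have "z v \<in> (if v \<in> V then {-1..1} else {0})" for v
  proof -
    have "x v \<in> (if v \<in> V then {-1..1} else {0})" using x(1) by (simp add: T_def)
    then show ?thesis by (cases "v \<in> V") (auto simp: z_def)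
  qed
  then have zT: "z \<in> T" using x(1) by (simp add: T_def z_def N_def)
  have "l \<le> B z z"
    unfolding l_def B_def z_def by (intro sum_mono) (auto simp: abs_mult[symmetric])
  then have Bz: "B z z = l" using x(2)[OF zT] by (simp add: l_def)
  have Nz: "N z = 1" using zT by (simp add: T_def)
  have form: "B y y \<le> l * N y" for y
  proof (cases "N y = 0")
    case True
    then have "y v = 0" if "v \<in> V" for v
      using that fin by (simp add: N_def sum_nonneg_eq_0_iff)
    then have "B y y = 0" using R by (auto simp: B_def intro!: sum.neutral)
    then show ?thesis using True by simp
  next
    case False
    then have pos: "N y > 0" by (metis N_def order_le_less sum_nonneg zero_le_power2)
    define w where "w v = (if v \<in> V then y v / sqrt (N y) else 0)" for v
    have Nw: "N w = 1"
    proof -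
      have "N w = (\<Sum>v\<in>V. (y v)\<^sup>2 / N y)" unfolding N_def[of w]
        using pos by (intro sum.cong) (auto simp: w_def power_divide)
      also have "\<dots> = 1" using pos by (simp add: N_def sum_divide_distrib[symmetric])
      finally show ?thesis .
    qed
    have "(w v)\<^sup>2 \<le> 1" if "v \<in> V" for v
      using member_le_sum[OF that, of "\<lambda>v. (w v)\<^sup>2"] fin Nw by (simp add: N_def)
    then have "\<bar>w v\<bar> \<le> 1" if "v \<in> V" for v using that by (metis abs_square_le_1)
    then have "w v \<in> (if v \<in> V then {-1..1} else {0})" for v
      by (cases "v \<in> V") (simp add: abs_le_iff, simp add: w_def)
    then have "w \<in> T" using Nw by (simp add: T_def)
    then have "B w w \<le> l" using x(2) l_def by simp
    moreover have "B w w = (\<Sum>(v, u)\<in>R. y v * y u / N y)" unfolding B_def[of w]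
      using pos R by (intro sum.cong) (auto simp: w_def)
    then have "B w w = B y y / N y" by (simp add: B_def sum_divide_distrib case_prod_beta)
    ultimately show ?thesis using pos by (simp add: field_simps)
  qed
  have Bsum: "B y' y = (\<Sum>v\<in>V. y' v * (\<Sum>w\<in>R `` {v}. y w))" for y' y
    using sum_over_arcs[OF fin R, of "\<lambda>v w. y' v * y w"] by (simp add: B_def sum_distrib_left)
  have Bsym: "B y y' = B y' y" for y y'
    using sum_arcs_swap[OF sym, of "\<lambda>v w. y v * y' w"] by (simp add: B_def mult.commute)
  have "(\<Sum>w\<in>R `` {u}. z w) = l * z u" if u: "u \<in> V" for u
  proof -
    define d where "d v = (if v = u then 1 else 0 :: real)" for v
    have Bd: "B d y = (\<Sum>w\<in>R `` {u}. y w)" for y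
      using u fin by (simp add: Bsum d_def sum.delta if_distrib[of "\<lambda>t. t * _"] cong: if_cong)
    have "0 \<le> 2 * e * (l * z u - (\<Sum>w\<in>R `` {u}. z w)) + e\<^sup>2 * (l - B d d)" for e
    proof -
      have "B (\<lambda>v. z v + e * d v) (\<lambda>v. z v + e * d v) = B z z + e * B z d + e * B d z + e\<^sup>2 * B d d"
      proof -
        have "B (\<lambda>v. z v + e * d v) (\<lambda>v. z v + e * d v) =
          (\<Sum>(v, w)\<in>R. z v * z w + e * (z v * d w) + e * (d v * z w) + e\<^sup>2 * (d v * d w))"
          unfolding B_def by (intro sum.cong) (auto simp: algebra_simps power2_eq_square)
        also have "\<dots> = B z z + e * B z d + e * B d z + e\<^sup>2 * B d d"
          by (simp add: B_def sum.distrib sum_distrib_left case_prod_beta)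
        finally show ?thesis .
      qed
      moreover have "N (\<lambda>v. z v + e * d v) = N z + 2 * e * z u + e\<^sup>2"
      proof -
        have "N (\<lambda>v. z v + e * d v) = (\<Sum>v\<in>V. (z v)\<^sup>2 + (if v = u then 2 * e * z u + e\<^sup>2 else 0))"
          unfolding N_def by (intro sum.cong) (auto simp: d_def power2_sum algebra_simps)
        also have "\<dots> = N z + (2 * e * z u + e\<^sup>2)" using u fin by (simp add: sum.distrib N_def)
        finally show ?thesis by simp
      qed
      ultimately show ?thesis
        using form[of "\<lambda>v. z v + e * d v"] Bsym[of z d] Bd[of z] Bz Nz by (simp add: algebra_simps)
    qed
    then have "l * z u - (\<Sum>w\<in>R `` {u}. z w) = 0" by (rule linear_term_zero)
    then show ?thesis by simp
  qed
  then have "eigenfunction V R l z" by (simp add: eigenfunction_def)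
  moreover have "\<exists>v\<in>V. z v \<noteq> 0" 
  proof (rule ccontr)
    assume "\<not> (\<exists>v\<in>V. z v \<noteq> 0)"
    then have "N z = 0" by (simp add: N_def)
    then show False using Nz by simp
  qed
  moreover have "l' \<le> l" if y: "v \<in> V" "y v \<noteq> 0" "eigenfunction V R l' y" for l' y v
  proof -
    have "(\<Sum>u\<in>V. y u * (\<Sum>w\<in>R `` {u}. y w)) = (\<Sum>u\<in>V. l' * (y u)\<^sup>2)"
      using y(3) by (intro sum.cong) (auto simp: eigenfunction_def power2_eq_square)
    then have "l' * N y \<le> l * N y" using form[of y] Bsum[of y y] by (simp add: N_def sum_distrib_left)
    moreover have "N y > 0"
      unfolding N_def using y(1,2) fin by (intro sum_pos2[of _ v]) auto
    ultimately show ?thesis by simp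
  qed
  ultimately show ?thesis by (intro exI[of _ l] exI[of _ z]) (auto simp: z_def)
qed

lemma pair_graph_facts:
  assumes "pair_graph G"
  shows "finite (pverts G)" "parcs G \<subseteq> pverts G \<times> pverts G" "sym (parcs G)" "wf_digraph (with_proj G)"
proof -
  interpret pair_graph G by fact
  show "finite (pverts G)" "parcs G \<subseteq> pverts G \<times> pverts G" "sym (parcs G)" "wf_digraph (with_proj G)"
    using finite_verts in_arcsD1 in_arcsD2 sym_arcs by (auto simp: symmetric_def) unfold_locales
qed

lemma spectral_rad_perron:
  assumes G: "pair_graph G" and ne: "pverts G \<noteq> {}"
  obtains x where "\<And>v. 0 \<le> x v" "\<exists>v\<in>pverts G. x v \<noteq> 0" "eigenfunction (pverts G) (parcs G) (\<rho> G) x"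
proof -
  note f = pair_graph_facts[OF G]
  obtain l x where lx: "\<forall>v. 0 \<le> x v" "\<exists>v\<in>pverts G. x v \<noteq> 0" "eigenfunction (pverts G) (parcs G) l x"
    "\<forall>l' y. (\<exists>v\<in>pverts G. y v \<noteq> 0) \<longrightarrow> eigenfunction (pverts G) (parcs G) l' y \<longrightarrow> l' \<le> l"
    using perron_eigenfunction[OF f(1) ne f(2,3)] by blast
  have "finite (spectrum (adjacency_matrix G))"
    by (rule card_finite_spectrum(1)[of _ "card (pverts G)"]) (simp add: adjacency_matrix_def)
  then have "\<rho> G = l"
    unfolding spectral_rad_def by (rule Max_eqI) (use lx spectrum_adjacency_matrix[OF G] in blast)+
  then show thesis using that lx by blast
qed

text \<open>
  Pairing the positive eigenfunction with the Perron eigenfunction, in the symmetric form, gives the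
  same positive number multiplied by either eigenvalue.
\<close>

lemma spectral_rad_eqI:
  assumes G: "pair_graph G" and ne: "pverts G \<noteq> {}"
    and y: "\<And>v. v \<in> pverts G \<Longrightarrow> 0 < y v" "eigenfunction (pverts G) (parcs G) l y"
  shows "\<rho> G = l"
proof -
  let ?V = "pverts G" and ?R = "parcs G"
  note f = pair_graph_facts[OF G]
  obtain x v where x: "\<And>v. 0 \<le> x v" "v \<in> ?V" "x v \<noteq> 0" "eigenfunction ?V ?R (\<rho> G) x"
    using spectral_rad_perron[OF G ne] by metis
  have "(\<Sum>v\<in>?V. y v * (\<rho> G * x v)) = (\<Sum>v\<in>?V. y v * (\<Sum>w\<in>?R `` {v}. x w))"
    using x(4) by (simp add: eigenfunction_def)
  also have "\<dots> = (\<Sum>(v, w)\<in>?R. y v * x w)"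
    using sum_over_arcs[OF f(1,2), of "\<lambda>v w. y v * x w"] by (simp add: sum_distrib_left)
  also have "\<dots> = (\<Sum>(v, w)\<in>?R. y w * x v)" by (rule sum_arcs_swap[OF f(3)])
  also have "\<dots> = (\<Sum>v\<in>?V. x v * (\<Sum>w\<in>?R `` {v}. y w))"
    using sum_over_arcs[OF f(1,2), of "\<lambda>v w. y w * x v"]
    by (simp add: sum_distrib_left mult.commute)
  also have "\<dots> = (\<Sum>v\<in>?V. x v * (l * y v))" using y(2) by (simp add: eigenfunction_def)
  finally have "\<rho> G * (\<Sum>v\<in>?V. x v * y v) = l * (\<Sum>v\<in>?V. x v * y v)"
    by (simp add: sum_distrib_left mult.commute mult.left_commute)
  moreover have "(\<Sum>v\<in>?V. x v * y v) > 0"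
    using x y(1) f(1) by (intro sum_pos2[of _ v]) (auto simp: less_le intro!: mult_nonneg_nonneg mult_pos_pos)
  ultimately show ?thesis by simp
qed

text \<open>
  Arcs are pairs of vertices, so an isomorphism acts on them through its vertex map.
\<close>

lemma graph_iso_iff:
  assumes G: "pair_graph G"
  shows "G \<cong>\<^sub>g H \<longleftrightarrow> (\<exists>f. inj_on f (pverts G) \<and> pverts H = f ` pverts G \<and> 
    parcs H = (\<lambda>(u, v). (f u, f v)) ` parcs G)"
proof
  assume "G \<cong>\<^sub>g H"
  then obtain h where h: "pre_digraph.digraph_isomorphism (with_proj G) h" "with_proj H = app_iso h (with_proj G)"
    by (auto simp: digraph_iso_def)
  have eq: "pverts H = iso_verts h ` pverts G" "parcs H = iso_arcs h ` parcs G"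
     "fst = iso_tail h" "snd = iso_head h"
    using h(2) by (auto simp: with_proj_def app_iso_def)
  have "\<forall>a\<in>parcs G. iso_verts h (fst a) = fst (iso_arcs h a) \<and> iso_verts h (snd a) = snd (iso_arcs h a)"
    using h(1) unfolding pre_digraph.digraph_isomorphism_def eq(3,4) by simp
  then have "iso_arcs h a = (case a of (u, v) \<Rightarrow> (iso_verts h u, iso_verts h v))" if "a \<in> parcs G" for a
    using that by (simp add: prod_eq_iff case_prod_beta)
  then have "parcs H = (\<lambda>(u, v). (iso_verts h u, iso_verts h v)) ` parcs G"
    unfolding eq(2) by (intro image_cong) auto
  then show "\<exists>f. inj_on f (pverts G) \<and> pverts H = f ` pverts G \<and> parcs H = (\<lambda>(u, v). (f u, f v)) ` parcs G"
    using h(1) eq(1) by (auto simp: pre_digraph.digraph_isomorphism_def)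
next
  assume "\<exists>f. inj_on f (pverts G) \<and> pverts H = f ` pverts G \<and> parcs H = (\<lambda>(u, v). (f u, f v)) ` parcs G"
  then obtain f where f: "inj_on f (pverts G)" "pverts H = f ` pverts G"
    "parcs H = (\<lambda>(u, v). (f u, f v)) ` parcs G" by blast
  note g = pair_graph_facts[OF G]
  let ?h = "\<lparr> iso_verts = f, iso_arcs = (\<lambda>(u, v). (f u, f v)), iso_head = snd, iso_tail = fst \<rparr>"
  have "inj_on (\<lambda>(u, v). (f u, f v)) (parcs G)"
    using f(1) g(2) by (auto simp: inj_on_def)
  then have "pre_digraph.digraph_isomorphism (with_proj G) ?h"
    using g(4) f(1) by (auto simp: pre_digraph.digraph_isomorphism_def)
  moreover have "with_proj H = app_iso ?h (with_proj G)"
    using f by (simp add: app_iso_def with_proj_def)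
  ultimately show "G \<cong>\<^sub>g H" by (auto simp: digraph_iso_def)
qed

lemma spectral_rad_iso:
  assumes G: "pair_graph G" and H: "pair_graph H" and iso: "G \<cong>\<^sub>g H"
  shows "\<rho> G = \<rho> H"
proof -
  obtain f where f: "inj_on f (pverts G)" "pverts H = f ` pverts G"
    "parcs H = (\<lambda>(u, v). (f u, f v)) ` parcs G"
    using iso unfolding graph_iso_iff[OF G] by (elim exE conjE) (rule that; assumption)
  note g = pair_graph_facts[OF G]
  have nb: "parcs H `` {f v} = f ` (parcs G `` {v})" if "v \<in> pverts G" for v
  proof (intro equalityI subsetI)
    fix y assume "y \<in> parcs H `` {f v}"
    then obtain a b where ab: "(a, b) \<in> parcs G" "f a = f v" "y = f b" using f(3) by auto
    then have "a = v" using inj_onD[OF f(1)] g(2) that by blast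
    then show "y \<in> f ` (parcs G `` {v})" using ab by blast
  next
    fix y assume "y \<in> f ` (parcs G `` {v})"
    then obtain b where b: "(v, b) \<in> parcs G" "y = f b" by blast
    have "(case (v, b) of (u, w) \<Rightarrow> (f u, f w)) \<in> parcs H" unfolding f(3) using b(1) by (rule imageI)
    then show "y \<in> parcs H `` {f v}" using b(2) by simp
  qed
  have sub: "parcs G `` {v} \<subseteq> pverts G" for v using g(2) by auto
  have ef: "eigenfunction (pverts H) (parcs H) l x \<longleftrightarrow> eigenfunction (pverts G) (parcs G) l (x \<circ> f)" for l x
  proof -
    have "sum x (parcs H `` {f v}) = sum (x \<circ> f) (parcs G `` {v})" if "v \<in> pverts G" for v
      unfolding nb[OF that] by (rule sum.reindex[OF inj_on_subset[OF f(1) sub]])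
    then show ?thesis unfolding eigenfunction_def f(2) by simp
  qed
  have "spectrum (adjacency_matrix G) = spectrum (adjacency_matrix H)"
  proof (intro equalityI subsetI)
    fix l assume "l \<in> spectrum (adjacency_matrix H)"
    then obtain x where "\<exists>v\<in>pverts H. x v \<noteq> 0" "eigenfunction (pverts H) (parcs H) l x"
      using spectrum_adjacency_matrix[OF H] by blast
    then have "(\<exists>v\<in>pverts G. (x \<circ> f) v \<noteq> 0) \<and> eigenfunction (pverts G) (parcs G) l (x \<circ> f)"
      using ef f(2) by auto
    then show "l \<in> spectrum (adjacency_matrix G)" using spectrum_adjacency_matrix[OF G] by blast
  next
    fix l assume "l \<in> spectrum (adjacency_matrix G)"
    then obtain x where x: "\<exists>v\<in>pverts G. x v \<noteq> 0" "eigenfunction (pverts G) (parcs G) l x"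
      using spectrum_adjacency_matrix[OF G] by blast
    define x' where "x' = x \<circ> the_inv_into (pverts G) f"
    have x': "(x' \<circ> f) v = x v" if "v \<in> pverts G" for v
      using that f(1) by (simp add: x'_def the_inv_into_f_f)
    have "eigenfunction (pverts G) (parcs G) l (x' \<circ> f)"
      unfolding eigenfunction_def
    proof
      fix v assume v: "v \<in> pverts G"
      have "sum (x' \<circ> f) (parcs G `` {v}) = sum x (parcs G `` {v})"
        using sub[of v] x' by (intro sum.cong) auto
      then show "sum (x' \<circ> f) (parcs G `` {v}) = l * (x' \<circ> f) v"
        using x(2) x'[OF v] v by (simp add: eigenfunction_def)
    qed
    moreover have "\<exists>v\<in>pverts H. x' v \<noteq> 0" using x(1) x' f(2) by auto
    ultimately show "l \<in> spectrum (adjacency_matrix H)" using ef spectrum_adjacency_matrix[OF H] by blast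
  qed
  then show ?thesis by (simp add: spectral_rad_def)
qed

section \<open>Short cycles in bridge-critical graphs\<close>

lemma rel_edges_insert [simp]: "rel_edges (insert (u, v) S) = insert {u, v} (rel_edges S)"
  and rel_edges_empty [simp]: "rel_edges {} = {}"
  by (auto simp: rel_edges_def)

lemma rtrancl_path3: "(a, b) \<in> {(a, d), (d, e), (e, b)}\<^sup>*"
proof -
  have "(a, d) \<in> {(a, d), (d, e), (e, b)}" "(d, e) \<in> {(a, d), (d, e), (e, b)}" "(e, b) \<in> {(a, d), (d, e), (e, b)}"
    by simp_all
  then show ?thesis by (meson r_into_rtrancl rtrancl_into_rtrancl)
qed

context bridge_critical_graph
begin

lemma R_irrefl: "(a, b) \<in> R \<Longrightarrow> a \<noteq> b"
  using irrefl_R by (auto simp: irrefl_def)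

text \<open>
  The usable form, for two paths given by their arcs in one direction.
\<close>

lemma no_two_edge_disjoint_paths:
  assumes "(a, b) \<in> R" "P \<subseteq> R" "Q \<subseteq> R" "(a, b) \<in> P\<^sup>*" "(a, b) \<in> Q\<^sup>*"
    "{a, b} \<notin> rel_edges P" "{a, b} \<notin> rel_edges Q" "rel_edges P \<inter> rel_edges Q = {}"
  shows False
proof -
  have e: "rel_edges (X \<union> X\<inverse>) = rel_edges X" for X :: "'a rel"
    by (auto simp: rel_edges_def)
  have t: "X\<^sup>* \<subseteq> (X \<union> X\<inverse>)\<^sup>*" for X :: "'a rel" by (rule rtrancl_mono) auto
  have i: "X \<union> X\<inverse> \<subseteq> R" if "X \<subseteq> R" for X using that arc_sym by blast
  show False
    by (rule no_two_edge_disjoint_links[OF assms(1), of "P \<union> P\<inverse>" "Q \<union> Q\<inverse>"])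
      (use assms t[of P] t[of Q] i[of P] i[of Q] in \<open>auto simp: e sym_Un_converse\<close>)
qed

lemma no_diamond:
  assumes "(a, b) \<in> R" "(a, c) \<in> R" "(c, b) \<in> R" "(a, d) \<in> R" "(d, b) \<in> R"
  shows "c = d"
proof (rule ccontr)
  assume cd: "c \<noteq> d"
  have ne: "a \<noteq> b" "a \<noteq> c" "c \<noteq> b" "a \<noteq> d" "d \<noteq> b" using assms R_irrefl by blast+
  show False
    by (rule no_two_edge_disjoint_paths[OF assms(1), of "{(a, c), (c, b)}" "{(a, d), (d, b)}"])
      (use assms cd ne in \<open>auto simp: doubleton_eq_iff intro: rtrancl_into_rtrancl r_into_rtrancl\<close>)
qed

lemma no_triangle_on_4_cycle:
  assumes "(a, b) \<in> R" "(a, c) \<in> R" "(c, b) \<in> R" "(a, d) \<in> R" "(d, e) \<in> R" "(e, b) \<in> R"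
    "distinct [a, b, c, d, e]"
  shows False
  by (rule no_two_edge_disjoint_paths[OF assms(1), of "{(a, c), (c, b)}" "{(a, d), (d, e), (e, b)}"])
    (use assms rtrancl_path3 in \<open>auto simp: doubleton_eq_iff intro: rtrancl_into_rtrancl r_into_rtrancl\<close>)

lemma no_two_4_cycles:
  assumes "(a, b) \<in> R" "(a, d) \<in> R" "(d, e) \<in> R" "(e, b) \<in> R" "(a, d') \<in> R" "(d', e') \<in> R" "(e', b) \<in> R"
    "distinct [a, b, d, e, d', e']"
  shows False
  by (rule no_two_edge_disjoint_paths[OF assms(1), of "{(a, d), (d, e), (e, b)}" "{(a, d'), (d', e'), (e', b)}"])
    (use assms rtrancl_path3 in \<open>auto simp: doubleton_eq_iff intro: rtrancl_into_rtrancl r_into_rtrancl\<close>)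

lemma not_bridge_in_4_cycle:
  assumes "(a, b) \<in> R" "(a, d) \<in> R" "(d, e) \<in> R" "(e, b) \<in> R" "a \<noteq> e" "b \<noteq> d"
  shows "{a, b} \<notin> bridges R"
proof -
  have "{(a, d), (d, e), (e, b)} \<subseteq> remove_edges R {{a, b}}"
    using assms R_irrefl by (auto simp: remove_edges_def doubleton_eq_iff)
  then have "(a, b) \<in> (remove_edges R {{a, b}})\<^sup>*"
    by (auto intro: rtrancl_into_rtrancl)
  then show ?thesis using bridge_iff[OF sym_R] by blast
qed

text \<open>
  A new bridge after the deletion of \<open>ap\<close> must lie on both detours \<open>a q w p\<close> and \<open>a r w p\<close>, so it is \<open>wp\<close>.
  Hence only one bridge is gained, and there were at least \<open>s\<close> before.
\<close>

lemma many_bridges_of_K23: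
  assumes e: "(a, p) \<in> R" "(p, w) \<in> R"
    and q: "(a, q) \<in> R" "(q, w) \<in> R" and r: "(a, r) \<in> R" "(r, w) \<in> R" 
    and d: "distinct [a, w, p, q, r]"
  shows "s \<le> card (bridges R)"
proof -
  have nb: "{a, p} \<notin> bridges R"
    by (rule not_bridge_in_4_cycle[of a p q w]) (use e q d arc_sym in auto)
  have "bridges (remove_edges R {{a, p}}) \<subseteq> insert {p, w} (bridges R)"
  proof
    fix f assume f: "f \<in> bridges (remove_edges R {{a, p}})"
    show "f \<in> insert {p, w} (bridges R)"
    proof (rule ccontr)
      assume n: "f \<notin> insert {p, w} (bridges R)"
      let ?T = "remove_edges R {{a, p}, f}"
      have sep: "(a, p) \<notin> ?T\<^sup>*" using new_bridge_separates[OF e(1) f] n by simp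
      have wp: "(w, p) \<in> ?T" using e n arc_sym d by (auto simp: remove_edges_def doubleton_eq_iff insert_commute)
      have "f \<notin> {{a, q}, {q, w}} \<or> f \<notin> {{a, r}, {r, w}}" using d by (auto simp: doubleton_eq_iff)
      then have "(a, w) \<in> ?T\<^sup>*"
      proof
        assume "f \<notin> {{a, q}, {q, w}}"
        then have "(a, q) \<in> ?T" "(q, w) \<in> ?T" using q d by (auto simp: remove_edges_def doubleton_eq_iff)
        then show ?thesis by (meson r_into_rtrancl rtrancl_into_rtrancl)
      next
        assume "f \<notin> {{a, r}, {r, w}}"
        then have "(a, r) \<in> ?T" "(r, w) \<in> ?T" using r d by (auto simp: remove_edges_def doubleton_eq_iff)
        then show ?thesis by (meson r_into_rtrancl rtrancl_into_rtrancl)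
      qed
      then show False using wp sep by (meson rtrancl_into_rtrancl)
    qed
  qed
  then have "card (bridges (remove_edges R {{a, p}})) \<le> card (insert {p, w} (bridges R))"
    by (intro card_mono) (auto simp: finite_bridges)
  also have "\<dots> \<le> Suc (card (bridges R))" by (rule card_insert_le_m1) auto
  finally show ?thesis using critical[OF _ nb] in_rel_edges[OF sym_R] e(1) by simp
qed

lemma finite_sub: "A \<subseteq> V \<Longrightarrow> finite A"
  using finite_V finite_subset by blast

lemma nb_sub: "R `` {v} \<subseteq> V"
  using R_sub by auto

lemma finite_nb: "finite (R `` {v})"
  using nb_sub finite_sub by blast

lemma sum_nb_swap:
  fixes f :: "'a \<Rightarrow> 'a \<Rightarrow> real"
  assumes "finite A" "finite B"
  shows "(\<Sum>v\<in>A. \<Sum>z\<in>B \<inter> R `` {v}. f v z) = (\<Sum>z\<in>B. \<Sum>v\<in>A \<inter> R `` {z}. f v z)"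
proof -
  have B: "B \<inter> R `` {v} = {z \<in> B. (v, z) \<in> R}" for v by auto
  have A: "A \<inter> R `` {z} = {v \<in> A. (v, z) \<in> R}" for z using arc_sym by auto
  show ?thesis unfolding A B sum.inter_filter[OF assms(1)] sum.inter_filter[OF assms(2)]
    by (rule sum.swap)
qed

text \<open>
  Real-valued because these degrees serve as weights in sums with eigenfunction entries.
\<close>

definition deg_in :: "'a set \<Rightarrow> 'a \<Rightarrow> real" where
  "deg_in A v = real (card (A \<inter> R `` {v}))"

lemma deg_in_nonneg: "0 \<le> deg_in A v"
  by (simp add: deg_in_def)

lemma sum_deg_in_swap:
  assumes "finite A" "finite B"
  shows "(\<Sum>v\<in>A. deg_in B v) = (\<Sum>z\<in>B. deg_in A z)"
  using sum_nb_swap[OF assms, of "\<lambda>_ _. 1"] by (simp add: deg_in_def)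

lemma sum_nb_swap_const:
  assumes "finite A" "finite B"
  shows "(\<Sum>v\<in>A. \<Sum>z\<in>B \<inter> R `` {v}. f z) = (\<Sum>z\<in>B. deg_in A z * f z)"
  using sum_nb_swap[OF assms, of "\<lambda>_. f"] by (simp add: deg_in_def)

lemma deg_in_mono: "A \<subseteq> B \<Longrightarrow> deg_in A v \<le> deg_in B v"
  unfolding deg_in_def using finite_nb[of v] by (intro of_nat_mono card_mono) auto

lemma deg_in_ge_1: "z \<in> A \<Longrightarrow> (v, z) \<in> R \<Longrightarrow> 1 \<le> deg_in A v"
  using finite_nb[of v] by (simp add: deg_in_def Suc_le_eq card_gt_0_iff) blast

lemma deg_in_le_1:
  assumes "\<And>y z. y \<in> A \<Longrightarrow> z \<in> A \<Longrightarrow> (v, y) \<in> R \<Longrightarrow> (v, z) \<in> R \<Longrightarrow> y = z"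
  shows "deg_in A v \<le> 1"
proof -
  have "card (A \<inter> R `` {v}) \<le> Suc 0"
    using finite_nb[of v] assms by (subst card_le_Suc0_iff_eq) auto
  then show ?thesis by (simp add: deg_in_def)
qed

lemma card_R_eq: "real (card R) = (\<Sum>v\<in>V. deg_in V v)"
proof -
  have "card R = (\<Sum>v\<in>V. card (R `` {v}))"
  proof -
    have "R = Sigma V (\<lambda>v. R `` {v})" using R_sub by auto
    then have "card R = card (Sigma V (\<lambda>v. R `` {v}))" by simp
    also have "\<dots> = (\<Sum>v\<in>V. card (R `` {v}))" using finite_V finite_nb by (intro card_SigmaI) auto
    finally show ?thesis .
  qed
  moreover have "V \<inter> R `` {v} = R `` {v}" for v using nb_sub by auto
  ultimately show ?thesis by (simp add: deg_in_def)
qed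

lemma leaf_neighbour:
  assumes "(a, b) \<in> R" "{a, b} \<notin> bridges R"
  obtains c where "c \<noteq> b" "(a, c) \<in> R"
  using nonbridge_extends[OF assms] by blast

end

section \<open>Nearly all edges form a complete bipartite graph\<close>

text \<open>
  A bridge-critical graph whose spectral radius \<open>l\<close> is at least that of the extremal graph, with a
  Perron eigenfunction scaled to have its maximum 1 at \<open>u\<close>.
\<close>

locale large_spectral_radius = bridge_critical_graph V R s
  for V :: "'a set" and R :: "'a rel" and s :: nat +
  fixes l :: real and x :: "'a \<Rightarrow> real" and u :: 'a and m :: nat
  assumes eig: "eigenfunction V R l x" and x_nonneg: "\<And>v. 0 \<le> x v"
    and u_V: "u \<in> V" and x_u: "x u = 1" and x_le_1: "\<And>v. v \<in> V \<Longrightarrow> x v \<le> 1"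
    and card_R: "card R = 2 * m" and m_large: "(432 * (s + 2))\<^sup>2 \<le> m"
    and l_nonneg: "0 \<le> l" and l_large: "real m - real s / 2 - 2 \<le> l\<^sup>2"
begin

lemma l_ge: "430 * (real s + 2) \<le> l"
proof (rule power2_le_imp_le[OF _ l_nonneg])
  have "real ((432 * (s + 2))\<^sup>2) \<le> real m" using m_large by (rule of_nat_mono)
  then have "(432 * (real s + 2))\<^sup>2 \<le> real m" by (simp add: algebra_simps)
  moreover have "(430 * (real s + 2))\<^sup>2 + real s / 2 + 2 \<le> (432 * (real s + 2))\<^sup>2"
    by (simp add: power2_eq_square algebra_simps)
  ultimately show "(430 * (real s + 2))\<^sup>2 \<le> l\<^sup>2" using l_large by linarith
qed

lemma l_pos: "l > 0"
  using l_ge by (rule less_le_trans[rotated]) simp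

lemma eigD: "v \<in> V \<Longrightarrow> l * x v = (\<Sum>w\<in>R `` {v}. x w)"
  using eig by (simp add: eigenfunction_def)

lemma sum_x_le_deg_in: "A \<subseteq> V \<Longrightarrow> (\<Sum>w\<in>A \<inter> R `` {v}. x w) \<le> deg_in A v"
  using sum_mono[of "A \<inter> R `` {v}" x "\<lambda>_. 1"] x_le_1 by (auto simp: deg_in_def)

abbreviation N :: "'a set" where "N \<equiv> R `` {u}"

definition W :: "'a set" where "W = V - N - {u}"

text \<open>
  The threshold serves both classes: at most two neighbours in \<open>N\<close> keep \<open>l * x w\<close> bounded up to edges
  inside \<open>W\<close>, and three leave the choices needed in \<open>deg_W_big_le_1\<close>.
\<close>

definition W_small :: "'a set" where "W_small = {w \<in> W. deg_in N w \<le> 2}"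

definition W_big :: "'a set" where "W_big = {w \<in> W. deg_in N w > 2}"

text \<open>
  Sums over ordered pairs: \<open>arcs_N\<close> and \<open>arcs_W\<close> are twice the numbers of edges inside \<open>N\<close> and \<open>W\<close>, while
  \<open>M_small\<close> and \<open>M_big\<close> are the numbers of edges from \<open>N\<close> to \<open>W_small\<close> and \<open>W_big\<close>.
\<close>

definition arcs_N :: real where "arcs_N = (\<Sum>v\<in>N. deg_in N v)"
definition arcs_W :: real where "arcs_W = (\<Sum>v\<in>W. deg_in W v)"
definition M_small :: real where "M_small = (\<Sum>w\<in>W_small. deg_in N w)"
definition M_big :: real where "M_big = (\<Sum>w\<in>W_big. deg_in N w)"

lemma u_notin_N: "u \<notin> N"
  using R_irrefl by blast

lemma V_eq: "V = insert u (N \<union> W)" "N \<inter> W = {}" "u \<notin> W" "W \<subseteq> V"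
  using u_V nb_sub by (auto simp: W_def)

lemma W_split: "W = W_small \<union> W_big" "W_small \<inter> W_big = {}"
  by (auto simp: W_small_def W_big_def)

lemma finites [simp]: "finite N" "finite W" "finite W_small" "finite W_big"
  using finite_nb finite_sub[OF V_eq(4)] W_split(1) by auto

lemma sum_W: "(\<Sum>w\<in>W. f w) = (\<Sum>w\<in>W_small. f w) + (\<Sum>w\<in>W_big. f w :: real)"
  by (subst W_split(1)) (simp add: sum.union_disjoint W_split(2))

lemma nonneg: "0 \<le> arcs_N" "0 \<le> arcs_W" "0 \<le> M_small" "0 \<le> M_big"
  by (simp_all add: arcs_N_def arcs_W_def M_small_def M_big_def sum_nonneg deg_in_nonneg)

lemma nb_N: "v \<in> N \<Longrightarrow> R `` {v} = insert u (N \<inter> R `` {v} \<union> W \<inter> R `` {v})"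
  using V_eq(1) nb_sub arc_sym by auto

lemma nb_W: "w \<in> W \<Longrightarrow> R `` {w} = N \<inter> R `` {w} \<union> W \<inter> R `` {w}"
  using V_eq(1,3) nb_sub arc_sym by (auto simp: W_def)

lemma sum_nb_N:
  assumes "v \<in> N"
  shows "(\<Sum>w\<in>R `` {v}. f w) = f u + (\<Sum>w\<in>N \<inter> R `` {v}. f w) + (\<Sum>w\<in>W \<inter> R `` {v}. f w :: real)"
  using V_eq(2,3) u_notin_N
  by (subst nb_N[OF assms]) (simp add: sum.insert_if sum.union_disjoint disjoint_iff)

lemma sum_nb_W:
  assumes "w \<in> W"
  shows "(\<Sum>z\<in>R `` {w}. f z) = (\<Sum>z\<in>N \<inter> R `` {w}. f z) + (\<Sum>z\<in>W \<inter> R `` {w}. f z :: real)"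
  using V_eq(2) by (subst nb_W[OF assms]) (subst sum.union_disjoint; auto)

lemma sum_V: "(\<Sum>v\<in>V. f v) = f u + (\<Sum>v\<in>N. f v) + (\<Sum>v\<in>W. f v :: real)"
  using V_eq(2,3) u_notin_N by (subst V_eq(1)) (simp add: sum.union_disjoint)

lemma edge_count: "real m = card N + arcs_N / 2 + arcs_W / 2 + M_small + M_big"
proof -
  have c: "deg_in V v = (\<Sum>w\<in>R `` {v}. 1)" for v
    using nb_sub[of v] by (simp add: deg_in_def Int_absorb1)
  have "2 * real m = (\<Sum>v\<in>V. deg_in V v)" using card_R card_R_eq by simp
  also have "\<dots> = deg_in V u + (\<Sum>v\<in>N. deg_in V v) + (\<Sum>v\<in>W. deg_in V v)"
    by (rule sum_V)
  also have "deg_in V u = card N" by (simp add: c)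
  also have "(\<Sum>v\<in>N. deg_in V v) = (\<Sum>v\<in>N. 1 + deg_in N v + deg_in W v)"
    using sum_nb_N[of _ "\<lambda>_. 1"] by (intro sum.cong refl) (simp add: deg_in_def Int_absorb1 nb_sub)
  also have "\<dots> = card N + arcs_N + (\<Sum>w\<in>W. deg_in N w)"
    by (simp add: sum.distrib arcs_N_def sum_deg_in_swap[of N W])
  also have "(\<Sum>v\<in>W. deg_in V v) = (\<Sum>v\<in>W. deg_in N v + deg_in W v)"
    using sum_nb_W[of _ "\<lambda>_. 1"] by (intro sum.cong refl) (simp add: deg_in_def Int_absorb1 nb_sub)
  also have "\<dots> = (\<Sum>w\<in>W. deg_in N w) + arcs_W" by (simp add: sum.distrib arcs_W_def)
  also have "(\<Sum>w\<in>W. deg_in N w) = M_small + M_big" by (simp add: sum_W M_small_def M_big_def)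
  finally show ?thesis by simp
qed

text \<open>
  Walks of length 2 from \<open>u\<close>, weighted by the entries at their ends. Compared with \<open>edge_count\<close>, an edge
  from \<open>N\<close> to \<open>w\<close> loses \<open>1 - x w\<close>.
\<close>

lemma l_square: "l\<^sup>2 = card N + (\<Sum>v\<in>N. deg_in N v * x v) + (\<Sum>w\<in>W. deg_in N w * x w)"
proof -
  have "l = (\<Sum>v\<in>N. x v)" using eigD[OF u_V] x_u by simp
  then have "l\<^sup>2 = (\<Sum>v\<in>N. l * x v)" by (simp add: power2_eq_square sum_distrib_left)
  also have "\<dots> = (\<Sum>v\<in>N. 1 + (\<Sum>w\<in>N \<inter> R `` {v}. x w) + (\<Sum>w\<in>W \<inter> R `` {v}. x w))"
    using nb_sub by (intro sum.cong refl) (subst eigD; auto simp: sum_nb_N x_u)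
  also have "\<dots> = card N + (\<Sum>v\<in>N. \<Sum>w\<in>N \<inter> R `` {v}. x w) + (\<Sum>v\<in>N. \<Sum>w\<in>W \<inter> R `` {v}. x w)"
    by (simp add: sum.distrib)
  finally show ?thesis using sum_nb_swap_const[of N N x] sum_nb_swap_const[of N W x] by simp
qed

text \<open>
  Two neighbours of \<open>v\<close> inside \<open>N\<close> would put two triangles on the edge \<open>uv\<close>.
\<close>

lemma deg_N_le_1: "v \<in> N \<Longrightarrow> deg_in N v \<le> 1"
  using no_diamond[of u v] arc_sym by (intro deg_in_le_1) blast

lemma common_neighbours:
  assumes "w \<in> W" "deg_in N w > 1"
  obtains p q where "p \<noteq> q" "p \<in> N" "q \<in> N" "(w, p) \<in> R" "(w, q) \<in> R"
proof -
  have "\<not> card (N \<inter> R `` {w}) \<le> Suc 0" using assms by (simp add: deg_in_def)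
  then show thesis using that finite_nb card_le_Suc0_iff_eq[of "N \<inter> R `` {w}"] by blast
qed

text \<open>
  Otherwise \<open>uv\<close> would lie on the triangle \<open>u v v'\<close> and on a 4-cycle through \<open>w\<close>, with edge-disjoint
  remainders.
\<close>

lemma no_triangle_at_common_neighbour:
  assumes w: "w \<in> W" "deg_in N w > 1" and v: "v \<in> N" "(w, v) \<in> R" "v' \<in> N" "(v, v') \<in> R"
  shows False
proof -
  have W: "w \<noteq> u" "(u, w) \<notin> R" using w by (auto simp: W_def)
  have R: "(u, v) \<in> R" "(u, v') \<in> R" "(v', v) \<in> R" using v arc_sym by auto
  obtain p0 q0 where pq: "p0 \<noteq> q0" "p0 \<in> N" "q0 \<in> N" "(w, p0) \<in> R" "(w, q0) \<in> R"
    by (rule common_neighbours[OF w])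
  define p where "p = (if p0 = v then q0 else p0)"
  have p: "p \<noteq> v" "(u, p) \<in> R" "(w, p) \<in> R" using pq by (auto simp: p_def)
  show False
  proof (cases "(w, v') \<in> R")
    case True
    have "(v, u) \<in> R" "(v, w) \<in> R" using v arc_sym by blast+
    then have "u = w" using no_diamond[of v v' u w] v(4) R(2) True by simp
    then show False using W by simp
  next
    case False
    then have "p \<noteq> v'" using p by auto
    moreover have "(p, w) \<in> R" using p arc_sym by blast
    moreover have "v' \<noteq> w" "v \<noteq> w" "p \<noteq> w" using R p W by auto
    moreover have "u \<noteq> v" "u \<noteq> v'" "v \<noteq> v'" "u \<noteq> p" using R p R_irrefl by blast+
    ultimately show False
      using no_triangle_on_4_cycle[of u v v' p w] W(1) R p v(2) by auto
  qed
qed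

text \<open>
  Edges inside \<open>N\<close> count twice among the walks of length 2, so their contribution must be shown to be
  small. A vertex of a triangle at \<open>u\<close> has entry at most its degree over \<open>l\<close>, and the edges from it to
  \<open>W\<close> end in \<open>W_small\<close>.
\<close>

lemma sum_N_le: "(\<Sum>v\<in>N. deg_in N v * x v) \<le> (2 * arcs_N + M_small) / l"
proof -
  \<comment> \<open>the vertices of the triangles at \<open>u\<close>\<close>
  define N1 where "N1 = {v \<in> N. deg_in N v > 0}"
  have fin: "finite N1" by (rule finite_subset[of N1 N]) (auto simp: N1_def)
  have N1: "deg_in N v = 1" if "v \<in> N1" for v
  proof -
    from that have "0 < card (N \<inter> R `` {v})" by (simp add: N1_def deg_in_def)
    then have "1 \<le> deg_in N v" by (simp add: deg_in_def)
    then show ?thesis using deg_N_le_1[of v] that by (simp add: N1_def)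
  qed
  have split: "(\<Sum>v\<in>N. f v) = (\<Sum>v\<in>N1. f v)" if "\<And>v. v \<in> N \<Longrightarrow> deg_in N v = 0 \<Longrightarrow> f v = 0" for f :: "'a \<Rightarrow> real"
  proof (rule sum.mono_neutral_right)
    show "\<forall>v\<in>N - N1. f v = 0"
    proof
      fix v assume v: "v \<in> N - N1"
      then have "deg_in N v = 0" using deg_in_nonneg[of N v] by (auto simp: N1_def)
      then show "f v = 0" using that v by simp
    qed
  qed (auto simp: N1_def)
  have "l * (\<Sum>v\<in>N. deg_in N v * x v) = (\<Sum>v\<in>N1. l * x v)"
    by (subst split) (auto simp: N1 sum_distrib_left)
  also have "\<dots> \<le> (\<Sum>v\<in>N1. 2 + deg_in W v)"
  proof (rule sum_mono)
    fix v assume v: "v \<in> N1"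
    then have "v \<in> N" by (simp add: N1_def)
    then have "l * x v = 1 + (\<Sum>w\<in>N \<inter> R `` {v}. x w) + (\<Sum>w\<in>W \<inter> R `` {v}. x w)"
      using eigD[of v] nb_sub sum_nb_N[of v x] x_u by auto
    also have "\<dots> \<le> 1 + deg_in N v + deg_in W v"
      using sum_x_le_deg_in[OF nb_sub, of u v] sum_x_le_deg_in[OF V_eq(4), of v] by simp
    finally show "l * x v \<le> 2 + deg_in W v" using N1[OF v] by simp
  qed
  also have "\<dots> = 2 * arcs_N + (\<Sum>w\<in>W. deg_in N1 w)"
  proof -
    have "arcs_N = card N1" unfolding arcs_N_def by (subst split) (auto simp: N1)
    then show ?thesis using sum_deg_in_swap[OF fin, of W] by (simp add: sum.distrib)
  qed
  also have "(\<Sum>w\<in>W. deg_in N1 w) \<le> M_small"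
  proof -
    have "deg_in N1 w = 0" if "w \<in> W" "deg_in N w > 1" for w
    proof -
      have "N1 \<inter> R `` {w} = {}"
      proof (rule ccontr)
        assume "N1 \<inter> R `` {w} \<noteq> {}"
        then obtain v where v: "v \<in> N1" "(w, v) \<in> R" by auto
        then have "N \<inter> R `` {v} \<noteq> {}" "v \<in> N" by (auto simp: N1_def deg_in_def)
        then obtain v' where "v' \<in> N" "(v, v') \<in> R" by auto
        then show False using no_triangle_at_common_neighbour[OF that \<open>v \<in> N\<close> v(2)] by blast
      qed
      then show ?thesis by (simp add: deg_in_def)
    qed
    then have "(\<Sum>w\<in>W_big. deg_in N1 w) = 0"
      by (intro sum.neutral) (auto simp: W_big_def)
    moreover have "(\<Sum>w\<in>W_small. deg_in N1 w) \<le> M_small"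
      unfolding M_small_def by (intro sum_mono deg_in_mono) (auto simp: N1_def)
    ultimately show ?thesis by (simp add: sum_W)
  qed
  finally show ?thesis using l_pos by (simp add: field_simps)
qed

lemma l_x_W_le:
  assumes "w \<in> W" shows "l * x w \<le> deg_in N w + deg_in W w"
  using assms eigD[of w] sum_nb_W[OF assms, of x] V_eq(4)
    sum_x_le_deg_in[OF nb_sub, of u w] sum_x_le_deg_in[OF V_eq(4), of w] by auto

lemma sum_small_le: "(\<Sum>w\<in>W_small. deg_in N w * x w) \<le> (2 * M_small + 2 * arcs_W) / l"
proof -
  have "l * (\<Sum>w\<in>W_small. deg_in N w * x w) = (\<Sum>w\<in>W_small. deg_in N w * (l * x w))"
    by (simp add: sum_distrib_left mult.left_commute)
  also have "\<dots> \<le> (\<Sum>w\<in>W_small. 2 * deg_in N w + 2 * deg_in W w)"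
  proof (rule sum_mono)
    fix w assume w: "w \<in> W_small"
    then have "deg_in N w * (l * x w) \<le> deg_in N w * (deg_in N w + deg_in W w)"
      by (intro mult_left_mono l_x_W_le deg_in_nonneg) (simp add: W_small_def)
    also have "\<dots> \<le> 2 * (deg_in N w + deg_in W w)"
      using w deg_in_nonneg[of N w] deg_in_nonneg[of W w] by (intro mult_right_mono) (auto simp: W_small_def)
    finally show "deg_in N w * (l * x w) \<le> 2 * deg_in N w + 2 * deg_in W w" by simp
  qed
  also have "\<dots> = 2 * M_small + 2 * (\<Sum>w\<in>W_small. deg_in W w)"
    by (simp add: M_small_def sum.distrib sum_distrib_left)
  also have "(\<Sum>w\<in>W_small. deg_in W w) \<le> arcs_W"
    unfolding arcs_W_def by (intro sum_mono2) (auto simp: W_split(1) deg_in_nonneg)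
  finally show ?thesis using l_pos by (simp add: field_simps)
qed

text \<open>
  If \<open>v\<close> had neighbours \<open>w\<close> and \<open>w'\<close> in \<open>W_big\<close>, the edge \<open>uv\<close> would lie on two 4-cycles, one through
  each of them, that share nothing else; three common neighbours leave enough choice for this.
\<close>

lemma deg_W_big_le_1:
  assumes "v \<in> N" shows "deg_in W_big v \<le> 1"
proof (rule deg_in_le_1, rule ccontr)
  fix w w' assume w: "w \<in> W_big" "w' \<in> W_big" "(v, w) \<in> R" "(v, w') \<in> R" "w \<noteq> w'"
  then have W: "w \<in> W" "w' \<in> W" "card (N \<inter> R `` {w}) > 2" "card (N \<inter> R `` {w'}) > 2"
    by (auto simp: W_big_def deg_in_def)
  have "N \<inter> R `` {w'} - {v} \<noteq> {}"
  proof
    assume "N \<inter> R `` {w'} - {v} = {}"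
    then have "card (N \<inter> R `` {w'}) \<le> card {v}" by (intro card_mono) auto
    then show False using W by simp
  qed
  then obtain q where q: "q \<in> N" "(w', q) \<in> R" "q \<noteq> v" by auto
  have "N \<inter> R `` {w} - {v, q} \<noteq> {}"
  proof
    assume "N \<inter> R `` {w} - {v, q} = {}"
    then have "card (N \<inter> R `` {w}) \<le> card {v, q}" by (intro card_mono) auto
    then show False using W q by simp
  qed
  then obtain p where p: "p \<in> N" "(w, p) \<in> R" "p \<noteq> v" "p \<noteq> q" by auto
  have W': "u \<noteq> w" "u \<noteq> w'" "w \<notin> N" "w' \<notin> N" using W(1,2) by (auto simp: W_def)
  have "u \<noteq> v" "u \<noteq> p" "u \<noteq> q" using p q assms R_irrefl by blast+
  moreover have "(p, w) \<in> R" "(q, w') \<in> R" "(w, v) \<in> R" "(w', v) \<in> R" using p q w arc_sym by blast+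
  moreover have "v \<noteq> w" "v \<noteq> w'" "p \<noteq> w" "p \<noteq> w'" "q \<noteq> w" "q \<noteq> w'"
    using W'(3,4) p q assms by blast+
  ultimately show False
    using no_two_4_cycles[of u v p w q w'] p q w W' assms by auto
qed

text \<open>
  The parts of \<open>N\<close> used by the vertices of \<open>W_big\<close> are disjoint, so \<open>l\<close> times the sum of their entries is
  at most the sum of the entries over \<open>N\<close>, which is \<open>l\<close>, up to the edges inside \<open>W\<close>.
\<close>

lemma sum_big_le: "(\<Sum>w\<in>W_big. x w) \<le> 1 + arcs_W / l"
proof -
  have "l * (\<Sum>w\<in>W_big. x w) = (\<Sum>w\<in>W_big. (\<Sum>z\<in>N \<inter> R `` {w}. x z) + (\<Sum>z\<in>W \<inter> R `` {w}. x z))"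
    unfolding sum_distrib_left using V_eq(4)
    by (intro sum.cong refl) (subst eigD; auto simp: W_big_def sum_nb_W)
  also have "\<dots> = (\<Sum>v\<in>N. deg_in W_big v * x v) + (\<Sum>w\<in>W_big. \<Sum>z\<in>W \<inter> R `` {w}. x z)"
    using sum_nb_swap_const[of W_big N x] by (simp add: sum.distrib)
  also have "(\<Sum>v\<in>N. deg_in W_big v * x v) \<le> (\<Sum>v\<in>N. 1 * x v)"
    by (intro sum_mono mult_right_mono deg_W_big_le_1 x_nonneg)
  also have "\<dots> = l" using eigD[OF u_V] x_u by simp
  also have "(\<Sum>w\<in>W_big. \<Sum>z\<in>W \<inter> R `` {w}. x z) \<le> (\<Sum>w\<in>W_big. deg_in W w)"
    by (intro sum_mono sum_x_le_deg_in V_eq)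
  also have "\<dots> \<le> arcs_W"
    unfolding arcs_W_def by (intro sum_mono2) (auto simp: W_split(1) deg_in_nonneg)
  finally show ?thesis using l_pos by (simp add: field_simps)
qed

text \<open>
  A neighbour \<open>v\<close> of \<open>u\<close> for which \<open>uv\<close> is not a bridge has another neighbour, in \<open>N\<close> or in \<open>W\<close>.
\<close>

lemma card_N_le: "card N \<le> M_big + M_small + arcs_N + s"
proof -
  \<comment> \<open>these account for at most \<open>s\<close> of the neighbours of \<open>u\<close>\<close>
  define Bu where "Bu = {v \<in> N. {u, v} \<in> bridges R}"
  have "1 \<le> (if v \<in> Bu then 1 else 0) + deg_in N v + deg_in W_small v + deg_in W_big v"
    if v: "v \<in> N" for v
  proof (cases "v \<in> Bu")
    case True
    then show ?thesis using deg_in_nonneg by (simp add: add_nonneg_nonneg)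
  next
    case False
    then have "{v, u} \<notin> bridges R" "(v, u) \<in> R" using v arc_sym by (auto simp: Bu_def insert_commute)
    then obtain c where c: "c \<noteq> u" "(v, c) \<in> R" using leaf_neighbour by blast
    then have "c \<in> N \<or> c \<in> W_small \<or> c \<in> W_big" using V_eq(1) R_sub W_split(1) by blast
    then show ?thesis using False deg_in_ge_1[OF _ c(2)] deg_in_nonneg[of _ v]
      by (smt (verit, best))
  qed
  then have "(\<Sum>v\<in>N. 1) \<le> (\<Sum>v\<in>N. (if v \<in> Bu then 1 else 0) + deg_in N v + deg_in W_small v + deg_in W_big v)"
    by (rule sum_mono)
  also have "\<dots> = (\<Sum>v\<in>N. if v \<in> Bu then 1 else 0) + arcs_N + M_small + M_big"
    by (simp add: sum.distrib arcs_N_def M_small_def M_big_def sum_deg_in_swap[of N W_small] sum_deg_in_swap[of N W_big])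
  also have "(\<Sum>v\<in>N. if v \<in> Bu then 1 else 0 :: real) = card Bu"
    by (simp add: sum.If_cases Bu_def Int_def)
  also have "card Bu \<le> s"
  proof -
    have "card Bu = card ((\<lambda>v. {u, v}) ` Bu)"
      by (rule card_image[symmetric]) (auto simp: inj_on_def doubleton_eq_iff)
    also have "\<dots> \<le> card (bridges R)" by (rule card_mono) (auto simp: Bu_def finite_bridges)
    finally show ?thesis using few_bridges by simp
  qed
  finally show ?thesis by simp
qed

text \<open>
  The loss \<open>m - l\<^sup>2\<close> is at most \<open>k = s + 2\<close>. It bounds the number \<open>Q\<close> of edges that are neither at \<open>u\<close> nor
  between \<open>N\<close> and \<open>W_big\<close>, and then forces some \<open>w0\<close> in \<open>W_big\<close> to have an entry of at least \<open>9/10\<close>. The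
  remaining entries on \<open>W_big\<close> are small because the sum of all is about 1, so the edges at these
  vertices are lost as well and there are \<open>O(k)\<close> of them.
\<close>

theorem large_common_neighbourhood:
  "\<exists>w\<in>W. 2 < deg_in N w \<and> real m + 2 \<le> 2 * deg_in N w + 5 * (real s + 2)"
proof -
  define k where "k = real s + 2"
  have k: "k \<ge> 2" "l \<ge> 430 * k" using l_ge by (auto simp: k_def)
  have mk: "real m \<ge> 186624 * k\<^sup>2"
  proof -
    have "real ((432 * (s + 2))\<^sup>2) \<le> real m" using m_large by (rule of_nat_mono)
    then show ?thesis by (simp add: k_def power2_eq_square algebra_simps)
  qed
  have k2: "k\<^sup>2 \<ge> 2 * k" using k by (simp add: power2_eq_square)
  define Q where "Q = M_small + arcs_N / 2 + arcs_W / 2"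
  define D where "D = (\<Sum>w\<in>W_big. deg_in N w * (1 - x w))"
  have D: "D = M_big - (\<Sum>w\<in>W_big. deg_in N w * x w)"
    by (simp add: D_def M_big_def algebra_simps sum_subtractf)
  have tm: "0 \<le> deg_in N w * (1 - x w)" if "w \<in> W_big" for w
    using that V_eq(4) by (intro mult_nonneg_nonneg deg_in_nonneg) (auto simp: W_big_def x_le_1)
  have Dnn: "0 \<le> D" unfolding D_def using tm by (rule sum_nonneg)
  have Qnn: "0 \<le> Q" "M_small \<le> Q" "arcs_N \<le> 2 * Q" "arcs_W \<le> 2 * Q" "M_small + arcs_N \<le> 2 * Q" using nonneg by (auto simp: Q_def)
  have "real m - l\<^sup>2 \<ge> D + Q - (2 * arcs_N + 3 * M_small + 2 * arcs_W) / l"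
    using edge_count l_square sum_N_le sum_small_le
    by (simp add: sum_W D Q_def add_divide_distrib)
  moreover have "(2 * arcs_N + 3 * M_small + 2 * arcs_W) / l \<le> (4 * Q) / 860"
  proof -
    have "(2 * arcs_N + 3 * M_small + 2 * arcs_W) / l \<le> (4 * Q) / l"
      using nonneg l_pos by (intro divide_right_mono) (auto simp: Q_def)
    also have "\<dots> \<le> (4 * Q) / 860" using k Qnn by (intro divide_left_mono) auto
    finally show ?thesis .
  qed
  moreover have "real m - l\<^sup>2 \<le> k" using l_large by (simp add: k_def)
  ultimately have DQ: "D + 99 / 100 * Q \<le> k" using Qnn(1) by linarith
  have mC: "real m = card N + Q + M_big" using edge_count by (simp add: Q_def)
  have m2: "real m \<le> 2 * M_big + k - 2 + 3 * Q" using mC card_N_le Qnn(5) by (simp add: k_def)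
  have Qk: "Q \<le> 102 / 100 * k" using DQ Dnn k by simp
  have Cbig: "M_big \<ge> 20 * k" using m2 Qk mk k2 k by simp
  have "\<exists>w0\<in>W_big. x w0 \<ge> 9 / 10"
  proof (rule ccontr)
    assume "\<not> ?thesis"
    then have "(\<Sum>w\<in>W_big. deg_in N w * (1 / 10)) \<le> D"
      unfolding D_def by (intro sum_mono mult_left_mono deg_in_nonneg) (auto simp: not_le)
    then have "M_big * (1 / 10) \<le> D" by (simp only: M_big_def sum_distrib_right)
    then show False using Cbig DQ Qnn k by simp
  qed
  then obtain w0 where w0: "w0 \<in> W_big" "x w0 \<ge> 9 / 10" by blast
  define M_big' where "M_big' = (\<Sum>w\<in>W_big - {w0}. deg_in N w)"
  have M_big': "M_big = deg_in N w0 + M_big'" unfolding M_big_def M_big'_def using w0 by (simp add: sum.remove)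
  have M_big'nn: "0 \<le> M_big'" unfolding M_big'_def by (intro sum_nonneg deg_in_nonneg)
  have "arcs_W / l \<le> 1 / 100"
  proof -
    have "arcs_W \<le> 204 / 100 * k" using Qnn Qk by simp
    also have "\<dots> \<le> 1 / 100 * l" using k by simp
    finally show ?thesis using l_pos by (simp add: divide_le_eq)
  qed
  then have "(\<Sum>w\<in>W_big. x w) \<le> 101 / 100" using sum_big_le by linarith
  moreover have "(\<Sum>w\<in>W_big. x w) = x w0 + (\<Sum>w\<in>W_big - {w0}. x w)" using w0 by (simp add: sum.remove)
  ultimately have others: "(\<Sum>w\<in>W_big - {w0}. x w) \<le> 11 / 100" using w0 by simp
  have xs: "x w \<le> 11 / 100" if "w \<in> W_big - {w0}" for w
  proof -
    have "x w \<le> (\<Sum>w\<in>W_big - {w0}. x w)" by (rule member_le_sum[OF that]) (auto simp: x_nonneg)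
    then show ?thesis using others by linarith
  qed
  have "89 / 100 * M_big' \<le> (\<Sum>w\<in>W_big - {w0}. deg_in N w * (1 - x w))"
    unfolding M_big'_def sum_distrib_left
  proof (rule sum_mono)
    fix w assume "w \<in> W_big - {w0}"
    then have "deg_in N w * (89 / 100) \<le> deg_in N w * (1 - x w)"
      using xs by (intro mult_left_mono deg_in_nonneg) auto
    then show "89 / 100 * deg_in N w \<le> deg_in N w * (1 - x w)" by simp
  qed
  also have "\<dots> \<le> D" unfolding D_def using tm by (intro sum_mono2) auto
  finally have "89 / 100 * M_big' + 99 / 100 * Q \<le> k" using DQ by simp
  then have "2 * M_big' + 3 * Q \<le> 4 * k" using M_big'nn Qnn k by simp
  then have "real m + 2 \<le> 2 * deg_in N w0 + 5 * k" using m2 M_big' by simp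
  then show ?thesis using w0 by (auto simp: W_big_def k_def)
qed

end

section \<open>The cost of an edge outside the complete bipartite graph\<close>

lemma card_sym_irrefl_rel:
  assumes "finite R" "sym R" "irrefl R"
  shows "card R = 2 * card (rel_edges R)"
proof -
  define fib where "fib e = {p \<in> R. {fst p, snd p} = e}" for e
  have "R = (\<Union>e\<in>rel_edges R. fib e)" by (fastforce simp: fib_def rel_edges_def)
  then have "card R = card (\<Union>e\<in>rel_edges R. fib e)" by simp
  also have "\<dots> = (\<Sum>e\<in>rel_edges R. card (fib e))"
    using finite_rel_edges[OF assms(1)] assms(1)
    by (intro card_UN_disjoint) (auto simp: fib_def)
  also have "\<dots> = (\<Sum>e\<in>rel_edges R. 2)"
  proof (rule sum.cong[OF refl])
    fix e assume "e \<in> rel_edges R"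
    then obtain a b where e: "e = {a, b}" "(a, b) \<in> R" by (auto simp: rel_edges_def)
    then have "a \<noteq> b" "(b, a) \<in> R" using assms(2,3) by (auto simp: irrefl_def sym_def)
    then have "fib e = {(a, b), (b, a)}" using e by (auto simp: fib_def doubleton_eq_iff)
    then show "card (fib e) = 2" using \<open>a \<noteq> b\<close> by simp
  qed
  finally show ?thesis by simp
qed

text \<open>
  The second hub \<open>w\<close>: all but \<open>O(s)\<close> edges join a hub to a common neighbour of \<open>u\<close> and \<open>w\<close>.
\<close>

locale two_hubs = large_spectral_radius V R s l x u m
  for V :: "'a set" and R s l x u m +
  fixes w :: 'a
  assumes w_W: "w \<in> W" and w_deg: "2 < deg_in N w"
    and m_le: "real m + 2 \<le> 2 * deg_in N w + 5 * (real s + 2)"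
begin

text \<open>
  The common neighbours of the hubs are \<open>P\<close>, the private neighbours of \<open>u\<close> and \<open>w\<close> are \<open>A\<close> and \<open>B\<close>, and \<open>Z\<close>
  is the set of vertices that are not hubs. The edges fall into \<open>EK\<close>, which form the complete
  bipartite graph, the further edges \<open>EA\<close> and \<open>EB\<close> at the hubs, and the edges \<open>EF\<close> off the hubs.
\<close>

definition P :: "'a set" where "P = R `` {u} \<inter> R `` {w}"
definition A :: "'a set" where "A = R `` {u} - P"
definition B :: "'a set" where "B = R `` {w} - P"
definition Z :: "'a set" where "Z = V - {u, w}"
definition EA :: "'a set set" where "EA = (\<lambda>v. {u, v}) ` A"
definition EB :: "'a set set" where "EB = (\<lambda>v. {w, v}) ` B"
definition EK :: "'a set set" where "EK = (\<lambda>v. {u, v}) ` P \<union> (\<lambda>v. {w, v}) ` P"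
definition EF :: "'a set set" where "EF = rel_edges (R \<inter> Z \<times> Z)"

abbreviation "a \<equiv> card A"
abbreviation "b \<equiv> card B"
abbreviation "c \<equiv> card P"
abbreviation "f \<equiv> card EF"

lemma uw: "u \<noteq> w" "(u, w) \<notin> R" "(w, u) \<notin> R" "w \<in> V"
  using w_W arc_sym by (auto simp: W_def)

lemma deg_w: "deg_in N w = real c"
  by (simp add: deg_in_def P_def Int_commute)

lemma c_ge_3: "3 \<le> c"
  using w_deg by (simp add: deg_w)

lemma hub_nb: "R `` {u} = P \<union> A" "R `` {w} = P \<union> B" "P \<inter> A = {}" "P \<inter> B = {}" "A \<inter> B = {}"
  by (auto simp: P_def A_def B_def)

lemma in_Z: "P \<subseteq> Z" "A \<subseteq> Z" "B \<subseteq> Z" "Z \<subseteq> V" "u \<notin> Z" "w \<notin> Z"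
  using uw nb_sub R_irrefl arc_sym by (auto simp: P_def A_def B_def Z_def)

lemma fins [simp]: "finite P" "finite A" "finite B" "finite Z" "finite EF"
proof -
  show "finite P" "finite A" "finite B" by (auto simp: P_def A_def B_def finite_nb)
  show "finite Z" by (rule finite_sub[OF in_Z(4)])
  show "finite EF" unfolding EF_def by (rule finite_rel_edges) (simp add: finite_R)
qed

lemma arcs_cases:
  assumes "(p, q) \<in> R"
  obtains "p = u" "q \<in> P \<union> A" | "p = w" "q \<in> P \<union> B" | "q = u" "p \<in> P \<union> A" | "q = w" "p \<in> P \<union> B"
    | "p \<in> Z" "q \<in> Z"
proof -
  have "p \<in> V" "q \<in> V" using assms R_sub by auto
  moreover have "q \<in> P \<union> A" if "p = u" using assms that hub_nb(1) by blast
  moreover have "q \<in> P \<union> B" if "p = w" using assms that hub_nb(2) by blast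
  moreover have "p \<in> P \<union> A" if "q = u" using arc_sym[OF assms] that hub_nb(1) by blast
  moreover have "p \<in> P \<union> B" if "q = w" using arc_sym[OF assms] that hub_nb(2) by blast
  ultimately show thesis using that by (auto simp: Z_def)
qed

lemma hub_arcs: "p \<in> P \<Longrightarrow> (u, p) \<in> R" "p \<in> P \<Longrightarrow> (w, p) \<in> R" "p \<in> A \<Longrightarrow> (u, p) \<in> R" "p \<in> B \<Longrightarrow> (w, p) \<in> R"
  by (auto simp: P_def A_def B_def)

lemma EF_iff: "{p, q} \<in> EF \<longleftrightarrow> (p, q) \<in> R \<and> p \<in> Z \<and> q \<in> Z"
  using arc_sym by (auto simp: EF_def rel_edges_def doubleton_eq_iff)

lemma rel_edges_eq: "rel_edges R = EK \<union> (EA \<union> EB \<union> EF)"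
proof
  show "rel_edges R \<subseteq> EK \<union> (EA \<union> EB \<union> EF)"
  proof
    fix e assume "e \<in> rel_edges R"
    then obtain p q where e: "e = {p, q}" "(p, q) \<in> R" by (auto simp: rel_edges_def)
    from e(2) show "e \<in> EK \<union> (EA \<union> EB \<union> EF)"
      by (cases rule: arcs_cases) (auto simp: e EF_iff EK_def EA_def EB_def insert_commute)
  qed
  show "EK \<union> (EA \<union> EB \<union> EF) \<subseteq> rel_edges R"
    using hub_arcs in_rel_edges[OF sym_R] by (auto simp: EK_def EA_def EB_def) (auto simp: EF_def rel_edges_def)
qed

lemma card_extra: "card (EA \<union> EB \<union> EF) = a + b + f"
proof -
  have "card EA = a" "card EB = b"
    unfolding EA_def EB_def by (auto intro!: card_image simp: inj_on_def doubleton_eq_iff)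
  moreover have "EA \<inter> EB = {}" using in_Z uw by (auto simp: EA_def EB_def doubleton_eq_iff)
  moreover have "(EA \<union> EB) \<inter> EF = {}"
    using in_Z by (auto simp: EA_def EB_def EF_iff)
  ultimately show ?thesis by (simp add: card_Un_disjoint EA_def EB_def)
qed

lemma card_EK: "card EK = 2 * c"
proof -
  have "card ((\<lambda>v. {u, v}) ` P) = c" "card ((\<lambda>v. {w, v}) ` P) = c"
    by (auto intro!: card_image simp: inj_on_def doubleton_eq_iff)
  moreover have "(\<lambda>v. {u, v}) ` P \<inter> (\<lambda>v. {w, v}) ` P = {}" using uw in_Z by (auto simp: doubleton_eq_iff)
  ultimately show ?thesis by (simp add: EK_def card_Un_disjoint)
qed

lemma EK_disjoint: "EK \<inter> (EA \<union> EB \<union> EF) = {}"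
proof -
  have "EK \<inter> EF = {}" using in_Z by (auto simp: EK_def EF_iff)
  moreover have "EK \<inter> EA = {}" "EK \<inter> EB = {}"
    using in_Z hub_nb(3,4) uw by (auto simp: EK_def EA_def EB_def doubleton_eq_iff)
  ultimately show ?thesis by blast
qed

lemma m_eq: "m = 2 * c + (a + b + f)"
proof -
  have "2 * m = 2 * card (rel_edges R)" using card_R card_sym_irrefl_rel[OF finite_R sym_R irrefl_R] by simp
  then have "m = card (EK \<union> (EA \<union> EB \<union> EF))" by (simp add: rel_edges_eq)
  also have "\<dots> = card EK + card (EA \<union> EB \<union> EF)"
    by (intro card_Un_disjoint EK_disjoint) (auto simp: EK_def EA_def EB_def)
  finally show ?thesis by (simp add: card_EK card_extra)
qed

lemma extra_le: "real (a + b + f) + 2 \<le> 5 * (real s + 2)"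
  using m_le by (simp add: deg_w m_eq)

lemma deg_Z_le: "deg_in Z v \<le> f" if "v \<in> Z"
proof -
  have "card (Z \<inter> R `` {v}) = card ((\<lambda>z. {v, z}) ` (Z \<inter> R `` {v}))"
    by (rule card_image[symmetric]) (auto simp: inj_on_def doubleton_eq_iff)
  also have "\<dots> \<le> f" using that by (intro card_mono) (auto simp: EF_iff)
  finally show ?thesis by (simp add: deg_in_def)
qed

lemma sum_deg_Z: "(\<Sum>v\<in>Z. deg_in Z v) = 2 * f"
proof -
  have "R \<inter> Z \<times> Z = Sigma Z (\<lambda>v. Z \<inter> R `` {v})" by auto
  then have "card (R \<inter> Z \<times> Z) = (\<Sum>v\<in>Z. card (Z \<inter> R `` {v}))"
    by (simp add: card_SigmaI finite_nb)
  moreover have "card (R \<inter> Z \<times> Z) = 2 * f"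
    unfolding EF_def using finite_R sym_R irrefl_R
    by (intro card_sym_irrefl_rel) (auto simp: sym_def irrefl_def)
  ultimately show ?thesis by (simp add: deg_in_def)
qed

definition y :: real where "y = x w"
text \<open>
  The part of the eigenvalue equation at \<open>v\<close> that does not come from the hubs.
\<close>

definition T :: "'a \<Rightarrow> real" where "T v = (\<Sum>z\<in>Z \<inter> R `` {v}. x z)"

lemma sum_nb_Z:
  assumes "v \<in> Z"
  shows "l * x v = (if v \<in> P \<union> A then 1 else 0) + (if v \<in> P \<union> B then y else 0) + T v"
proof -
  have "R `` {v} = ({u, w} \<inter> R `` {v}) \<union> (Z \<inter> R `` {v})" using nb_sub by (auto simp: Z_def)
  then have "(\<Sum>z\<in>R `` {v}. x z) = (\<Sum>z\<in>({u, w} \<inter> R `` {v}) \<union> (Z \<inter> R `` {v}). x z)" by simp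
  also have "\<dots> = (\<Sum>z\<in>{u, w} \<inter> R `` {v}. x z) + T v"
    unfolding T_def by (intro sum.union_disjoint) (use in_Z fins in auto)
  also have "{u, w} \<inter> R `` {v} = (if v \<in> P \<union> A then {u} else {}) \<union> (if v \<in> P \<union> B then {w} else {})"
    using hub_nb(1,2) arc_sym by auto
  also have "(\<Sum>z\<in>\<dots>. x z) = (if v \<in> P \<union> A then 1 else 0) + (if v \<in> P \<union> B then y else 0)"
    using uw by (auto simp: x_u y_def)
  finally show ?thesis using eigD in_Z(4) assms by auto
qed

lemma hub_eq_u: "l\<^sup>2 = c * (1 + y) + a + (\<Sum>v\<in>P \<union> A. T v)"
proof -
  have "l\<^sup>2 = (\<Sum>v\<in>P \<union> A. l * x v)"
    using eigD[OF u_V] hub_nb(1) x_u by (simp add: power2_eq_square sum_distrib_left)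
  also have "\<dots> = (\<Sum>v\<in>P \<union> A. 1 + (if v \<in> P then y else 0) + T v)"
    using in_Z hub_nb by (intro sum.cong refl) (subst sum_nb_Z; auto)
  also have "\<dots> = card (P \<union> A) + (\<Sum>v\<in>P \<union> A. if v \<in> P then y else 0) + (\<Sum>v\<in>P \<union> A. T v)"
    by (simp add: sum.distrib)
  also have "card (P \<union> A) = c + a" by (simp add: card_Un_disjoint hub_nb)
  also have "(\<Sum>v\<in>P \<union> A. if v \<in> P then y else 0) = c * y"
    by (simp add: sum.inter_restrict[symmetric] Int_absorb1)
  finally show ?thesis by (simp add: algebra_simps)
qed

lemma hub_eq_w: "l\<^sup>2 * y = c * (1 + y) + b * y + (\<Sum>v\<in>P \<union> B. T v)"
proof -
  have "l\<^sup>2 * y = (\<Sum>v\<in>P \<union> B. l * x v)"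
    using eigD[OF uw(4)] hub_nb(2) by (simp add: power2_eq_square sum_distrib_left y_def mult.assoc)
  also have "\<dots> = (\<Sum>v\<in>P \<union> B. y + (if v \<in> P then 1 else 0) + T v)"
    using in_Z hub_nb by (intro sum.cong refl) (subst sum_nb_Z; auto)
  also have "\<dots> = card (P \<union> B) * y + (\<Sum>v\<in>P \<union> B. if v \<in> P then 1 else 0) + (\<Sum>v\<in>P \<union> B. T v)"
    by (simp add: sum.distrib)
  also have "card (P \<union> B) = c + b" by (simp add: card_Un_disjoint hub_nb)
  also have "(\<Sum>v\<in>P \<union> B. if v \<in> P then 1 else 0 :: real) = c"
    by (simp add: sum.inter_restrict[symmetric] Int_absorb1)
  finally show ?thesis by (simp add: algebra_simps)
qed

lemma T_nonneg: "0 \<le> T v"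
  unfolding T_def by (intro sum_nonneg x_nonneg)

lemma y_bounds: "0 < y" "y \<le> 1"
proof -
  have y0: "0 \<le> y" "y \<le> 1" using x_nonneg x_le_1 uw by (auto simp: y_def)
  have "0 < c * (1 + y)" using c_ge_3 y0 by simp
  also have "\<dots> \<le> l\<^sup>2 * y"
    using hub_eq_w y0 by (simp add: sum_nonneg T_nonneg)
  finally show "0 < y" using y0 by (cases "y = 0") auto
  show "y \<le> 1" by fact
qed

lemma l_square_ge: "2 * c \<le> l\<^sup>2"
proof -
  have "2 * c * y \<le> c * (1 + y)" using y_bounds by (simp add: algebra_simps mult_left_le_one_le)
  also have "\<dots> \<le> l\<^sup>2 * y"
    using hub_eq_w y_bounds by (simp add: sum_nonneg T_nonneg)
  finally show ?thesis using y_bounds(1) by simp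
qed

text \<open>
  A vertex off the hubs has degree at most \<open>2 + f\<close>, which is small compared with \<open>l\<close>, so each edge off
  the hubs contributes little.
\<close>

lemma sum_T_le:
  assumes "X \<subseteq> Z" shows "(\<Sum>v\<in>X. T v) \<le> f / 43"
proof -
  define k where "k = real s + 2"
  have xz: "x z \<le> 1 / 86" if "z \<in> Z" for z
  proof -
    have "T z \<le> deg_in Z z" unfolding T_def by (rule sum_x_le_deg_in[OF in_Z(4)])
    then have "l * x z \<le> 1 + 1 + real f"
      using sum_nb_Z[OF that] deg_Z_le[OF that] y_bounds by (auto split: if_splits)
    also have "\<dots> \<le> 5 * k" using extra_le by (simp add: k_def)
    also have "\<dots> \<le> l * (1 / 86)" using l_ge by (simp add: k_def)
    finally show ?thesis using l_pos by simp
  qed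
  have "(\<Sum>v\<in>X. T v) \<le> (\<Sum>v\<in>Z. T v)" using assms T_nonneg by (intro sum_mono2) auto
  also have "\<dots> = (\<Sum>z\<in>Z. deg_in Z z * x z)" unfolding T_def by (rule sum_nb_swap_const) auto
  also have "\<dots> \<le> (\<Sum>z\<in>Z. deg_in Z z * (1 / 86))"
    using xz by (intro sum_mono mult_left_mono deg_in_nonneg)
  also have "\<dots> = f / 43" by (simp add: sum_distrib_right[symmetric] sum_deg_Z sum_divide_distrib[symmetric])
  finally show ?thesis .
qed

text \<open>
  Adding the two hub equations gives \<open>(1 + y) l\<^sup>2 = 2 c (1 + y) + a + b y\<close> up to the small contribution of
  \<open>EF\<close>. Their difference shows that \<open>1 - y\<close> has order \<open>k / l\<^sup>2\<close>, so \<open>a + b y\<close> may be replaced by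
  \<open>(1 + y) (a + b) / 2\<close>; thus edges at a hub count one half and edges off the hubs nearly nothing,
  whereas in \<open>m\<close> every edge counts 1.
\<close>

theorem extra_edges_cost: "(real a + real b) / 2 + 19 / 20 * real f \<le> real m - l\<^sup>2 + 1 / 1000"
proof -
  define k where "k = real s + 2"
  have k: "k \<ge> 2" "430 * k \<le> l" using l_ge by (auto simp: k_def)
  define t where "t = l\<^sup>2"
  have t: "t \<ge> (430 * k)\<^sup>2" unfolding t_def using k by (intro power_mono) auto
  have tpos: "t > 0" using t k by (smt (verit) zero_less_power)
  have r: "real a + real b + real f \<le> 5 * k" using extra_le by (simp add: k_def)
  define U where "U = (\<Sum>v\<in>P \<union> A. T v)"
  define U' where "U' = (\<Sum>v\<in>P \<union> B. T v)"
  have U: "U \<le> f / 43" "U' \<le> f / 43" "0 \<le> U'" unfolding U_def U'_def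
    using sum_T_le[of "P \<union> A"] sum_T_le[of "P \<union> B"] in_Z by (auto intro!: sum_nonneg T_nonneg)
  have e1: "t = c * (1 + y) + a + U" using hub_eq_u by (simp add: U_def t_def)
  have e2: "t * y = c * (1 + y) + b * y + U'" using hub_eq_w by (simp add: U'_def t_def)
  have by0: "0 \<le> b * y" using y_bounds by simp
  have "t * (1 - y) = a + U - b * y - U'" using e1 e2 by (simp add: algebra_simps)
  also have "\<dots> \<le> 5 * k" using by0 U r by linarith
  finally have y1: "1 - y \<le> 5 * k / t" using tpos by (simp add: field_simps)
  have "(1 - y) * (real a - real b) \<le> (1 - y) * (5 * k)"
    using y_bounds r by (intro mult_left_mono) auto
  also have "\<dots> \<le> (5 * k / t) * (5 * k)" using y1 k by (intro mult_right_mono) auto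
  also have "\<dots> = 25 * k\<^sup>2 / t" by (simp add: power2_eq_square)
  also have "\<dots> \<le> 25 * k\<^sup>2 / (430 * k)\<^sup>2" using t k tpos by (intro divide_left_mono) auto
  also have "\<dots> = 25 / 184900" using k by (simp add: power_mult_distrib)
  finally have small: "(1 - y) * (real a - real b) \<le> 25 / 184900" .
  have "(1 + y) * (t - 2 * real c - (real a + real b) / 2) = (1 - y) * (real a - real b) / 2 + U + U'"
  proof -
    have "(1 + y) * t = 2 * c * (1 + y) + a + b * y + U + U'" using e1 e2 by (simp add: algebra_simps)
    then show ?thesis by (simp add: algebra_simps add_divide_distrib diff_divide_distrib)
  qed
  also have "\<dots> \<le> 1 / 1000 + 2 / 43 * real f" using small U by linarith
  also have "\<dots> \<le> (1 + y) * (1 / 1000 + 2 / 43 * real f)" using y_bounds by (simp add: mult_le_cancel_right1)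
  finally have "t - 2 * real c - (real a + real b) / 2 \<le> 1 / 1000 + 2 / 43 * real f" using y_bounds by simp
  moreover have "real m = 2 * real c + real a + real b + real f" using m_eq by simp
  moreover have "0 \<le> real f" by simp
  ultimately show ?thesis unfolding t_def by (simp add: field_simps)
qed

end

section \<open>Graphs that lose no more than the extremal graphs\<close>

lemma cost_arith:
  fixes A B F S :: real
  assumes "(A + B) / 2 + 19 / 20 * F \<le> S / 2 + 1 / 1000" "S \<le> A + B + F" "0 \<le> F"
  shows "F < 1" "A + B < S + 1"
proof -
  show "F < 1" using assms by (simp add: field_simps)
  show "A + B < S + 1" using assms by (simp add: field_simps)
qed

lemma cost_arith_odd:
  fixes A B F S X :: real
  assumes "(A + B) / 2 + 19 / 20 * F \<le> S / 2 + 2 + 1 / 1000" "X + S = A + B + F" "1 \<le> F" "3 \<le> X"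
  shows "F < 2" "X < 4"
proof -
  show "F < 2" using assms by (simp add: field_simps)
  show "X < 4" using assms by (simp add: field_simps)
qed

text \<open>
  Solves the eigenvalue equations at two adjacent vertices that have the same further neighbour, with
  entry \<open>h\<close>.
\<close>

lemma triangle_at_hub:
  fixes l p p' h :: real
  assumes l: "l > 1" and p: "l * p = h + p'" "l * p' = h + p"
  shows "p + p' = 2 * h / (l - 1)"
proof -
  have "(l - 1) * (p + p') = 2 * h" using p by (simp add: algebra_simps)
  then show ?thesis using l by (simp add: field_simps)
qed

text \<open>
  For a triangle at one hub the hub equations multiply to the assumption; moving the \<open>b\<close> pendant edges
  of the other hub to the hub of the triangle changes the left side by \<open>b (d + T)\<close>.
\<close>

lemma triangle_arith:
  fixes q d b c T :: real
  assumes "(q - d - T) * (q - b) = c\<^sup>2" "0 < T" "0 \<le> b" "0 \<le> d"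
  shows "(q - (d + b) - T) * q \<le> c\<^sup>2" "(q - (d + b) - T) * q = c\<^sup>2 \<Longrightarrow> b = 0"
proof -
  have e: "(q - (d + b) - T) * q = c\<^sup>2 - b * (d + T)"
    unfolding assms(1)[symmetric] by (simp add: algebra_simps)
  show "(q - (d + b) - T) * q \<le> c\<^sup>2" using assms by (simp add: e)
  show "b = 0" if "(q - (d + b) - T) * q = c\<^sup>2" using that assms by (simp add: e)
qed

lemma hub_product:
  fixes X Y c y :: real
  assumes "X = c * y" "Y * y = c"
  shows "X * Y = c\<^sup>2"
proof -
  have "X * Y = c * (Y * y)" using assms(1) by simp
  then show ?thesis by (simp add: assms(2) power2_eq_square)
qed

text \<open>
  The path \<open>u z z' w\<close> with entries \<open>p\<close>, \<open>p'\<close> at \<open>z\<close>, \<open>z'\<close>, and \<open>d\<close>, \<open>e\<close> pendant edges at the hubs \<open>u\<close>, \<open>w\<close>.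
  Eliminating \<open>p\<close> and \<open>p'\<close>, the path acts as \<open>\<alpha>\<close> pendant edges at each hub and adds \<open>\<beta>\<close> to the coupling \<open>c\<close>
  between the hubs, where \<open>\<alpha> + \<beta> = l / (l - 1)\<close>. A triangle acts as \<open>2 (\<alpha> + \<beta>)\<close> pendant edges at a single hub, and
  concentrating them is better because \<open>\<beta> < \<alpha>\<close>.
\<close>

lemma path_arith:
  fixes l p p' q c y d e :: real
  assumes l: "l > 1" and p: "l * p = 1 + p'" "l * p' = y + p" and y: "y > 0"
    and q: "q = c * y + (d + 1) + p'" "q * y = c + (e + 1) * y + p" and qc: "c \<le> q"
    and nn: "0 \<le> d" "0 \<le> e"
  shows "(q - (d + e) - 2 * l / (l - 1)) * q < c\<^sup>2"
proof -
  define D where "D = l\<^sup>2 - 1"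
  have D: "D > 0" using l less_1_mult[OF l l] by (simp add: D_def power2_eq_square)
  have "D * p = l * (l * p) - p" "D * p' = l * (l * p') - p'" by (simp_all add: D_def power2_eq_square algebra_simps)
  then have "D * p = l + y" "D * p' = l * y + 1" using p by (simp_all add: algebra_simps)
  then have pp: "p = (l + y) / D" "p' = (l * y + 1) / D" using D by (simp_all add: field_simps)
  define \<alpha> where "\<alpha> = 1 + 1 / D"
  define \<beta> where "\<beta> = l / D"
  have ab: "\<alpha> + \<beta> = l / (l - 1)"
  proof -
    have "D = (l - 1) * (l + 1)" by (simp add: D_def power2_eq_square algebra_simps)
    moreover have "\<alpha> + \<beta> = (D + 1 + l) / D" using D by (simp add: \<alpha>_def \<beta>_def field_simps)
    moreover have "D + 1 + l = l * (l + 1)" by (simp add: D_def power2_eq_square algebra_simps)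
    ultimately show ?thesis using l by simp
  qed
  have "\<beta> < \<alpha>"
  proof -
    have "l < D + 1" using l by (simp add: D_def power2_eq_square)
    then show ?thesis using D by (simp add: \<alpha>_def \<beta>_def field_simps)
  qed
  have b0: "0 < \<beta>" using D l by (simp add: \<beta>_def)
  have 1: "q - d - \<alpha> = (c + \<beta>) * y" using q(1) D by (simp add: pp \<alpha>_def \<beta>_def field_simps)
  have 2: "(q - e - \<alpha>) * y = c + \<beta>" using q(2) D by (simp add: pp \<alpha>_def \<beta>_def field_simps)
  have "(q - d - \<alpha>) * (q - e - \<alpha>) = (c + \<beta>) * ((q - e - \<alpha>) * y)" unfolding 1 by simp
  then have prod: "(q - d - \<alpha>) * (q - e - \<alpha>) = (c + \<beta>)\<^sup>2" by (simp add: 2 power2_eq_square)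
  have "(q - (d + e) - 2 * (\<alpha> + \<beta>)) * q = (q - d - \<alpha>) * (q - e - \<alpha>) - (d + \<alpha>) * (e + \<alpha>) - 2 * \<beta> * q"
    by (simp add: algebra_simps)
  also have "\<dots> = c\<^sup>2 + \<beta>\<^sup>2 - (d + \<alpha>) * (e + \<alpha>) - 2 * \<beta> * (q - c)"
    unfolding prod by (simp add: power2_eq_square algebra_simps)
  also have "\<dots> < c\<^sup>2"
  proof -
    have "\<beta>\<^sup>2 < \<alpha>\<^sup>2" using \<open>\<beta> < \<alpha>\<close> b0 by (intro power_strict_mono) auto
    also have "\<alpha>\<^sup>2 \<le> (d + \<alpha>) * (e + \<alpha>)" unfolding power2_eq_square
      using nn b0 \<open>\<beta> < \<alpha>\<close> by (intro mult_mono) auto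
    finally show ?thesis using b0 qc by (smt (verit) mult_nonneg_nonneg)
  qed
  finally show ?thesis by (simp add: ab)
qed

context two_hubs
begin

lemma bridges_eq_s: "card (bridges R) = s"
proof -
  obtain p q r where pqr: "p \<in> P" "q \<in> P" "r \<in> P" "distinct [p, q, r]"
  proof -
    obtain P' where "P' \<subseteq> P" "card P' = 3" using c_ge_3 by (meson obtain_subset_with_card_n)
    then obtain p q r where "P' = {p, q, r}" "p \<noteq> q" "q \<noteq> r" "p \<noteq> r" by (auto simp: card_3_iff)
    then show thesis using that \<open>P' \<subseteq> P\<close> by auto
  qed
  have "s \<le> card (bridges R)"
  proof (rule many_bridges_of_K23[of u p w q r])
    show "(u, p) \<in> R" "(u, q) \<in> R" "(u, r) \<in> R" using pqr hub_arcs(1) by blast+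
    show "(p, w) \<in> R" "(q, w) \<in> R" "(r, w) \<in> R" using pqr hub_arcs(2) arc_sym by blast+
    show "distinct [u, w, p, q, r]" using pqr uw(1) in_Z by auto
  qed
  then show ?thesis using few_bridges by simp
qed

lemma EK_not_bridge: "EK \<inter> bridges R = {}"
proof -
  have "{u, p} \<notin> bridges R \<and> {w, p} \<notin> bridges R" if p: "p \<in> P" for p
  proof -
    have "P - {p} \<noteq> {}"
    proof
      assume "P - {p} = {}"
      then have "card P \<le> card {p}" by (intro card_mono) auto
      then show False using c_ge_3 by simp
    qed
    then obtain q where q: "q \<in> P" "q \<noteq> p" by blast
    have "{u, p} \<notin> bridges R"
      using not_bridge_in_4_cycle[of u p q w] hub_arcs(1,2)[OF p] hub_arcs(1,2)[OF q(1)]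
        arc_sym[OF hub_arcs(2)[OF q(1)]] q(2) uw(1) by simp
    moreover have "{w, p} \<notin> bridges R"
      using not_bridge_in_4_cycle[of w p q u] hub_arcs(1,2)[OF p] hub_arcs(1,2)[OF q(1)]
        arc_sym[OF hub_arcs(1)[OF q(1)]] q(2) uw(1) by simp
    ultimately show ?thesis by blast
  qed
  then show ?thesis by (auto simp: EK_def)
qed

lemma bridges_extra: "bridges R \<subseteq> EA \<union> EB \<union> EF"
  using bridges_subset rel_edges_eq EK_not_bridge by blast

lemma finite_extra: "finite (EA \<union> EB \<union> EF)"
  by (auto simp: EA_def EB_def)

lemma s_le: "s \<le> a + b + f"
  using card_mono[OF finite_extra bridges_extra] by (simp add: bridges_eq_s card_extra)

text \<open>
  The graph is connected, so every vertex other than \<open>u\<close> has a neighbour.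
\<close>

lemma vertices_eq:
  assumes "\<And>p q. (p, q) \<in> R \<Longrightarrow> p \<in> Z \<Longrightarrow> q \<in> Z \<Longrightarrow> p \<in> A \<union> B"
  shows "V = {u, w} \<union> P \<union> A \<union> B"
proof
  show "V \<subseteq> {u, w} \<union> P \<union> A \<union> B"
  proof
    fix v assume v: "v \<in> V"
    show "v \<in> {u, w} \<union> P \<union> A \<union> B"
    proof (cases "v = u")
      case False
      then obtain z where z: "(v, z) \<in> R" using connected[OF v u_V] by (meson converse_rtranclE)
      then show ?thesis by (cases rule: arcs_cases) (use assms[OF z] in auto)
    qed simp
  qed
  show "{u, w} \<union> P \<union> A \<union> B \<subseteq> V" using in_Z u_V uw by auto
qed

text \<open>
  The \<open>s\<close> bridges alone exhaust the permitted loss.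
\<close>

theorem no_extra_cost:
  assumes "real m - l\<^sup>2 \<le> real s / 2"
  shows "EF = {}" "a + b = s" "m = 2 * c + s" "V = {u, w} \<union> P \<union> A \<union> B"
    "(l\<^sup>2 - c - a) * (l\<^sup>2 - c - b) = (real c)\<^sup>2"
proof -
  have cost: "(real a + real b) / 2 + 19 / 20 * real f \<le> real s / 2 + 1 / 1000"
    using extra_edges_cost assms by simp
  have ge: "real s \<le> real a + real b + real f" using s_le by (metis of_nat_add of_nat_mono)
  have "real f < 1" by (rule cost_arith(1)[OF cost ge]) simp
  then have f: "f = 0" by linarith
  then show EF: "EF = {}" by simp
  have "real a + real b < real s + 1" by (rule cost_arith(2)[OF cost ge]) simp
  then show ab: "a + b = s" using s_le f by linarith
  then show "m = 2 * c + s" using m_eq f by simp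
  show "V = {u, w} \<union> P \<union> A \<union> B" using vertices_eq EF EF_iff by blast
  have T0: "T v = 0" if "v \<in> Z" for v
  proof -
    have "Z \<inter> R `` {v} = {}" using EF that EF_iff by blast
    then show ?thesis by (simp add: T_def)
  qed
  have "(\<Sum>v\<in>P \<union> A. T v) = 0" "(\<Sum>v\<in>P \<union> B. T v) = 0"
    using in_Z T0 by (auto intro!: sum.neutral)
  then have e: "l\<^sup>2 - c - a = c * y" "(l\<^sup>2 - c - b) * y = c"
    using hub_eq_u hub_eq_w by (simp_all add: algebra_simps)
  have "(l\<^sup>2 - c - a) * (l\<^sup>2 - c - b) = c * (y * (l\<^sup>2 - c - b))" using e(1) by simp
  also have "\<dots> = c * c" using e(2) by (simp add: mult.commute)
  finally show "(l\<^sup>2 - c - a) * (l\<^sup>2 - c - b) = (real c)\<^sup>2" by (simp add: power2_eq_square)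
qed

text \<open>
  The private neighbour \<open>v\<close> of a hub has a second edge if its edge to the hub is no bridge; that edge
  cannot end in a hub.
\<close>

lemma nonbridge_extra_end:
  assumes v: "v \<in> A \<and> h = u \<or> v \<in> B \<and> h = w" and nb: "{h, v} \<notin> bridges R"
  shows "\<exists>z. {v, z} \<in> EF"
proof -
  have "(v, h) \<in> R" using v hub_arcs arc_sym by blast
  moreover have "{v, h} \<notin> bridges R" using nb by (simp add: insert_commute)
  ultimately obtain z where z: "z \<noteq> h" "(v, z) \<in> R" using leaf_neighbour by blast
  from z(2) show ?thesis
    by (cases rule: arcs_cases) (use z v in_Z hub_nb in \<open>auto simp: EF_iff\<close>)
qed

lemma EK_end: "{p, q} \<in> EK \<Longrightarrow> p \<in> {u, w} \<union> P"
  by (auto simp: EK_def doubleton_eq_iff)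

text \<open>
  An edge between two common neighbours would lie on a triangle with each hub.
\<close>

lemma core_edge:
  assumes "(p, q) \<in> R" "p \<in> {u, w} \<union> P" "q \<in> {u, w} \<union> P"
  shows "{p, q} \<in> EK"
proof -
  have "\<not> (p \<in> P \<and> q \<in> P)"
  proof
    assume pq: "p \<in> P \<and> q \<in> P"
    have "u = w" by (rule no_diamond[OF assms(1)]) (use pq hub_arcs arc_sym in auto)
    then show False using uw by simp
  qed
  then show ?thesis using assms uw R_irrefl[OF assms(1)]
    by (auto simp: EK_def insert_commute)
qed

text \<open>
  Let \<open>X\<close> be the set of non-bridges outside \<open>EK\<close>. By parity its size is odd, and by cost at most 3. A
  single such edge is impossible: its ends carry other non-bridges, so it would join two vertices of
  the complete bipartite graph. Three edges leave room for only one off the hubs, and every non-bridge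
  at a hub continues along that one.
\<close>

theorem odd_extra_structure:
  assumes cost: "real m - l\<^sup>2 \<le> real s / 2 + 2" and odd: "odd (m + s)"
  obtains z z' where "EF = {{z, z'}}" "z \<noteq> z'" "z \<in> A \<union> B" "z' \<in> A \<union> B" "a + b = s + 2" "m = 2 * c + s + 3"
proof -
  define X where "X = (EA \<union> EB \<union> EF) - bridges R"
  have finX: "finite X" using finite_extra by (simp add: X_def)
  have cardX: "card X + s = a + b + f"
    using card_Diff_subset[OF finite_bridges bridges_extra] s_le
    by (simp add: X_def card_extra bridges_eq_s)
  have ineq: "(real a + real b) / 2 + 19 / 20 * real f \<le> real s / 2 + 2 + 1 / 1000"
    using extra_edges_cost cost by simp
  have oddX: "odd (card X)" using odd cardX m_eq by presburger
  have XR: "X \<subseteq> rel_edges R" by (auto simp: X_def rel_edges_eq)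
  have f1: "f \<ge> 1"
  proof (rule ccontr)
    assume "\<not> ?thesis"
    then have "f = 0" by linarith
    then have "EF = {}" by simp
    then have "X = {}" using nonbridge_extra_end by (auto simp: X_def EA_def EB_def)
    then show False using oddX by simp
  qed
  have X1: "card X \<noteq> 1"
  proof
    assume "card X = 1"
    then obtain e where e: "X = {e}" by (meson card_1_singletonE)
    then obtain p q where pq: "e = {p, q}" "(p, q) \<in> R" using XR by (auto simp: rel_edges_def)
    have nb: "{p, q} \<notin> bridges R" "{p, q} \<notin> EK" using e pq EK_disjoint by (auto simp: X_def)
    have core: "p' \<in> {u, w} \<union> P" if pq': "(p', q') \<in> R" "{p', q'} = e" for p' q'
    proof -
      obtain z where z: "z \<noteq> q'" "(p', z) \<in> R" "{p', z} \<notin> bridges R"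
        using nonbridge_extends[of p' q'] pq' nb pq by auto
      have "{p', z} \<noteq> e" using z(1) pq' by (auto simp: doubleton_eq_iff)
      moreover have "{p', z} \<in> rel_edges R" using z(2) in_rel_edges[OF sym_R] by simp
      then have "{p', z} \<in> EK \<or> {p', z} \<in> X" using z(3) by (simp add: X_def rel_edges_eq)
      ultimately have "{p', z} \<in> EK" using e by simp
      then show ?thesis by (rule EK_end)
    qed
    have "p \<in> {u, w} \<union> P" using core[of p q] pq by simp
    moreover have "q \<in> {u, w} \<union> P" using core[of q p] pq arc_sym by (simp add: insert_commute)
    ultimately show False using core_edge[OF pq(2)] nb by simp
  qed
  have "card X \<ge> 3" using oddX X1 by presburger
  have "real (card X) + real s = real a + real b + real f" using cardX by (metis of_nat_add)
  note cost_arith_odd[OF ineq this]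
  then have "real f < 2" "real (card X) < 4" using f1 \<open>card X \<ge> 3\<close> by simp_all
  then have f: "f = 1" and X3: "card X = 3" using f1 \<open>card X \<ge> 3\<close> by linarith+
  obtain e where e: "EF = {e}" using f by (meson card_1_singletonE)
  then have "e \<in> rel_edges (R \<inter> Z \<times> Z)" by (simp add: EF_def)
  then obtain z z' where z: "e = {z, z'}" "(z, z') \<in> R" by (auto simp: rel_edges_def)
  have ne: "z \<noteq> z'" using z R_irrefl by blast
  \<comment> \<open>the unique edge from a private neighbour to its hub\<close>
  define h where "h v = (if v \<in> A then {u, v} else {w, v})" for v
  have sub: "X \<subseteq> insert {z, z'} (h ` ({z, z'} \<inter> (A \<union> B)))"
  proof
    fix g assume g: "g \<in> X"
    then consider "g = {z, z'}" | v where "v \<in> A" "g = {u, v}" | v where "v \<in> B" "g = {w, v}"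
      using e z by (auto simp: X_def EA_def EB_def)
    then show "g \<in> insert {z, z'} (h ` ({z, z'} \<inter> (A \<union> B)))"
    proof cases
      case 2
      then obtain v' where "{v, v'} \<in> EF" using nonbridge_extra_end[of v u] g by (auto simp: X_def)
      then have "v \<in> {z, z'}" using e z by (auto simp: doubleton_eq_iff)
      then have "v \<in> {z, z'} \<inter> (A \<union> B)" "g = h v" using 2 by (auto simp: h_def)
      then show ?thesis by blast
    next
      case 3
      then obtain v' where "{v, v'} \<in> EF" using nonbridge_extra_end[of v w] g by (auto simp: X_def)
      then have "v \<in> {z, z'}" using e z by (auto simp: doubleton_eq_iff)
      moreover have "v \<notin> A" using 3 hub_nb(5) by blast
      ultimately have "v \<in> {z, z'} \<inter> (A \<union> B)" "g = h v" using 3 by (auto simp: h_def)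
      then show ?thesis by blast
    qed simp
  qed
  have "3 \<le> card (insert {z, z'} (h ` ({z, z'} \<inter> (A \<union> B))))"
    using card_mono[OF _ sub] X3 by simp
  also have "\<dots> \<le> Suc (card (h ` ({z, z'} \<inter> (A \<union> B))))" by (simp add: card_insert_if)
  also have "\<dots> \<le> Suc (card ({z, z'} \<inter> (A \<union> B)))" by (simp add: card_image_le)
  finally have "card {z, z'} \<le> card ({z, z'} \<inter> (A \<union> B))" using ne by simp
  then have "{z, z'} \<inter> (A \<union> B) = {z, z'}" by (intro card_subset_eq) (auto intro: order_antisym card_mono)
  then have "z \<in> A \<union> B" "z' \<in> A \<union> B" by blast+
  moreover have "a + b = s + 2" "m = 2 * c + s + 3" using cardX X3 f m_eq by auto
  ultimately show thesis using that e z ne by blast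
qed

text \<open>
  The two ends of the edge off the hubs are private neighbours of the hubs: of the same hub for a
  triangle, of different hubs for a path of length 3.
\<close>

theorem odd_extremal_inequality:
  fixes z z' :: 'a
  defines "q \<equiv> l\<^sup>2 - c"
  assumes EF: "EF = {{z, z'}}" and ne: "z \<noteq> z'" and z: "z \<in> A \<union> B" "z' \<in> A \<union> B"
    and ab: "a + b = s + 2"
  shows odd_vertices: "V = {u, w} \<union> P \<union> A \<union> B"
    and odd_le: "(q - s - 2 * l / (l - 1)) * q \<le> (real c)\<^sup>2"
    and odd_eq: "(q - s - 2 * l / (l - 1)) * q = (real c)\<^sup>2 \<Longrightarrow>
      z \<in> A \<and> z' \<in> A \<and> B = {} \<or> z \<in> B \<and> z' \<in> B \<and> A = {}"
proof -
  have l1: "l > 1" by (rule less_le_trans[OF _ l_ge]) simp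
  define p where "p = x z"
  define p' where "p' = x z'"
  have zz: "(z, z') \<in> R" "z \<in> Z" "z' \<in> Z" "z \<notin> P" "z' \<notin> P"
    using EF_iff[of z z'] EF z hub_nb by auto
  have Rz: "Z \<inter> R `` {v} = (if v = z then {z'} else {}) \<union> (if v = z' then {z} else {})" if "v \<in> Z" for v
  proof -
    have "(v, r) \<in> R \<and> r \<in> Z \<longleftrightarrow> {v, r} = {z, z'}" for r using EF EF_iff[of v r] that by auto
    then have "r \<in> Z \<inter> R `` {v} \<longleftrightarrow> v = z \<and> r = z' \<or> v = z' \<and> r = z" for r
      by (simp add: doubleton_eq_iff conj_commute)
    then have "Z \<inter> R `` {v} = {r. v = z \<and> r = z' \<or> v = z' \<and> r = z}" by blast
    then show ?thesis by auto
  qed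
  show V: "V = {u, w} \<union> P \<union> A \<union> B"
  proof (rule vertices_eq)
    fix v r assume "(v, r) \<in> R" "v \<in> Z" "r \<in> Z"
    then have "{v, r} = {z, z'}" using EF EF_iff[of v r] by simp
    then have "v = z \<or> v = z'" by (auto simp: doubleton_eq_iff)
    then show "v \<in> A \<union> B" using z by blast
  qed
  have T: "T v = (if v = z then p' else 0) + (if v = z' then p else 0)" if "v \<in> Z" for v
    unfolding T_def Rz[OF that] using ne by (auto simp: p_def p'_def)
  have sumT: "(\<Sum>v\<in>P \<union> X. T v) = (if z \<in> X then p' else 0) + (if z' \<in> X then p else 0)"
    if "X \<subseteq> Z" "finite X" for X
  proof -
    have "(\<Sum>v\<in>P \<union> X. T v) = (\<Sum>v\<in>P \<union> X. (if v = z then p' else 0) + (if v = z' then p else 0))"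
      using in_Z that by (intro sum.cong T) auto
    also have "\<dots> = (if z \<in> X then p' else 0) + (if z' \<in> X then p else 0)"
      using that zz by (simp add: sum.distrib sum.delta)
    finally show ?thesis .
  qed
  have qu: "q = c * y + a + (if z \<in> A then p' else 0) + (if z' \<in> A then p else 0)"
    using hub_eq_u sumT[OF in_Z(2)] by (simp add: q_def algebra_simps)
  have qw: "q * y = c + b * y + (if z \<in> B then p' else 0) + (if z' \<in> B then p else 0)"
    using hub_eq_w sumT[OF in_Z(3)] by (simp add: q_def algebra_simps)
  have lp: "l * p = (if z \<in> A then 1 else 0) + (if z \<in> B then y else 0) + p'"
      "l * p' = (if z' \<in> A then 1 else 0) + (if z' \<in> B then y else 0) + p"
    using sum_nb_Z[OF zz(2)] sum_nb_Z[OF zz(3)] T[OF zz(2)] T[OF zz(3)] zz ne by (simp_all add: p_def p'_def)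
  have disj: "v \<in> A \<Longrightarrow> v \<notin> B" for v using hub_nb(5) by blast
  have sab: "real s = real a + real b - 2" using ab by linarith
  have qc: "real c \<le> q" using l_square_ge by (simp add: q_def)
  have "(q - s - 2 * l / (l - 1)) * q \<le> (real c)\<^sup>2 \<and> ((q - s - 2 * l / (l - 1)) * q = (real c)\<^sup>2 \<longrightarrow>
      z \<in> A \<and> z' \<in> A \<and> B = {} \<or> z \<in> B \<and> z' \<in> B \<and> A = {})"
  proof -
    consider "z \<in> A" "z' \<in> A" | "z \<in> B" "z' \<in> B" | "z \<in> A" "z' \<in> B" | "z \<in> B" "z' \<in> A" using z by blast
    then show ?thesis
    proof cases
      case 1
      have "2 \<le> a" using card_mono[of A "{z, z'}"] 1 ne by simp
      have "p + p' = 2 * 1 / (l - 1)" using lp 1 disj by (intro triangle_at_hub[OF l1]) auto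
      then have "q - (real a - 2) - 2 * l / (l - 1) = c * y" "(q - b) * y = c"
        using qu qw 1 disj l1 by (auto simp: field_simps)
      then have "(q - (real a - 2) - 2 * l / (l - 1)) * (q - b) = (real c)\<^sup>2"
        by (rule hub_product)
      note tri = triangle_arith[OF this]
      have "s = real a - 2 + b" using sab by simp
      then show ?thesis using tri l1 \<open>2 \<le> a\<close> 1 by auto
    next
      case 2
      have nA: "z \<notin> A" "z' \<notin> A" using 2 disj by blast+
      have "2 \<le> b" using card_mono[of B "{z, z'}"] 2 ne by simp
      have "p + p' = 2 * y / (l - 1)" using lp 2 nA by (intro triangle_at_hub[OF l1]) auto
      moreover have "2 * y + 2 * y / (l - 1) = 2 * l / (l - 1) * y" using l1 by (simp add: field_simps)
      ultimately have "p + p' = 2 * l / (l - 1) * y - 2 * y" by simp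
      then have "(q - (real b - 2) - 2 * l / (l - 1)) * y = c"
        using qw 2 nA by (simp add: left_diff_distrib)
      moreover have "q - a = c * y" using qu nA by simp
      ultimately have "(q - a) * (q - (real b - 2) - 2 * l / (l - 1)) = (real c)\<^sup>2"
        by (intro hub_product)
      then have "(q - (real b - 2) - 2 * l / (l - 1)) * (q - a) = (real c)\<^sup>2"
        by (simp only: mult.commute)
      note tri = triangle_arith[OF this]
      have "s = real b - 2 + a" using sab by simp
      then show ?thesis using tri l1 \<open>2 \<le> b\<close> 2 by auto
    next
      case 3
      have n: "z \<notin> B" "z' \<notin> A" using 3 disj by blast+
      have "0 < a" "0 < b" using 3 by (auto simp: card_gt_0_iff)
      have "(q - ((real a - 1) + (real b - 1)) - 2 * l / (l - 1)) * q < (real c)\<^sup>2"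
        using lp 3 n qu qw qc y_bounds \<open>0 < a\<close> \<open>0 < b\<close> by (intro path_arith[OF l1, of p p' y]) auto
      moreover have "(real a - 1) + (real b - 1) = s" using sab by simp
      ultimately show ?thesis by simp
    next
      case 4
      have n: "z \<notin> A" "z' \<notin> B" using 4 disj by blast+
      have "0 < a" "0 < b" using 4 by (auto simp: card_gt_0_iff)
      have "(q - ((real a - 1) + (real b - 1)) - 2 * l / (l - 1)) * q < (real c)\<^sup>2"
        using lp 4 n qu qw qc y_bounds \<open>0 < a\<close> \<open>0 < b\<close> by (intro path_arith[OF l1, of p' p y]) auto
      moreover have "(real a - 1) + (real b - 1) = s" using sab by simp
      ultimately show ?thesis by simp
    qed
  qed
  then show "(q - s - 2 * l / (l - 1)) * q \<le> (real c)\<^sup>2"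
    and "(q - s - 2 * l / (l - 1)) * q = (real c)\<^sup>2 \<Longrightarrow>
      z \<in> A \<and> z' \<in> A \<and> B = {} \<or> z \<in> B \<and> z' \<in> B \<and> A = {}"
    by blast+
qed

end

section \<open>The extremal graphs\<close>

lemma star_K2_simps:
  "pverts (star_K2 s n) = {Centre, Opposite} \<union> Leaf ` {..<s} \<union> Mid ` {..<n}"
  "parcs (star_K2 s n) `` {Centre} = Leaf ` {..<s} \<union> Mid ` {..<n}"
  "parcs (star_K2 s n) `` {Opposite} = Mid ` {..<n}"
  "i < s \<Longrightarrow> parcs (star_K2 s n) `` {Leaf i} = {Centre}"
  "j < n \<Longrightarrow> parcs (star_K2 s n) `` {Mid j} = {Centre, Opposite}"
  by (auto simp: star_K2_def undirected_def star_K2_verts_def star_K2_arcs_def)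

lemma star_K2_triangle_simps:
  "pverts (star_K2_triangle s n) = {Centre, Opposite} \<union> Leaf ` {..<s} \<union> Mid ` {..<n} \<union> {Tri1, Tri2}"
  "parcs (star_K2_triangle s n) `` {Centre} = Leaf ` {..<s} \<union> Mid ` {..<n} \<union> {Tri1, Tri2}"
  "parcs (star_K2_triangle s n) `` {Opposite} = Mid ` {..<n}"
  "i < s \<Longrightarrow> parcs (star_K2_triangle s n) `` {Leaf i} = {Centre}"
  "j < n \<Longrightarrow> parcs (star_K2_triangle s n) `` {Mid j} = {Centre, Opposite}"
  "parcs (star_K2_triangle s n) `` {Tri1} = {Centre, Tri2}"
  "parcs (star_K2_triangle s n) `` {Tri2} = {Centre, Tri1}"
proof -
  have star: "parcs (star_K2_triangle s n) `` X = parcs (star_K2 s n) `` X \<union>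
      ({(Centre, Tri1), (Centre, Tri2), (Tri1, Tri2)} \<union> {(Centre, Tri1), (Centre, Tri2), (Tri1, Tri2)}\<inverse>) `` X" for X
  proof -
    have "(A \<union> E \<union> (A \<union> E)\<inverse>) `` X = (A \<union> A\<inverse>) `` X \<union> (E \<union> E\<inverse>) `` X" for A E :: "kvertex rel" by blast
    then show ?thesis by (simp only: star_K2_triangle_def star_K2_def undirected_def pair_pre_digraph.simps)
  qed
  have none: "parcs (star_K2 s n) `` {Tri1} = {}" "parcs (star_K2 s n) `` {Tri2} = {}"
    by (auto simp: star_K2_def undirected_def star_K2_arcs_def)
  show "pverts (star_K2_triangle s n) = {Centre, Opposite} \<union> Leaf ` {..<s} \<union> Mid ` {..<n} \<union> {Tri1, Tri2}"
    by (simp add: star_K2_triangle_def undirected_def star_K2_verts_def)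
  show "parcs (star_K2_triangle s n) `` {Centre} = Leaf ` {..<s} \<union> Mid ` {..<n} \<union> {Tri1, Tri2}"
    unfolding star star_K2_simps by auto
  show "parcs (star_K2_triangle s n) `` {Opposite} = Mid ` {..<n}"
    unfolding star star_K2_simps by auto
  show "i < s \<Longrightarrow> parcs (star_K2_triangle s n) `` {Leaf i} = {Centre}"
    unfolding star by (auto simp: star_K2_simps)
  show "j < n \<Longrightarrow> parcs (star_K2_triangle s n) `` {Mid j} = {Centre, Opposite}"
    unfolding star by (auto simp: star_K2_simps)
  show "parcs (star_K2_triangle s n) `` {Tri1} = {Centre, Tri2}"
    "parcs (star_K2_triangle s n) `` {Tri2} = {Centre, Tri1}"
    unfolding star none by auto
qed

lemma sum_Leaf: "(\<Sum>v\<in>Leaf ` {..<s}. f v) = (\<Sum>i<s. f (Leaf i))"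
  and sum_Mid: "(\<Sum>v\<in>Mid ` {..<n}. f v) = (\<Sum>j<n. f (Mid j))"
  by (simp_all add: sum.reindex inj_on_def)

text \<open>
  The positive solution of the eigenvalue equations off \<open>Centre\<close> with value \<open>q\<close> there, where
  \<open>q = l\<^sup>2 - n\<close>. The equation at \<open>Centre\<close> is the polynomial equation for \<open>l\<close>.
\<close>

definition star_K2_eigenfunction :: "real \<Rightarrow> real \<Rightarrow> real \<Rightarrow> kvertex \<Rightarrow> real" where
  "star_K2_eigenfunction l n q v = (case v of Centre \<Rightarrow> q | Opposite \<Rightarrow> n | Leaf _ \<Rightarrow> q / l
    | Mid _ \<Rightarrow> (q + n) / l | Tri1 \<Rightarrow> q / (l - 1) | Tri2 \<Rightarrow> q / (l - 1))"

lemma spectral_rad_star_K2: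
  assumes l: "l > 0" and n: "n > 0" and q: "q = l\<^sup>2 - real n" "q > 0" and eq: "(q - real s) * q = (real n)\<^sup>2"
  shows "\<rho> (star_K2 s n) = l"
proof (rule spectral_rad_eqI[OF pair_graph_star_K2])
  let ?y = "star_K2_eigenfunction l (real n) q"
  show "pverts (star_K2 s n) \<noteq> {}" by (auto simp: star_K2_simps)
  show "0 < ?y v" if "v \<in> pverts (star_K2 s n)" for v
    using that l n q by (auto simp: star_K2_simps star_K2_eigenfunction_def)
  have qn: "q + n = l * l" using q by (simp add: power2_eq_square)
  show "eigenfunction (pverts (star_K2 s n)) (parcs (star_K2 s n)) l ?y"
    unfolding eigenfunction_def
  proof
    fix v assume "v \<in> pverts (star_K2 s n)"
    then consider "v = Centre" | "v = Opposite" | i where "v = Leaf i" "i < s" | j where "v = Mid j" "j < n"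
      by (auto simp: star_K2_simps)
    then show "(\<Sum>w\<in>parcs (star_K2 s n) `` {v}. ?y w) = l * ?y v"
    proof cases
      case 1
      have "(\<Sum>w\<in>Leaf ` {..<s} \<union> Mid ` {..<n}. ?y w) = s * (q / l) + n * ((q + n) / l)"
        by (subst sum.union_disjoint) (auto simp: sum_Leaf sum_Mid star_K2_eigenfunction_def)
      also have "\<dots> = (s * q + n * q + (real n)\<^sup>2) / l" by (simp add: power2_eq_square add_divide_distrib algebra_simps)
      also have "s * q + n * q + (real n)\<^sup>2 = (q + n) * q" using eq by (simp add: algebra_simps)
      finally show ?thesis using 1 l by (simp add: star_K2_simps qn star_K2_eigenfunction_def)
    next
      case 2
      then show ?thesis using l by (simp add: star_K2_simps sum_Mid star_K2_eigenfunction_def qn)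
    next
      case 3
      then show ?thesis using l by (simp add: star_K2_simps star_K2_eigenfunction_def)
    next
      case 4
      then show ?thesis using l by (simp add: star_K2_simps star_K2_eigenfunction_def)
    qed
  qed
qed

lemma spectral_rad_star_K2_triangle:
  assumes l: "l > 1" and n: "n > 0" and q: "q = l\<^sup>2 - real n" "q > 0"
    and eq: "(q - real s - 2 * l / (l - 1)) * q = (real n)\<^sup>2"
  shows "\<rho> (star_K2_triangle s n) = l"
proof (rule spectral_rad_eqI[OF pair_graph_star_K2_triangle])
  let ?y = "star_K2_eigenfunction l (real n) q" and ?H = "star_K2_triangle s n"
  show "pverts ?H \<noteq> {}" by (auto simp: star_K2_triangle_simps)
  show "0 < ?y v" if "v \<in> pverts ?H" for v
    using that l n q by (auto simp: star_K2_triangle_simps star_K2_eigenfunction_def)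
  have qn: "q + n = l * l" using q by (simp add: power2_eq_square)
  show "eigenfunction (pverts ?H) (parcs ?H) l ?y"
    unfolding eigenfunction_def
  proof
    fix v assume "v \<in> pverts ?H"
    then consider "v = Centre" | "v = Opposite" | i where "v = Leaf i" "i < s" | j where "v = Mid j" "j < n"
      | "v = Tri1" | "v = Tri2"
      by (auto simp: star_K2_triangle_simps)
    then show "(\<Sum>w\<in>parcs ?H `` {v}. ?y w) = l * ?y v"
    proof cases
      case 1
      have "(\<Sum>w\<in>Leaf ` {..<s} \<union> Mid ` {..<n}. ?y w) = s * (q / l) + n * ((q + n) / l)"
        by (subst sum.union_disjoint) (auto simp: sum_Leaf sum_Mid star_K2_eigenfunction_def)
      moreover have "(\<Sum>w\<in>{Tri1, Tri2}. ?y w) = (2 * l / (l - 1) * q) / l"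
        using l by (simp add: star_K2_eigenfunction_def)
      moreover have "(\<Sum>w\<in>Leaf ` {..<s} \<union> Mid ` {..<n} \<union> {Tri1, Tri2}. ?y w) =
          (\<Sum>w\<in>Leaf ` {..<s} \<union> Mid ` {..<n}. ?y w) + (\<Sum>w\<in>{Tri1, Tri2}. ?y w)"
        by (rule sum.union_disjoint) auto
      ultimately have "(\<Sum>w\<in>parcs ?H `` {v}. ?y w) = (s * q + n * q + (real n)\<^sup>2 + 2 * l / (l - 1) * q) / l"
        by (simp add: 1 star_K2_triangle_simps power2_eq_square add_divide_distrib algebra_simps)
      also have "s * q + n * q + (real n)\<^sup>2 + 2 * l / (l - 1) * q = (q + n) * q"
        unfolding eq[symmetric] by (simp add: algebra_simps)
      finally show ?thesis using 1 l by (simp add: qn star_K2_eigenfunction_def)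
    next
      case 2
      then show ?thesis using l by (simp add: star_K2_triangle_simps sum_Mid star_K2_eigenfunction_def qn)
    next
      case 3
      then show ?thesis using l by (simp add: star_K2_triangle_simps star_K2_eigenfunction_def)
    next
      case 4
      then show ?thesis using l by (simp add: star_K2_triangle_simps star_K2_eigenfunction_def)
    next
      case 5
      then show ?thesis using l by (simp add: star_K2_triangle_simps star_K2_eigenfunction_def field_simps)
    next
      case 6
      then show ?thesis using l by (simp add: star_K2_triangle_simps star_K2_eigenfunction_def field_simps)
    qed
  qed
qed

text \<open>
  The polynomial exceeds \<open>n\<^sup>2\<close> for large \<open>l\<close>, so by the intermediate value theorem it takes the value
  \<open>n\<^sup>2\<close> at or above \<open>l\<close>, and the spectral radius is the only such point.
\<close>

lemma spectral_rad_star_K2_triangle_ge: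
  fixes l :: real and s n :: nat
  defines "g \<equiv> \<lambda>l. (l\<^sup>2 - real n - real s - 2 * l / (l - 1)) * (l\<^sup>2 - real n)"
  assumes l: "l > 1" and n: "n > 0" and q: "l\<^sup>2 > n" and le: "g l \<le> (real n)\<^sup>2"
  shows "l \<le> \<rho> (star_K2_triangle s n)"
    and "g l < (real n)\<^sup>2 \<Longrightarrow> l < \<rho> (star_K2_triangle s n)"
proof -
  \<comment> \<open>large enough that \<open>M\<^sup>2 - n - s - 2 M / (M - 1)\<close> and \<open>M\<^sup>2 - n\<close> are both at least \<open>n\<close>\<close>
  define M where "M = l + s + n + 4"
  have M: "M \<ge> 4" "M \<ge> l" "M \<ge> s + n + 4" using l by (auto simp: M_def)
  have "M * 4 \<le> M * M" using M by (intro mult_left_mono) auto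
  moreover have "2 * real n + s + 4 \<le> M * 4" using M(3) by simp
  ultimately have "2 * real n + s + 4 \<le> M * M" by linarith
  then have "M\<^sup>2 - n \<ge> n + s + 4" by (simp add: power2_eq_square)
  moreover have "2 * M / (M - 1) \<le> 4" using M by (simp add: field_simps)
  ultimately have "real n * real n \<le> g M" unfolding g_def by (intro mult_mono) auto
  then have gM: "(real n)\<^sup>2 \<le> g M" by (simp add: power2_eq_square)
  have "continuous_on {l..M} g" unfolding g_def using l by (intro continuous_intros) auto
  then obtain r where r: "l \<le> r" "g r = (real n)\<^sup>2" using IVT'[of g l _ M] le gM M(2) by blast
  have "l\<^sup>2 \<le> r\<^sup>2" using r l by (intro power_mono) auto
  then have "real n < r\<^sup>2" using q by linarith
  then have "\<rho> (star_K2_triangle s n) = r"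
    using r l n by (intro spectral_rad_star_K2_triangle[of r n "r\<^sup>2 - real n"]) (auto simp: g_def)
  then show "l \<le> \<rho> (star_K2_triangle s n)"
    "g l < (real n)\<^sup>2 \<Longrightarrow> l < \<rho> (star_K2_triangle s n)"
    using r by (auto simp: less_le)
qed

lemma inj_on_UnI: "inj_on f X \<Longrightarrow> inj_on f Y \<Longrightarrow> f ` X \<inter> f ` Y = {} \<Longrightarrow> inj_on f (X \<union> Y)"
  by (auto simp: inj_on_Un)

lemma inj_on_factor: "inj_on (g \<circ> e) X \<Longrightarrow> (\<And>v. v \<in> X \<Longrightarrow> f v = (g \<circ> e) v) \<Longrightarrow> inj_on f X"
  by (metis inj_on_cong)

lemma iso_star_K2:
  assumes G: "pair_graph G" and V: "pverts G = {h, h'} \<union> L \<union> P"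
    and R: "parcs G = S \<union> S\<inverse>" and S: "S = {h} \<times> L \<union> {h, h'} \<times> P"
    and d: "h \<noteq> h'" "{h, h'} \<inter> L = {}" "{h, h'} \<inter> P = {}" "L \<inter> P = {}"
  shows "G \<cong>\<^sub>g star_K2 (card L) (card P)"
proof -
  have fin: "finite L" "finite P" using pair_graph_facts(1)[OF G] V by auto
  obtain e where e: "bij_betw e L {..<card L}" using ex_bij_betw_finite_nat[OF fin(1)] by (auto simp: atLeast0LessThan)
  obtain e' where e': "bij_betw e' P {..<card P}" using ex_bij_betw_finite_nat[OF fin(2)] by (auto simp: atLeast0LessThan)
  define f where "f v = (if v = h then Centre else if v = h' then Opposite else if v \<in> L then Leaf (e v) else Mid (e' v))" for v
  have fh: "f h = Centre" "f h' = Opposite" using d by (auto simp: f_def)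
  have onL: "f v = (Leaf \<circ> e) v" if "v \<in> L" for v using d that by (auto simp: f_def)
  have onP: "f v = (Mid \<circ> e') v" if "v \<in> P" for v using d that by (auto simp: f_def)
  have "f ` L = (Leaf \<circ> e) ` L" "f ` P = (Mid \<circ> e') ` P" using onL onP by (auto intro!: image_cong)
  then have fL: "f ` L = Leaf ` {..<card L}" and fP: "f ` P = Mid ` {..<card P}"
    using bij_betw_imp_surj_on[OF e] bij_betw_imp_surj_on[OF e'] by (simp_all only: image_comp[symmetric])
  have inj_L: "inj_on f L" by (rule inj_on_factor[OF comp_inj_on onL]) (use bij_betw_imp_inj_on[OF e] in \<open>auto simp: inj_on_def\<close>)
  have inj_P: "inj_on f P" by (rule inj_on_factor[OF comp_inj_on onP]) (use bij_betw_imp_inj_on[OF e'] in \<open>auto simp: inj_on_def\<close>)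
  have inj: "inj_on f (pverts G)"
    unfolding V by (intro inj_on_UnI inj_L inj_P) (auto simp: fh fL fP image_Un)
  have "map_prod f f ` S = star_K2_arcs (card L) (card P)"
    unfolding S star_K2_arcs_def image_Un map_prod_surj_on[OF refl refl] by (simp add: fh fL fP)
  moreover have "map_prod f f ` (S\<inverse>) = (map_prod f f ` S)\<inverse>" by force
  ultimately have "parcs (star_K2 (card L) (card P)) = map_prod f f ` parcs G"
    by (simp add: R image_Un star_K2_def undirected_def)
  moreover have "pverts (star_K2 (card L) (card P)) = f ` pverts G"
    by (simp add: V image_Un fh fL fP star_K2_simps)
  ultimately show ?thesis using inj unfolding graph_iso_iff[OF G] map_prod_def by blast
qed

lemma iso_star_K2_triangle:
  assumes G: "pair_graph G" and V: "pverts G = {h, h'} \<union> L \<union> P \<union> {z, z'}"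
    and R: "parcs G = S \<union> S\<inverse>" and S: "S = {h} \<times> L \<union> {h, h'} \<times> P \<union> {(h, z), (h, z'), (z, z')}"
    and d: "h \<noteq> h'" "{h, h'} \<inter> L = {}" "{h, h'} \<inter> P = {}" "L \<inter> P = {}"
    and z: "z \<noteq> z'" "z \<notin> {h, h'} \<union> L \<union> P" "z' \<notin> {h, h'} \<union> L \<union> P"
  shows "G \<cong>\<^sub>g star_K2_triangle (card L) (card P)"
proof -
  have fin: "finite L" "finite P" using pair_graph_facts(1)[OF G] V by auto
  obtain e where e: "bij_betw e L {..<card L}" using ex_bij_betw_finite_nat[OF fin(1)] by (auto simp: atLeast0LessThan)
  obtain e' where e': "bij_betw e' P {..<card P}" using ex_bij_betw_finite_nat[OF fin(2)] by (auto simp: atLeast0LessThan)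
  define f where "f v = (if v = h then Centre else if v = h' then Opposite else if v = z then Tri1
    else if v = z' then Tri2 else if v \<in> L then Leaf (e v) else Mid (e' v))" for v
  have fh: "f h = Centre" "f h' = Opposite" "f z = Tri1" "f z' = Tri2" using d z by (auto simp: f_def)
  have onL: "f v = (Leaf \<circ> e) v" if "v \<in> L" for v using d z that by (auto simp: f_def)
  have onP: "f v = (Mid \<circ> e') v" if "v \<in> P" for v using d z that by (auto simp: f_def)
  have "f ` L = (Leaf \<circ> e) ` L" "f ` P = (Mid \<circ> e') ` P" using onL onP by (auto intro!: image_cong)
  then have fL: "f ` L = Leaf ` {..<card L}" and fP: "f ` P = Mid ` {..<card P}"
    using bij_betw_imp_surj_on[OF e] bij_betw_imp_surj_on[OF e'] by (simp_all only: image_comp[symmetric])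
  have inj_L: "inj_on f L" by (rule inj_on_factor[OF comp_inj_on onL]) (use bij_betw_imp_inj_on[OF e] in \<open>auto simp: inj_on_def\<close>)
  have inj_P: "inj_on f P" by (rule inj_on_factor[OF comp_inj_on onP]) (use bij_betw_imp_inj_on[OF e'] in \<open>auto simp: inj_on_def\<close>)
  have inj: "inj_on f (pverts G)"
    unfolding V by (intro inj_on_UnI inj_L inj_P) (auto simp: fh fL fP image_Un)
  have "map_prod f f ` S = star_K2_arcs (card L) (card P) \<union> {(Centre, Tri1), (Centre, Tri2), (Tri1, Tri2)}"
    unfolding S star_K2_arcs_def image_Un map_prod_surj_on[OF refl refl] by (simp add: fh fL fP)
  moreover have "map_prod f f ` (S\<inverse>) = (map_prod f f ` S)\<inverse>" by force
  ultimately have "parcs (star_K2_triangle (card L) (card P)) = map_prod f f ` parcs G"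
    by (simp add: R image_Un star_K2_triangle_def undirected_def)
  moreover have "pverts (star_K2_triangle (card L) (card P)) = f ` pverts G"
    by (simp add: V image_Un fh fL fP star_K2_triangle_simps)
  ultimately show ?thesis using inj unfolding graph_iso_iff[OF G] map_prod_def by blast
qed

section \<open>The extremal theorem\<close>

lemma four_k_le_size:
  assumes "k \<ge> 2" "(432 * k)\<^sup>2 \<le> m" shows "4 * k \<le> (m :: nat)"
proof -
  have "4 * k \<le> (432 * k) * (432 * k)" using assms(1) by (intro mult_le_mono) auto
  then show ?thesis using assms(2) by (simp only: power2_eq_square)
qed

lemma edges_eq_rel_edges: "edges G = rel_edges (parcs G)"
  by (simp add: edges_def rel_edges_def)

text \<open>
  Scales the Perron eigenfunction and picks a vertex of maximal entry as the first hub.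
\<close>

lemma two_hubs_of_large_spectral_radius:
  assumes k: "k \<ge> 2" and G: "pair_graph G" and min: "minimally_edge_connected k k G"
    and m: "m = graph_size G" "(432 * k)\<^sup>2 \<le> m"
    and l: "0 \<le> \<rho> G" "real m - real (k - 2) / 2 - 2 \<le> (\<rho> G)\<^sup>2"
  obtains x u w where "two_hubs (pverts G) (parcs G) (k - 2) (\<rho> G) x u m w"
proof -
  interpret bridge_critical_graph "pverts G" "parcs G" "k - 2"
    by (rule bridge_critical_graph_of_minimally_edge_connected[OF k G min])
  have cR: "card (parcs G) = 2 * m"
    using card_sym_irrefl_rel[OF finite_R sym_R irrefl_R] m by (simp add: graph_size_def edges_eq_rel_edges)
  have "0 < (432 * k)\<^sup>2" using k by simp
  then have "parcs G \<noteq> {}" using cR m(2) by auto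
  then have ne: "pverts G \<noteq> {}" using R_sub by auto
  obtain x where x: "\<And>v. 0 \<le> x v" "\<exists>v\<in>pverts G. x v \<noteq> 0" "eigenfunction (pverts G) (parcs G) (\<rho> G) x"
    using spectral_rad_perron[OF G ne] by metis
  have "Max (x ` pverts G) \<in> x ` pverts G" using finite_V ne by (intro Max_in) auto
  then obtain u where u: "u \<in> pverts G" "x u = Max (x ` pverts G)" by auto
  have le: "x v \<le> x u" if "v \<in> pverts G" for v using that finite_V by (simp add: u(2))
  obtain v where v: "v \<in> pverts G" "x v \<noteq> 0" using x(2) by blast
  then have xu: "x u > 0" using x(1)[of v] le[of v] by simp
  interpret large_spectral_radius "pverts G" "parcs G" "k - 2" "\<rho> G" "\<lambda>v. x v / x u" u m
  proof
    show "eigenfunction (pverts G) (parcs G) (\<rho> G) (\<lambda>v. x v / x u)"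
      using x(3) by (simp add: eigenfunction_def sum_divide_distrib[symmetric])
    have "k - 2 + 2 = k" using k by simp
    then show "(432 * (k - 2 + 2))\<^sup>2 \<le> m" using m(2) by (simp only:)
    show "u \<in> pverts G" "0 \<le> \<rho> G" "card (parcs G) = 2 * m" "real m - real (k - 2) / 2 - 2 \<le> (\<rho> G)\<^sup>2"
      by (fact u(1) l cR)+
    show "0 \<le> x v / x u" for v using x(1)[of v] xu by simp
    show "x u / x u = 1" using xu by simp
    show "x v / x u \<le> 1" if "v \<in> pverts G" for v using le[OF that] xu by simp
  qed
  obtain w where "w \<in> W" "2 < deg_in N w" "real m + 2 \<le> 2 * deg_in N w + 5 * (real (k - 2) + 2)"
    using large_common_neighbourhood by auto
  then have "two_hubs (pverts G) (parcs G) (k - 2) (\<rho> G) (\<lambda>v. x v / x u) u m w"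
    by unfold_locales
  then show thesis by (rule that)
qed

text \<open>
  The radicand is \<open>4 n\<^sup>2 + s\<^sup>2\<close>, and the square of the bound is the larger root of
  \<open>(t - n - s) (t - n) = n\<^sup>2\<close>.
\<close>

lemma bound_root:
  fixes s n :: real and k m :: real
  assumes n: "n > 0" and s: "s \<ge> 0" and k: "k = s + 2" and m: "m = 2 * n + s"
  defines "bound \<equiv> sqrt (2 * m + 2 * sqrt (2 * k\<^sup>2 - 2 * k * m + m\<^sup>2 - 8 * k + 4 * m + 8)) / 2"
  shows "bound > 0" "bound\<^sup>2 \<ge> m - s / 2" "bound\<^sup>2 \<ge> n + s" "bound\<^sup>2 > n"
    "(bound\<^sup>2 - n - s) * (bound\<^sup>2 - n) = n\<^sup>2"
proof -
  define E where "E = sqrt (4 * n\<^sup>2 + s\<^sup>2)"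
  have rad: "2 * k\<^sup>2 - 2 * k * m + m\<^sup>2 - 8 * k + 4 * m + 8 = 4 * n\<^sup>2 + s\<^sup>2"
    by (simp add: k m power2_eq_square algebra_simps)
  have E2: "E\<^sup>2 = 4 * n\<^sup>2 + s\<^sup>2" by (simp add: E_def)
  have E1: "2 * n \<le> E" unfolding E_def by (rule real_le_rsqrt) (simp add: power_mult_distrib)
  have E3: "s < E" unfolding E_def by (rule real_less_rsqrt) (use n in simp)
  have mE: "0 < m + E" using n s m E1 by linarith
  have bE: "bound = sqrt (2 * (m + E)) / 2" unfolding bound_def rad E_def[symmetric] by (simp only: distrib_left)
  have "(sqrt (2 * (m + E)))\<^sup>2 = 2 * (m + E)" using mE by (intro real_sqrt_pow2) simp
  then have b2: "bound\<^sup>2 = (m + E) / 2" by (simp add: bE power_divide)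
  show "bound > 0" unfolding bE using mE by simp
  show "bound\<^sup>2 \<ge> m - s / 2" "bound\<^sup>2 \<ge> n + s" "bound\<^sup>2 > n"
    unfolding b2 using E1 E3 n s m by auto
  have q: "bound\<^sup>2 - n = (E + s) / 2" "bound\<^sup>2 - n - s = (E - s) / 2"
    unfolding b2 m by (simp_all add: add_divide_distrib diff_divide_distrib)
  have "(E - s) / 2 * ((E + s) / 2) = (E\<^sup>2 - s\<^sup>2) / 4" by (simp add: power2_eq_square algebra_simps)
  also have "\<dots> = n\<^sup>2" by (simp add: E2)
  finally show "(bound\<^sup>2 - n - s) * (bound\<^sup>2 - n) = n\<^sup>2" by (subst q(2), subst q(1))
qed

context two_hubs
begin

lemma R_sym_closure:
  assumes K: "K = {u} \<times> A \<union> {w} \<times> B \<union> {u, w} \<times> P \<union> F"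
    and F: "F \<subseteq> R" "\<And>p q. (p, q) \<in> R \<Longrightarrow> p \<in> Z \<Longrightarrow> q \<in> Z \<Longrightarrow> (p, q) \<in> F \<union> F\<inverse>"
  shows "R = K \<union> K\<inverse>"
proof
  show "R \<subseteq> K \<union> K\<inverse>"
  proof (rule subrelI)
    fix p q assume pq: "(p, q) \<in> R"
    then show "(p, q) \<in> K \<union> K\<inverse>"
      by (cases rule: arcs_cases) (use F(2)[OF pq] in \<open>auto simp: K\<close>)
  qed
  have "K \<subseteq> R" using hub_arcs F(1) by (auto simp: K)
  then show "K \<union> K\<inverse> \<subseteq> R" using arc_sym by blast
qed

lemma hub_distinct: "u \<noteq> w" "{u, w} \<inter> A = {}" "{u, w} \<inter> B = {}" "{u, w} \<inter> P = {}"
  using uw in_Z by auto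

end

text \<open>
  With \<open>a\<close> and \<open>b\<close> pendant edges at the hubs, \<open>(q - s) q = n\<^sup>2 - a b\<close>. If \<open>q\<close> is at least the root \<open>q0\<close> of
  \<open>(q - s) q = n\<^sup>2\<close>, monotonicity forces \<open>q = q0\<close> and all pendant edges at one hub.
\<close>

lemma even_extremal:
  fixes k m :: nat and G :: "'a pair_pre_digraph"
  assumes k: "k \<ge> 2" and G: "pair_graph G" and min: "minimally_edge_connected k k G"
    and m: "m = graph_size G" "(432 * k)\<^sup>2 \<le> m" and even: "even (m + k)"
  defines "bound \<equiv> sqrt (2 * real m + 2 * sqrt (2 * (real k)\<^sup>2 - 2 * real k * real m
                     + (real m)\<^sup>2 - 8 * real k + 4 * real m + 8)) / 2"
    and "H \<equiv> star_K2 (k - 2) ((m - k + 2) div 2)"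
  shows "\<rho> H = bound" and "bound \<le> \<rho> G \<Longrightarrow> \<rho> G = bound \<and> G \<cong>\<^sub>g H"
proof -
  define s where "s = k - 2"
  define n where "n = (m - k + 2) div 2"
  have km: "4 * k \<le> m" by (rule four_k_le_size[OF k m(2)])
  then have km': "k < m" using k by linarith
  have mn: "m = 2 * n + s" using even km' k unfolding n_def s_def by presburger
  have ks: "real k = real s + 2" using k by (simp add: s_def)
  have n0: "n > 0" using km k mn by (simp add: s_def)
  note b = bound_root[of "real n" "real s" "real k" "real m", folded bound_def]
  have b': "bound > 0" "bound\<^sup>2 \<ge> m - real s / 2" "bound\<^sup>2 \<ge> real n + s" "bound\<^sup>2 > n"
    "(bound\<^sup>2 - n - s) * (bound\<^sup>2 - n) = (real n)\<^sup>2"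
    using b n0 ks mn by auto
  show "\<rho> H = bound"
    unfolding H_def n_def[symmetric] s_def[symmetric]
    by (rule spectral_rad_star_K2[of _ _ "bound\<^sup>2 - real n"]) (use b' n0 in \<open>auto simp: algebra_simps\<close>)
  assume ge: "bound \<le> \<rho> G"
  then have sq: "bound\<^sup>2 \<le> (\<rho> G)\<^sup>2" using b'(1) by (intro power_mono) auto
  then have ms: "real m - (\<rho> G)\<^sup>2 \<le> real s / 2" using b'(2) by linarith
  obtain x u w where "two_hubs (pverts G) (parcs G) (k - 2) (\<rho> G) x u m w"
    by (rule two_hubs_of_large_spectral_radius[OF k G min m]) (use ge b'(1) ms in \<open>auto simp: s_def[symmetric]\<close>)
  then interpret two_hubs "pverts G" "parcs G" s "\<rho> G" x u m w by (simp add: s_def)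
  note st = no_extra_cost[OF ms]
  have c: "c = n" using st(3) mn by simp
  define q where "q = (\<rho> G)\<^sup>2 - n"
  define q0 where "q0 = bound\<^sup>2 - n"
  have q: "q0 \<le> q" "real s \<le> q0" "0 < q0" using sq b' by (auto simp: q_def q0_def)
  have q0: "(q0 - s) * q0 = (real n)\<^sup>2" using b'(5) by (simp add: q0_def algebra_simps)
  have "(q - a) * (q - b) = (real n)\<^sup>2" using st(5) by (simp add: q_def c)
  moreover have "(q - a) * (q - b) = (q - (real a + real b)) * q + real a * real b" by (simp add: algebra_simps)
  moreover have "real a + real b = s" using st(2) by linarith
  ultimately have "(q - s) * q + real a * real b = (q0 - s) * q0" using q0 by simp
  moreover have "(q - s) * q = (q0 - s) * q0 + (q - q0) * (q + q0 - s)" by (simp add: algebra_simps)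
  ultimately have z: "(q - q0) * (q + q0 - s) + real a * real b = 0" by simp
  have nn: "0 \<le> (q - q0) * (q + q0 - s)" using q by (intro mult_nonneg_nonneg) auto
  have "(q - q0) * (q + q0 - s) = 0" "real a * real b = 0" using z nn by (simp_all add: add_nonneg_eq_0_iff)
  then have "q = q0" and ab: "a = 0 \<or> b = 0" using q by auto
  then have "(\<rho> G)\<^sup>2 = bound\<^sup>2" by (simp add: q_def q0_def)
  then have eq: "\<rho> G = bound" using ge b'(1) by (simp add: power2_eq_iff)
  define K where "K = {u} \<times> A \<union> {w} \<times> B \<union> {u, w} \<times> P \<union> {}"
  have R: "parcs G = K \<union> K\<inverse>"
    by (rule R_sym_closure[OF K_def]) (use st(1) EF_iff in auto)
  have "G \<cong>\<^sub>g star_K2 s c"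
  proof (cases "b = 0")
    case True
    then have "B = {}" by simp
    then show ?thesis
      using iso_star_K2[OF G _ R, of u w A P] st(2,4) hub_distinct hub_nb(3) by (auto simp: K_def Un_ac)
  next
    case False
    then have "A = {}" using ab by simp
    then show ?thesis
      using iso_star_K2[OF G _ R, of w u B P] st(2,4) hub_distinct hub_nb(4)
      by (auto simp: K_def Un_ac insert_commute)
  qed
  then show "\<rho> G = bound \<and> G \<cong>\<^sub>g H" using eq by (simp add: H_def c n_def s_def)
qed

text \<open>
  The first lower bound on the spectral radius of \<open>H\<close> makes the structure theorem applicable to \<open>G\<close>. The
  inequality obtained for \<open>G\<close> then places the spectral radius of \<open>H\<close> at or above that of \<open>G\<close>, strictly
  above unless equality holds.
\<close>

lemma odd_extremal:
  fixes k m :: nat and G :: "'a pair_pre_digraph"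
  assumes k: "k \<ge> 2" and G: "pair_graph G" and min: "minimally_edge_connected k k G"
    and m: "m = graph_size G" "(432 * k)\<^sup>2 \<le> m" and odd: "odd (m + k)"
  defines "H \<equiv> star_K2_triangle (k - 2) ((m - k - 1) div 2)"
  assumes ge: "\<rho> H \<le> \<rho> G"
  shows "\<rho> G = \<rho> H \<and> G \<cong>\<^sub>g H"
proof -
  define s where "s = k - 2"
  define n where "n = (m - k - 1) div 2"
  have km: "4 * k \<le> m" by (rule four_k_le_size[OF k m(2)])
  then have km': "k < m" using k by linarith
  have mn: "m = 2 * n + s + 3" using odd km' k unfolding n_def s_def by presburger
  then have n0: "n > 0" using km k by (simp add: s_def)
  have H: "H = star_K2_triangle s n" by (simp add: H_def s_def n_def)
  \<comment> \<open>\<open>l0\<^sup>2 = m - s / 2 - 2\<close>, the bound that the structure theorem asks for\<close>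
  define l0 where "l0 = sqrt (2 * n + real s / 2 + 1)"
  have l0: "l0\<^sup>2 = 2 * n + real s / 2 + 1" by (simp add: l0_def)
  have "l0 > 1" unfolding l0_def by (rule real_less_rsqrt) (use n0 in simp)
  have "l0 \<le> \<rho> H" unfolding H
  proof (rule spectral_rad_star_K2_triangle_ge(1))
    define q where "q = l0\<^sup>2 - n"
    have q: "q = n + real s / 2 + 1" by (simp add: q_def l0)
    have "2 \<le> 2 * l0 / (l0 - 1)" using \<open>l0 > 1\<close> by (simp add: field_simps)
    then have "(q - s - 2 * l0 / (l0 - 1)) * q \<le> (q - s - 2) * q"
      by (intro mult_right_mono) (auto simp: q)
    also have "\<dots> = (real n)\<^sup>2 - (real s / 2 + 1)\<^sup>2" by (simp add: q power2_eq_square algebra_simps)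
    also have "\<dots> \<le> (real n)\<^sup>2" by simp
    finally show "(l0\<^sup>2 - n - s - 2 * l0 / (l0 - 1)) * (l0\<^sup>2 - n) \<le> (real n)\<^sup>2" by (simp add: q_def)
  qed (use \<open>l0 > 1\<close> n0 l0 in auto)
  then have lG: "l0 \<le> \<rho> G" using ge by simp
  then have "l0\<^sup>2 \<le> (\<rho> G)\<^sup>2" using \<open>l0 > 1\<close> by (intro power_mono) auto
  then have ms: "real m - (\<rho> G)\<^sup>2 \<le> real s / 2 + 2" using mn by (simp add: l0)
  obtain x u w where "two_hubs (pverts G) (parcs G) (k - 2) (\<rho> G) x u m w"
    by (rule two_hubs_of_large_spectral_radius[OF k G min m]) (use lG \<open>l0 > 1\<close> ms in \<open>auto simp: s_def[symmetric]\<close>)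
  then interpret two_hubs "pverts G" "parcs G" s "\<rho> G" x u m w by (simp add: s_def)
  have "odd (m + s)" using odd k by (simp add: s_def)
  then obtain z z' where z: "EF = {{z, z'}}" "z \<noteq> z'" "z \<in> A \<union> B" "z' \<in> A \<union> B" "a + b = s + 2" "m = 2 * c + s + 3"
    using odd_extra_structure[OF ms] by metis
  have c: "c = n" using z(6) mn by simp
  note o = odd_extremal_inequality[OF z(1-5), unfolded c]
  have l1: "\<rho> G > 1" using lG \<open>l0 > 1\<close> by simp
  have qn: "real n < (\<rho> G)\<^sup>2" using l_square_ge n0 by (simp add: c)
  note root = spectral_rad_star_K2_triangle_ge[OF l1 n0 qn o(2), folded H]
  have eq: "\<rho> G = \<rho> H" using root(1) ge by simp
  have "(((\<rho> G)\<^sup>2 - n) - s - 2 * \<rho> G / (\<rho> G - 1)) * ((\<rho> G)\<^sup>2 - n) = (real n)\<^sup>2"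
    using root(2) o(2) eq by fastforce
  note side = o(3)[OF this]
  define K where "K = {u} \<times> A \<union> {w} \<times> B \<union> {u, w} \<times> P \<union> {(z, z')}"
  have zz: "(z, z') \<in> parcs G" using z(1) EF_iff[of z z'] by simp
  have R: "parcs G = K \<union> K\<inverse>"
  proof (rule R_sym_closure[OF K_def])
    fix p q assume "(p, q) \<in> parcs G" "p \<in> Z" "q \<in> Z"
    then have "{p, q} = {z, z'}" using z(1) EF_iff[of p q] by simp
    then show "(p, q) \<in> {(z, z')} \<union> {(z, z')}\<inverse>" by (auto simp: doubleton_eq_iff)
  qed (use zz in simp)
  have "G \<cong>\<^sub>g star_K2_triangle s c"
    using side
  proof
    assume zA: "z \<in> A \<and> z' \<in> A \<and> B = {}"
    define L where "L = A - {z, z'}"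
    have L: "L \<subseteq> A" "z \<notin> L" "z' \<notin> L" by (auto simp: L_def)
    have AL: "A = L \<union> {z, z'}" using zA by (auto simp: L_def)
    have "card L = s" using zA z(2,5) by (simp add: L_def card_Diff_subset)
    moreover have "G \<cong>\<^sub>g star_K2_triangle (card L) (card P)"
    proof (rule iso_star_K2_triangle[OF G _ R, of u w L P z z'])
      show "pverts G = {u, w} \<union> L \<union> P \<union> {z, z'}"
        using o(1) zA unfolding AL by blast
      show "K = {u} \<times> L \<union> {u, w} \<times> P \<union> {(u, z), (u, z'), (z, z')}"
        unfolding K_def using zA AL by blast
      show "u \<noteq> w" "{u, w} \<inter> P = {}" "z \<noteq> z'" using hub_distinct(1,4) z(2) by auto
      show "{u, w} \<inter> L = {}" using hub_distinct(2) L(1) by blast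
      show "L \<inter> P = {}" using hub_nb(3) L(1) by blast
      have "{z, z'} \<inter> ({u, w} \<union> P) = {}" using hub_distinct(2) hub_nb(3) zA by blast
      then show "z \<notin> {u, w} \<union> L \<union> P" "z' \<notin> {u, w} \<union> L \<union> P" using L(2,3) by auto
    qed
    ultimately show ?thesis by simp
  next
    assume zB: "z \<in> B \<and> z' \<in> B \<and> A = {}"
    define L where "L = B - {z, z'}"
    have L: "L \<subseteq> B" "z \<notin> L" "z' \<notin> L" by (auto simp: L_def)
    have BL: "B = L \<union> {z, z'}" using zB by (auto simp: L_def)
    have "card L = s" using zB z(2,5) by (simp add: L_def card_Diff_subset)
    moreover have "G \<cong>\<^sub>g star_K2_triangle (card L) (card P)"
    proof (rule iso_star_K2_triangle[OF G _ R, of w u L P z z'])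
      show "pverts G = {w, u} \<union> L \<union> P \<union> {z, z'}"
        using o(1) zB unfolding BL by blast
      show "K = {w} \<times> L \<union> {w, u} \<times> P \<union> {(w, z), (w, z'), (z, z')}"
        unfolding K_def using zB BL by blast
      show "w \<noteq> u" "{w, u} \<inter> P = {}" "z \<noteq> z'" using hub_distinct(1,4) z(2) by auto
      show "{w, u} \<inter> L = {}" using hub_distinct(3) L(1) by blast
      show "L \<inter> P = {}" using hub_nb(4) L(1) by blast
      have "{z, z'} \<inter> ({w, u} \<union> P) = {}" using hub_distinct(3) hub_nb(4) zB by blast
      then show "z \<notin> {w, u} \<union> L \<union> P" "z' \<notin> {w, u} \<union> L \<union> P" using L(2,3) by auto
    qed
    ultimately show ?thesis by simp
  qed
  then show ?thesis using eq by (simp add: H c)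
qed

theorem theorem2:
  fixes k m :: nat and G :: "'a pair_pre_digraph"
  assumes "k \<ge> 2"
    and "pair_graph G"
    and "minimally_edge_connected k k G"
    and "m = graph_size G"
    and "m \<ge> (432 * k)\<^sup>2"
  shows "((int m - int k) mod 2 = 0 \<longrightarrow>
      (let bound = sqrt (2 * real m + 2 * sqrt (2 * (real k)\<^sup>2 - 2 * real k * real m
                     + (real m)\<^sup>2 - 8 * real k + 4 * real m + 8)) / 2
       in \<rho> G \<le> bound \<and>
          (\<rho> G = bound \<longleftrightarrow> G \<cong>\<^sub>g star_K2 (k - 2) ((m - k + 2) div 2)))) \<and>
    ((int m - int k) mod 2 = 1 \<longrightarrow>
      (let H = star_K2_triangle (k - 2) ((m - k - 1) div 2)
       in \<rho> G \<le> \<rho> H \<and> (\<rho> G = \<rho> H \<longleftrightarrow> G \<cong>\<^sub>g H)))"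
proof (intro conjI impI)
  assume "(int m - int k) mod 2 = 0"
  then have "even (m + k)" by presburger
  note ex = even_extremal[OF assms this]
  show "let bound = sqrt (2 * real m + 2 * sqrt (2 * (real k)\<^sup>2 - 2 * real k * real m
                     + (real m)\<^sup>2 - 8 * real k + 4 * real m + 8)) / 2
       in \<rho> G \<le> bound \<and>
          (\<rho> G = bound \<longleftrightarrow> G \<cong>\<^sub>g star_K2 (k - 2) ((m - k + 2) div 2))"
    unfolding Let_def
    using ex spectral_rad_iso[OF assms(2) pair_graph_star_K2] by (metis order_refl linear)
next
  assume "(int m - int k) mod 2 = 1"
  then have "odd (m + k)" by presburger
  note ex = odd_extremal[OF assms this]
  show "let H = star_K2_triangle (k - 2) ((m - k - 1) div 2)
       in \<rho> G \<le> \<rho> H \<and> (\<rho> G = \<rho> H \<longleftrightarrow> G \<cong>\<^sub>g H)"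
    unfolding Let_def
    using ex spectral_rad_iso[OF assms(2) pair_graph_star_K2_triangle] by (metis order_refl linear)
qed

end
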